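(* Let $s\geq 3$ and $u^{in}\in H^s(\mathbb T^3)\cap V$. For each $\alpha>0$ let $u_\alpha$ be the solution of the Euler-Voigt equations with parameter $\alpha$ and initial data $u_\alpha(0)=u^{in}$. Suppose there exists a finite time $T^{**}>0$ such that $$\sup_{t\in[0,T^{**})}\ \limsup_{\alpha\to0}\ \alpha^2\|\nabla u_\alpha(t)\|^2_{L^2(\mathbb T^3)}>0.$$ Then the Euler equations with initial data $u^{in}$ develop a singularity in the interval $[0,T^{**}]$; that is, there is no solution $u\in C([0,T^{**}],H^s(\mathbb T^3)\cap V)\cap C^1([0,T^{**}],H^{s-1}(\mathbb T^3)\cap V)$ of the Euler equations with $u(0)=u^{in}$.
   Context: $\mathbb T^3=[0,1]^3$ is the periodic unit torus. $L^2$ and $H^s$ are the usual Lebesgue and Sobolev spaces on $\mathbb T^3$. $\mathcal V$ is the set of $\mathbb R^3$-valued trigonometric polynomials $\varphi$ on $\mathbb T^3$ with $\nabla\cdot\varphi=0$ and $\int_{\mathbb T^3}\varphi\,dx=0$. $H$ and $V$ are the closures of $\mathcal V$ in $L^2$ and $H^1$, respectively, and $V'$ is the dual of $V$. Euler equations (periodic boundary conditions, zero forcing): $\partial_tu+(u\cdot\nabla)u+\nabla p=0$, $\nabla\cdot u=0$, $u(0)=u^{in}$. For $u^{in}\in H^s\cap V$, $s>5/2$, it is known that a unique solution in $C([0,T_*],H^s\cap V)\cap C^1([0,T_*],H^{s-1}\cap V)$ exists for some $T_*>0$. Euler-Voigt equations with parameter $\alpha>0$ (periodic boundary conditions, zero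 forcing): $-\alpha^2\partial_t\triangle u_\alpha+\partial_tu_\alpha+(u_\alpha\cdot\nabla)u_\alpha+\nabla p_\alpha=0$, $\nabla\cdot u_\alpha=0$; in functional form, $(I+\alpha^2A)\frac{du_\alpha}{dt}+B(u_\alpha,u_\alpha)=0$ in $V'$, where $P_\sigma:L^2\to H$ is the Leray-Helmholtz projection, $A=-P_\sigma\triangle$ and $B(w_1,w_2)=P_\sigma((w_1\cdot\nabla)w_2)$ (extended continuously to $V\times V\to V'$). For initial data in $V$ there is a unique solution $u_\alpha\in C^1((-\infty,\infty),V)$. *)

theory Defs
  imports "HOL-Analysis.Analysis"
begin

text \<open>
  A function on the torus is represented by a function on \<open>\<real>\<^sup>3\<close> of which only the values on the
  unit cube, up to null sets, matter.  Function spaces are sets of such representatives; their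
  norms are seminorms on representatives whose kernel is equality almost everywhere.
\<close>

type_synonym vfield = "real^3 \<Rightarrow> real^3"

definition torus :: "(real^3) measure" where
  "torus = lebesgue_on (cbox 0 1)"


subsection \<open>Lebesgue and Sobolev spaces\<close>

definition L2 :: "(real^3 \<Rightarrow> 'b::euclidean_space) set" where
  "L2 = {f. f \<in> borel_measurable torus \<and> integrable torus (\<lambda>x. (norm (f x))\<^sup>2)}"

definition L2_inner :: "(real^3 \<Rightarrow> 'b::euclidean_space) \<Rightarrow> (real^3 \<Rightarrow> 'b) \<Rightarrow> real" where
  "L2_inner f g = (LINT x|torus. f x \<bullet> g x)"

definition L2_norm :: "(real^3 \<Rightarrow> 'b::euclidean_space) \<Rightarrow> real" where
  "L2_norm f = sqrt (LINT x|torus. (norm (f x))\<^sup>2)"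

definition wavevector :: "int^3 \<Rightarrow> real^3" where
  "wavevector k = (\<chi> i. 2 * pi * real_of_int (k $ i))"

definition fourier_coeff :: "vfield \<Rightarrow> int^3 \<Rightarrow> complex^3" where
  "fourier_coeff f k =
     (\<chi> j. LINT x|torus. complex_of_real (f x $ j) * cis (- (wavevector k \<bullet> x)))"

text \<open>
  Sobolev spaces of arbitrary real order \<open>s \<ge> 0\<close>.  With this normalisation of the weight,
  \<open>Hs_norm 0\<close> is the \<open>L\<^sup>2\<close> norm and \<open>(Hs_norm 1 f)\<^sup>2 = \<parallel>f\<parallel>\<^sup>2 + \<parallel>\<nabla>f\<parallel>\<^sup>2\<close>.
  The norm is only meaningful on members of \<open>Hs s\<close>, since \<open>infsum\<close> is 0 on non-summable families.
\<close>

definition Hs :: "real \<Rightarrow> vfield set" where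
  "Hs s = {f \<in> L2. (\<lambda>k. (1 + (norm (wavevector k))\<^sup>2) powr s * (norm (fourier_coeff f k))\<^sup>2)
                     summable_on UNIV}"

definition Hs_norm :: "real \<Rightarrow> vfield \<Rightarrow> real" where
  "Hs_norm s f =
     sqrt (\<Sum>\<^sub>\<infinity>k. (1 + (norm (wavevector k))\<^sup>2) powr s * (norm (fourier_coeff f k))\<^sup>2)"


subsection \<open>Trigonometric polynomials and weak derivatives\<close>

definition trig_poly :: "(real^3 \<Rightarrow> 'b::euclidean_space) \<Rightarrow> bool" where
  "trig_poly f \<longleftrightarrow> (\<exists>K a b. finite K \<and>
     f = (\<lambda>x. \<Sum>k\<in>K. cos (wavevector k \<bullet> x) *\<^sub>R a k + sin (wavevector k \<bullet> x) *\<^sub>R b k))"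

definition classical_partial ::
    "3 \<Rightarrow> (real^3 \<Rightarrow> 'b::euclidean_space) \<Rightarrow> real^3 \<Rightarrow> 'b" where
  "classical_partial i f x = frechet_derivative f (at x) (axis i 1)"

text \<open>
  Square-integrable distributional derivatives on the torus.  Testing against trigonometric
  polynomials suffices, as these are dense in the smooth periodic functions.
\<close>

definition has_weak_partial ::
    "3 \<Rightarrow> (real^3 \<Rightarrow> 'b::euclidean_space) \<Rightarrow> (real^3 \<Rightarrow> 'b) \<Rightarrow> bool" where
  "has_weak_partial i f g \<longleftrightarrow> f \<in> L2 \<and> g \<in> L2 \<and>
     (\<forall>\<theta> :: real^3 \<Rightarrow> real. trig_poly \<theta> \<longrightarrow>
        (LINT x|torus. classical_partial i \<theta> x *\<^sub>R f x) = - (LINT x|torus. \<theta> x *\<^sub>R g x))"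

definition weak_partial ::
    "3 \<Rightarrow> (real^3 \<Rightarrow> 'b::euclidean_space) \<Rightarrow> real^3 \<Rightarrow> 'b" where
  "weak_partial i f = (SOME g. has_weak_partial i f g)"

definition grad_L2_norm :: "vfield \<Rightarrow> real" where
  "grad_L2_norm f = sqrt (\<Sum>i\<in>UNIV. (L2_norm (weak_partial i f))\<^sup>2)"

definition advect :: "vfield \<Rightarrow> vfield \<Rightarrow> vfield" where
  "advect w1 w2 x = (\<Sum>i\<in>UNIV. (w1 x $ i) *\<^sub>R weak_partial i w2 x)"

definition laplacian :: "vfield \<Rightarrow> vfield" where
  "laplacian w x = (\<Sum>i\<in>UNIV. weak_partial i (weak_partial i w) x)"


subsection \<open>Solenoidal spaces and the operators of the functional setting\<close>

definition Vpoly :: "vfield set" where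
  "Vpoly = {\<phi>. trig_poly \<phi> \<and> (\<forall>x. (\<Sum>i\<in>UNIV. classical_partial i \<phi> x $ i) = 0) \<and>
               (LINT x|torus. \<phi> x) = 0}"

definition Hspace :: "vfield set" where
  "Hspace = {f \<in> L2. \<forall>\<epsilon>>0. \<exists>\<phi>\<in>Vpoly. L2_norm (\<lambda>x. f x - \<phi> x) < \<epsilon>}"

definition Vspace :: "vfield set" where
  "Vspace = {f \<in> Hs 1. \<forall>\<epsilon>>0. \<exists>\<phi>\<in>Vpoly. Hs_norm 1 (\<lambda>x. f x - \<phi> x) < \<epsilon>}"

text \<open>The orthogonal projection of \<open>L\<^sup>2\<close> onto \<open>H\<close>.\<close>

definition leray :: "vfield \<Rightarrow> vfield" where
  "leray f = (SOME h. h \<in> Hspace \<and> (\<forall>g\<in>Hspace. L2_inner (\<lambda>x. f x - h x) g = 0))"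

definition linear_on_V :: "(vfield \<Rightarrow> real) \<Rightarrow> bool" where
  "linear_on_V F \<longleftrightarrow>
     (\<forall>f\<in>Vspace. \<forall>g\<in>Vspace. F (\<lambda>x. f x + g x) = F f + F g) \<and>
     (\<forall>c. \<forall>f\<in>Vspace. F (\<lambda>x. c *\<^sub>R f x) = c * F f)"

text \<open>
  Elements of \<open>V'\<close> are functionals of which only the values on \<open>V\<close> matter, and \<open>H\<close> is embedded
  in \<open>V'\<close> by \<open>h \<mapsto> L2_inner h\<close>.  The operators \<open>A : V \<rightarrow> V'\<close> and \<open>B : V \<times> V \<rightarrow> V'\<close> are the
  continuous extensions of \<open>- P\<^sub>\<sigma> \<Delta>\<close> and \<open>P\<^sub>\<sigma> ((w\<^sub>1 \<cdot> \<nabla>) w\<^sub>2)\<close> from trigonometric polynomials; a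
  linear or bilinear map into \<open>V'\<close> is continuous iff it is bounded.  The bounds below combine this
  boundedness with that of the individual functionals.
\<close>

definition extends_A :: "(vfield \<Rightarrow> vfield \<Rightarrow> real) \<Rightarrow> bool" where
  "extends_A F \<longleftrightarrow>
     (\<forall>w\<in>Vspace. linear_on_V (F w)) \<and>
     (\<forall>\<phi>\<in>Vspace. linear_on_V (\<lambda>w. F w \<phi>)) \<and>
     (\<exists>C. \<forall>w\<in>Vspace. \<forall>\<phi>\<in>Vspace. \<bar>F w \<phi>\<bar> \<le> C * Hs_norm 1 w * Hs_norm 1 \<phi>) \<and>
     (\<forall>w\<in>Vpoly. \<forall>\<phi>\<in>Vspace. F w \<phi> = L2_inner (leray (\<lambda>x. - laplacian w x)) \<phi>)"

definition A_op :: "vfield \<Rightarrow> vfield \<Rightarrow> real" where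
  "A_op = (SOME F. extends_A F)"

definition extends_B :: "(vfield \<Rightarrow> vfield \<Rightarrow> vfield \<Rightarrow> real) \<Rightarrow> bool" where
  "extends_B F \<longleftrightarrow>
     (\<forall>w1\<in>Vspace. \<forall>w2\<in>Vspace. linear_on_V (F w1 w2)) \<and>
     (\<forall>w2\<in>Vspace. \<forall>\<phi>\<in>Vspace. linear_on_V (\<lambda>w1. F w1 w2 \<phi>)) \<and>
     (\<forall>w1\<in>Vspace. \<forall>\<phi>\<in>Vspace. linear_on_V (\<lambda>w2. F w1 w2 \<phi>)) \<and>
     (\<exists>C. \<forall>w1\<in>Vspace. \<forall>w2\<in>Vspace. \<forall>\<phi>\<in>Vspace.
        \<bar>F w1 w2 \<phi>\<bar> \<le> C * Hs_norm 1 w1 * Hs_norm 1 w2 * Hs_norm 1 \<phi>) \<and>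
     (\<forall>w1\<in>Vpoly. \<forall>w2\<in>Vpoly. \<forall>\<phi>\<in>Vspace. F w1 w2 \<phi> = L2_inner (leray (advect w1 w2)) \<phi>)"

definition B_op :: "vfield \<Rightarrow> vfield \<Rightarrow> vfield \<Rightarrow> real" where
  "B_op = (SOME F. extends_B F)"


subsection \<open>Curves in function spaces\<close>

text \<open>
  Continuity and continuous differentiability on \<open>J\<close> with values in the space \<open>X\<close> normed by \<open>N\<close>;
  derivatives at endpoints of \<open>J\<close> are one-sided.
\<close>

definition curve_C0 ::
    "real set \<Rightarrow> vfield set \<Rightarrow> (vfield \<Rightarrow> real) \<Rightarrow> (real \<Rightarrow> vfield) \<Rightarrow> bool" where
  "curve_C0 J X N u \<longleftrightarrow>
     (\<forall>t\<in>J. u t \<in> X \<and> ((\<lambda>\<tau>. N (\<lambda>x. u \<tau> x - u t x)) \<longlongrightarrow> 0) (at t within J))"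

definition curve_C1 ::
    "real set \<Rightarrow> vfield set \<Rightarrow> (vfield \<Rightarrow> real) \<Rightarrow> (real \<Rightarrow> vfield) \<Rightarrow> (real \<Rightarrow> vfield) \<Rightarrow> bool" where
  "curve_C1 J X N u u' \<longleftrightarrow> curve_C0 J X N u \<and> curve_C0 J X N u' \<and>
     (\<forall>t\<in>J. ((\<lambda>\<tau>. N (\<lambda>x. (1 / (\<tau> - t)) *\<^sub>R (u \<tau> x - u t x) - u' t x)) \<longlongrightarrow> 0)
              (at t within J))"


subsection \<open>The equations\<close>

text \<open>
  The constraint \<open>\<nabla> \<cdot> u = 0\<close> is contained in the requirement that \<open>u\<close> takes values in \<open>V\<close>.
\<close>

definition euler_solution :: "real \<Rightarrow> real \<Rightarrow> vfield \<Rightarrow> (real \<Rightarrow> vfield) \<Rightarrow> bool" where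
  "euler_solution s T uin u \<longleftrightarrow>
     curve_C0 {0..T} (Hs s \<inter> Vspace) (Hs_norm s) u \<and>
     (\<exists>u'. curve_C1 {0..T} (Hs (s - 1) \<inter> Vspace) (Hs_norm (s - 1)) u u' \<and>
        (\<forall>t\<in>{0..T}. \<exists>p :: real^3 \<Rightarrow> real. (\<forall>i. \<exists>g. has_weak_partial i p g) \<and>
           (AE x in torus. u' t x + advect (u t) (u t) x + (\<chi> i. weak_partial i p x) = 0))) \<and>
     (AE x in torus. u 0 x = uin x)"

definition euler_voigt_solution :: "real \<Rightarrow> vfield \<Rightarrow> (real \<Rightarrow> vfield) \<Rightarrow> bool" where
  "euler_voigt_solution \<alpha> uin u \<longleftrightarrow>
     (\<exists>u'. curve_C1 UNIV Vspace (Hs_norm 1) u u' \<and>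
        (\<forall>t. \<forall>\<phi>\<in>Vspace.
           L2_inner (u' t) \<phi> + \<alpha>\<^sup>2 * A_op (u' t) \<phi> + B_op (u t) (u t) \<phi> = 0)) \<and>
     (AE x in torus. u 0 x = uin x)"

end

theory Submission
  imports Defs
begin

text \<open>
  The statement is the contrapositive of an inviscid limit.  Suppose that \<open>v\<close> is a solution of the
  Euler equations on \<open>[0, T]\<close> that is continuous with values in \<open>H\<^sup>s\<close>, \<open>s \<ge> 3\<close>.  Along the
  difference \<open>w = u\<^sub>\<alpha> - v\<close> the modulated energy \<open>E = \<parallel>w\<parallel>\<^sup>2 + \<alpha>\<^sup>2 \<parallel>\<nabla>w\<parallel>\<^sup>2\<close> satisfies
  \<open>E' \<le> a E + b \<alpha>\<^sup>2\<close> with \<open>a\<close> and \<open>b\<close> independent of \<open>\<alpha>\<close>, and it vanishes at time zero.  Gronwall's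
  inequality gives \<open>E \<le> C \<alpha>\<^sup>2\<close>.  Since \<open>E\<close> contains \<open>\<alpha>\<^sup>2 \<parallel>\<nabla>w\<parallel>\<^sup>2\<close>, the gradients \<open>\<nabla>u\<^sub>\<alpha>(t)\<close> are bounded
  in \<open>L\<^sup>2\<close> uniformly in \<open>\<alpha>\<close> (\<open>voigt_gradient_bound\<close>), so \<open>\<alpha>\<^sup>2 \<parallel>\<nabla>u\<^sub>\<alpha>(t)\<parallel>\<^sup>2\<close> tends to zero for every \<open>t\<close>
  and the supremum in the hypothesis cannot be positive.

  The differential inequality (\<open>modulated_energy_inequality\<close>) comes from testing the difference of
  the two equations with \<open>w\<close>.  The pressure disappears because gradients are orthogonal to \<open>V\<close>.  Of
  the advection terms only \<open>((w \<cdot> \<nabla>) v, w)\<close> is left, because \<open>((u\<^sub>\<alpha> \<cdot> \<nabla>) w, w) = 0\<close>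
  (\<open>advect_cancel\<close>); it is at most \<open>\<parallel>\<nabla>v\<parallel>\<^sub>\<infinity> \<parallel>w\<parallel>\<^sup>2\<close>, and \<open>\<nabla>v\<close> is bounded because three derivatives
  in \<open>L\<^sup>2\<close> make the Fourier coefficients of \<open>\<nabla>v\<close> absolutely summable
  (\<open>weak_partial_bounded\<close>).  The remaining term \<open>\<alpha>\<^sup>2 (\<nabla>v', \<nabla>w)\<close> is split by Young's inequality.

  Most of the work lies in giving these manipulations a meaning.  The operators \<open>A\<close> and \<open>B\<close> are
  known only as extensions from trigonometric polynomials, so it must be shown that extensions exist
  and are unique.  For \<open>A\<close> the extension is the Dirichlet form (\<open>A_op_eq\<close>), for \<open>B\<close> the integral
  of \<open>(w\<^sub>1 \<cdot> \<nabla>) w\<^sub>2 \<bullet> \<phi>\<close> (\<open>B_op_eq\<close>).  That integral is controlled by \<open>H\<^sup>1\<close> norms because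
  \<open>H\<^sup>1\<close> embeds into \<open>L\<^sup>4\<close> (\<open>vfield_square_L2\<close>).  Both embeddings rest on the convergence of
  \<open>\<Sum>k. (1 + \<bar>k\<bar>\<^sup>2)\<^sup>-\<^sup>2\<close> over the three-dimensional lattice and on Cauchy-Schwarz.  Weak derivatives
  and the Fourier description of the Sobolev norms come from Parseval's identity, which is derived
  from the completeness of \<open>L\<^sup>2\<close> and the Stone-Weierstrass theorem.
\<close>

section \<open>The space of square-integrable functions\<close>

lemma space_torus [simp]: "space torus = cbox 0 1"
  by (simp add: torus_def)

lemma emeasure_torus: "emeasure torus (space torus) = 1"
proof -
  have "emeasure torus (space torus) = emeasure lebesgue (cbox 0 (1::real^3))"
    unfolding torus_def by (subst emeasure_restrict_space) auto
  also have "\<dots> = 1"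
    by (auto simp: emeasure_lborel_cbox_eq Basis_vec_def inner_axis inner_axis' intro!: prod.neutral)
  finally show ?thesis .
qed

interpretation torus: finite_measure torus
  by standard (simp add: emeasure_torus del: space_torus)

lemma measure_torus [simp]: "measure torus (cbox 0 1) = 1"
  using emeasure_torus by (simp add: measure_def)

lemma borel_measurable_torusI:
  "f \<in> borel_measurable borel \<Longrightarrow> f \<in> borel_measurable torus"
  unfolding torus_def by (intro measurable_restrict_space1) (simp add: measurable_completion)

lemma continuous_measurable_torus:
  "continuous_on UNIV f \<Longrightarrow> f \<in> borel_measurable torus"
  by (intro borel_measurable_torusI borel_measurable_continuous_onI)

lemma L2_measurable [measurable_dest]: "f \<in> L2 \<Longrightarrow> f \<in> borel_measurable torus"
  by (simp add: L2_def)

lemma L2_integrable_sq: "f \<in> L2 \<Longrightarrow> integrable torus (\<lambda>x. (norm (f x))\<^sup>2)"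
  by (simp add: L2_def)

lemma L2_dominated:
  assumes "g \<in> L2" "f \<in> borel_measurable torus" "AE x in torus. norm (f x) \<le> norm (g x)"
  shows "f \<in> L2"
proof -
  have "integrable torus (\<lambda>x. (norm (f x))\<^sup>2)"
    using L2_integrable_sq[OF assms(1)]
  proof (rule Bochner_Integration.integrable_bound)
    show "(\<lambda>x. (norm (f x))\<^sup>2) \<in> borel_measurable torus"
      using assms by measurable
    show "AE x in torus. norm ((norm (f x))\<^sup>2) \<le> norm ((norm (g x))\<^sup>2)"
      using assms(3) by eventually_elim (simp add: power_mono)
  qed
  then show ?thesis using assms by (simp add: L2_def)
qed

lemma L2_bounded:
  assumes "f \<in> borel_measurable torus" "AE x in torus. norm (f x) \<le> M"
  shows "f \<in> L2"
proof -
  have "integrable torus (\<lambda>x. (norm (f x))\<^sup>2)"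
  proof (rule torus.integrable_const_bound[where B="M\<^sup>2"])
    show "AE x in torus. norm ((norm (f x))\<^sup>2) \<le> M\<^sup>2"
      using assms(2) by eventually_elim (simp add: power_mono)
  qed (use assms in measurable)
  then show ?thesis using assms by (simp add: L2_def)
qed

lemma L2_product_integrable:
  assumes "f \<in> L2" "g \<in> L2"
  shows "integrable torus (\<lambda>x. norm (f x) * norm (g x))"
proof (rule Bochner_Integration.integrable_bound)
  show "integrable torus (\<lambda>x. (norm (f x))\<^sup>2 + (norm (g x))\<^sup>2)"
    using assms by (intro Bochner_Integration.integrable_add L2_integrable_sq)
  show "(\<lambda>x. norm (f x) * norm (g x)) \<in> borel_measurable torus"
    using assms by measurable
  have "norm (norm a * norm b) \<le> norm ((norm a)\<^sup>2 + (norm b)\<^sup>2)" for a :: 'a and b :: 'b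
    using sum_squares_bound[of "norm a" "norm b"] mult_nonneg_nonneg[OF norm_ge_zero norm_ge_zero, of a b]
    unfolding real_norm_def by linarith
  then show "AE x in torus. norm (norm (f x) * norm (g x)) \<le> norm ((norm (f x))\<^sup>2 + (norm (g x))\<^sup>2)"
    by auto
qed

lemma L2_inner_integrable:
  assumes "f \<in> L2" "g \<in> L2"
  shows "integrable torus (\<lambda>x. f x \<bullet> g x)"
  using L2_product_integrable[OF assms]
  by (rule Bochner_Integration.integrable_bound)
     (use assms in \<open>auto simp: Cauchy_Schwarz_ineq2\<close>)

lemma L2_zero [simp]: "(\<lambda>x. 0) \<in> L2"
  by (simp add: L2_def)

lemma L2_const [simp]: "(\<lambda>x. c) \<in> L2"
  by (rule L2_bounded[where M="norm c"]) auto

lemma L2_add [intro]: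
  assumes "f \<in> L2" "g \<in> L2" shows "(\<lambda>x. f x + g x) \<in> L2"
proof -
  have "integrable torus (\<lambda>x. (norm (f x))\<^sup>2 + (norm (g x))\<^sup>2 + 2 * (f x \<bullet> g x))"
    using assms by (intro Bochner_Integration.integrable_add L2_integrable_sq integrable_mult_right L2_inner_integrable)
  also have "(\<lambda>x. (norm (f x))\<^sup>2 + (norm (g x))\<^sup>2 + 2 * (f x \<bullet> g x)) = (\<lambda>x. (norm (f x + g x))\<^sup>2)"
    by (rule ext) (simp add: power2_norm_eq_inner inner_add inner_commute)
  finally show ?thesis using assms by (auto simp: L2_def)
qed

lemma L2_bounded_linear:
  assumes "bounded_linear h" "f \<in> L2" shows "(\<lambda>x. h (f x)) \<in> L2"
proof -
  interpret bounded_linear h by fact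
  obtain K where K: "\<And>x. norm (h x) \<le> norm x * K" using bounded by blast
  have "(\<lambda>x. h (f x)) \<in> borel_measurable torus"
    using assms(2) by (intro borel_measurable_continuous_on[OF linear_continuous_on[OF assms(1)]]) (auto simp: L2_def)
  moreover have "integrable torus (\<lambda>x. K\<^sup>2 * (norm (f x))\<^sup>2)"
    using L2_integrable_sq[OF assms(2)] by simp
  then have "integrable torus (\<lambda>x. (norm (h (f x)))\<^sup>2)"
    by (rule Bochner_Integration.integrable_bound)
       (use calculation K in \<open>auto simp: mult.commute simp flip: power_mult_distrib intro!: power_mono\<close>)
  ultimately show ?thesis by (simp add: L2_def)
qed

lemma L2_scaleR [intro]: "f \<in> L2 \<Longrightarrow> (\<lambda>x. c *\<^sub>R f x) \<in> L2"
  by (rule L2_bounded_linear[OF bounded_linear_scaleR_right])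

lemma L2_uminus [intro]: "f \<in> L2 \<Longrightarrow> (\<lambda>x. - f x) \<in> L2"
  using L2_scaleR[of f "-1"] by simp

lemma L2_diff [intro]: "f \<in> L2 \<Longrightarrow> g \<in> L2 \<Longrightarrow> (\<lambda>x. f x - g x) \<in> L2"
  using L2_add[of f "\<lambda>x. - g x"] by (auto simp: L2_uminus)

lemma L2_sum [intro]: "(\<And>i. i \<in> I \<Longrightarrow> f i \<in> L2) \<Longrightarrow> (\<lambda>x. \<Sum>i\<in>I. f i x) \<in> L2"
  by (induction I rule: infinite_finite_induct) auto

lemma L2_mult_bounded:
  assumes "f \<in> L2" "\<theta> \<in> borel_measurable torus" "AE x in torus. \<bar>\<theta> x\<bar> \<le> M"
  shows "(\<lambda>x. \<theta> x *\<^sub>R f x) \<in> L2"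
proof (rule L2_dominated[OF L2_scaleR[OF assms(1), of M]])
  show "(\<lambda>x. \<theta> x *\<^sub>R f x) \<in> borel_measurable torus" using assms by measurable
  show "AE x in torus. norm (\<theta> x *\<^sub>R f x) \<le> norm (M *\<^sub>R f x)"
    using assms(3) by eventually_elim (auto intro!: mult_right_mono)
qed

lemma L2_integrable: "f \<in> L2 \<Longrightarrow> integrable torus f"
  using L2_product_integrable[of f "\<lambda>_. 1::real"]
  by (intro Bochner_Integration.integrable_bound[of torus "\<lambda>x. norm (f x)" f]) auto

lemma L2_cong_AE:
  assumes "f \<in> L2" "g \<in> borel_measurable torus" "AE x in torus. f x = g x" shows "g \<in> L2"
  by (rule L2_dominated[OF assms(1,2)]) (use assms(3) in auto)

subsection \<open>Inner product and norm\<close>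

lemma L2_norm_inner: "L2_norm f = sqrt (L2_inner f f)"
  by (simp add: L2_norm_def L2_inner_def power2_norm_eq_inner)

lemma L2_inner_nonneg [simp]: "0 \<le> L2_inner f f"
  by (auto simp: L2_inner_def intro!: integral_nonneg_AE)

lemma L2_norm_nonneg [simp]: "0 \<le> L2_norm f"
  by (simp add: L2_norm_inner)

lemma L2_norm_sq: "(L2_norm f)\<^sup>2 = L2_inner f f"
  by (simp add: L2_norm_inner)

lemma L2_inner_commute: "L2_inner f g = L2_inner g f"
  by (simp add: L2_inner_def inner_commute)

lemma L2_inner_add_left:
  "f \<in> L2 \<Longrightarrow> g \<in> L2 \<Longrightarrow> h \<in> L2 \<Longrightarrow> L2_inner (\<lambda>x. f x + g x) h = L2_inner f h + L2_inner g h"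
  by (simp add: L2_inner_def inner_add_left L2_inner_integrable)

lemma L2_inner_diff_left:
  "f \<in> L2 \<Longrightarrow> g \<in> L2 \<Longrightarrow> h \<in> L2 \<Longrightarrow> L2_inner (\<lambda>x. f x - g x) h = L2_inner f h - L2_inner g h"
  by (simp add: L2_inner_def inner_diff_left L2_inner_integrable)

lemma L2_inner_scaleR_left: "L2_inner (\<lambda>x. c *\<^sub>R f x) h = c * L2_inner f h"
  by (simp add: L2_inner_def)

lemma L2_inner_add_right:
  "f \<in> L2 \<Longrightarrow> g \<in> L2 \<Longrightarrow> h \<in> L2 \<Longrightarrow> L2_inner h (\<lambda>x. f x + g x) = L2_inner h f + L2_inner h g"
  by (simp add: L2_inner_def inner_add_right L2_inner_integrable)

lemma L2_inner_diff_right: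
  "f \<in> L2 \<Longrightarrow> g \<in> L2 \<Longrightarrow> h \<in> L2 \<Longrightarrow> L2_inner h (\<lambda>x. f x - g x) = L2_inner h f - L2_inner h g"
  by (simp add: L2_inner_def inner_diff_right L2_inner_integrable)

lemma L2_inner_scaleR_right: "L2_inner h (\<lambda>x. c *\<^sub>R f x) = c * L2_inner h f"
  by (simp add: L2_inner_def)

lemma L2_inner_sum_left:
  assumes "\<And>i. i \<in> I \<Longrightarrow> f i \<in> L2" "h \<in> L2"
  shows "L2_inner (\<lambda>x. \<Sum>i\<in>I. f i x) h = (\<Sum>i\<in>I. L2_inner (f i) h)"
  using assms by (simp add: L2_inner_def inner_sum_left L2_inner_integrable)

lemma L2_inner_cong_AE:
  assumes "f \<in> L2" "f' \<in> L2" "g \<in> L2" "g' \<in> L2"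
    "AE x in torus. f x = f' x" "AE x in torus. g x = g' x"
  shows "L2_inner f g = L2_inner f' g'"
  unfolding L2_inner_def
proof (rule integral_cong_AE)
  show "AE x in torus. f x \<bullet> g x = f' x \<bullet> g' x" using assms(5,6) by eventually_elim simp
qed (use assms in measurable)

lemma L2_Cauchy_Schwarz:
  assumes "f \<in> L2" "g \<in> L2"
  shows "\<bar>L2_inner f g\<bar> \<le> L2_norm f * L2_norm g"
proof -
  define a b c where "a = L2_inner f f" and "b = L2_inner f g" and "c = L2_inner g g"
  have q: "0 \<le> a * s\<^sup>2 - 2 * b * s * t + c * t\<^sup>2" for s t
  proof -
    have "0 \<le> L2_inner (\<lambda>x. s *\<^sub>R f x - t *\<^sub>R g x) (\<lambda>x. s *\<^sub>R f x - t *\<^sub>R g x)" by simp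
    also have "\<dots> = a * s\<^sup>2 - 2 * b * s * t + c * t\<^sup>2"
      using assms by (simp add: L2_inner_diff_left L2_inner_diff_right L2_inner_scaleR_left
          L2_inner_scaleR_right L2_scaleR L2_diff a_def b_def c_def L2_inner_commute[of g f] power2_eq_square algebra_simps)
    finally show ?thesis .
  qed
  have a: "0 \<le> a" and c: "0 \<le> c" by (simp_all add: a_def c_def)
  have "b\<^sup>2 \<le> a * c"
  proof (cases "c = 0")
    case True
    have "b = 0"
    proof (rule ccontr)
      assume "b \<noteq> 0"
      \<comment> \<open>with \<open>c = 0\<close> the form is affine in \<open>t\<close>, and this \<open>t\<close> gives it the value \<open>- 1\<close>\<close>
      have "0 \<le> a * 1\<^sup>2 - 2 * b * 1 * ((a + 1) / (2 * b)) + c * ((a + 1) / (2 * b))\<^sup>2" by (rule q)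
      then show False using \<open>b \<noteq> 0\<close> True by simp
    qed
    then show ?thesis using a c by simp
  next
    case False
    have "0 \<le> a * c\<^sup>2 - 2 * b * c * b + c * b\<^sup>2" by (rule q)
    then have "c * (b\<^sup>2) \<le> c * (a * c)" by (simp add: power2_eq_square algebra_simps)
    then show ?thesis using False c by (simp add: mult_le_cancel_left)
  qed
  then have "sqrt (b\<^sup>2) \<le> sqrt (a * c)" by (rule real_sqrt_le_mono)
  then show ?thesis by (simp add: L2_norm_inner a_def b_def c_def real_sqrt_mult)
qed

lemma L2_norm_triangle:
  assumes "f \<in> L2" "g \<in> L2"
  shows "L2_norm (\<lambda>x. f x + g x) \<le> L2_norm f + L2_norm g"
proof (rule power2_le_imp_le)
  have "(L2_norm (\<lambda>x. f x + g x))\<^sup>2 = L2_inner f f + 2 * L2_inner f g + L2_inner g g"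
    using assms by (simp add: L2_norm_sq L2_inner_add_left L2_inner_add_right L2_add L2_inner_commute[of g f])
  also have "\<dots> \<le> (L2_norm f + L2_norm g)\<^sup>2"
    using L2_Cauchy_Schwarz[OF assms] by (simp add: power2_sum L2_norm_sq)
  finally show "(L2_norm (\<lambda>x. f x + g x))\<^sup>2 \<le> (L2_norm f + L2_norm g)\<^sup>2" .
qed simp

lemma L2_norm_minus_commute: "L2_norm (\<lambda>x. f x - g x) = L2_norm (\<lambda>x. g x - f x)"
  by (simp add: L2_norm_def norm_minus_commute)

lemma L1_le_L2_norm:
  assumes "f \<in> L2" shows "(LINT x|torus. norm (f x)) \<le> L2_norm f"
proof -
  have "(\<lambda>x. norm (f x)) \<in> L2" by (rule L2_dominated[OF assms]) (use assms in auto)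
  from L2_Cauchy_Schwarz[OF this, of "\<lambda>_. 1"] show ?thesis
    by (simp add: L2_inner_def L2_norm_def)
qed

subsection \<open>Convergence and completeness\<close>

lemma L2_subseq_AE:
  assumes "\<And>n. f n \<in> L2" "F \<in> L2" "(\<lambda>n. L2_norm (\<lambda>x. f n x - F x)) \<longlonglongrightarrow> 0"
  obtains r :: "nat \<Rightarrow> nat" where "strict_mono r" "AE x in torus. (\<lambda>n. f (r n) x) \<longlonglongrightarrow> F x"
proof -
  have "(\<lambda>n. LINT x|torus. norm (f n x - F x)) \<longlonglongrightarrow> 0"
    by (rule Lim_null_comparison[OF _ assms(3)])
       (use assms L1_le_L2_norm[of "\<lambda>x. f _ x - F x"] in \<open>auto intro!: always_eventually simp: L2_diff\<close>)
  then obtain r where "strict_mono r" "AE x in torus. (\<lambda>n. f (r n) x - F x) \<longlonglongrightarrow> 0"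
    using tendsto_L1_AE_subseq[of torus "\<lambda>n x. f n x - F x"] assms by (auto simp: L2_integrable L2_diff)
  then show ?thesis by (intro that[of r]) (auto simp: LIM_zero_iff)
qed

text \<open>
  Along a subsequence with geometrically small increments the sum of the increments has a finite
  integral, so that subsequence converges almost everywhere.  Fatou's lemma then bounds the distance
  of every late member of the sequence from the pointwise limit.
\<close>

theorem L2_complete:
  fixes f :: "nat \<Rightarrow> real^3 \<Rightarrow> 'b::euclidean_space"
  assumes f: "\<And>n. f n \<in> L2"
    and Cauchy: "\<And>\<epsilon>. \<epsilon> > 0 \<Longrightarrow> \<exists>N. \<forall>m\<ge>N. \<forall>n\<ge>N. L2_norm (\<lambda>x. f m x - f n x) < \<epsilon>"
  obtains F where "F \<in> L2" "(\<lambda>n. L2_norm (\<lambda>x. f n x - F x)) \<longlonglongrightarrow> 0"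
proof -
  have "\<forall>j. \<exists>N. \<forall>m\<ge>N. \<forall>n\<ge>N. L2_norm (\<lambda>x. f m x - f n x) < (1/2)^j"
    using Cauchy by simp
  then obtain N where N: "\<And>j m n. m \<ge> N j \<Longrightarrow> n \<ge> N j \<Longrightarrow> L2_norm (\<lambda>x. f m x - f n x) < (1/2)^j"
    by metis
  \<comment> \<open>the sum makes \<open>r\<close> monotone while keeping \<open>N j \<le> r j\<close>\<close>
  define r where "r j = (\<Sum>i\<le>j. N i) + j" for j
  have rN: "r j \<ge> N j" for j
    unfolding r_def using member_le_sum[of j "{..j}" N] by simp
  have rSuc: "r j \<le> r (Suc j)" for j by (simp add: r_def)
  have rmono: "i \<le> j \<Longrightarrow> r i \<le> r j" for i j by (rule lift_Suc_mono_le[of r, OF rSuc])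
  have rid: "j \<le> r j" for j by (simp add: r_def)
  define d where "d j x = norm (f (r (Suc j)) x - f (r j) x)" for j x
  have dL2: "d j \<in> L2" for j
    unfolding d_def by (rule L2_dominated[of "\<lambda>x. f (r (Suc j)) x - f (r j) x"]) (use f in auto)
  have dint: "integrable torus (d j)" for j by (rule L2_integrable[OF dL2])
  have "(LINT x|torus. d j x) \<le> (1/2)^j" for j
  proof -
    have "(LINT x|torus. d j x) \<le> L2_norm (\<lambda>x. f (r (Suc j)) x - f (r j) x)"
      unfolding d_def by (rule L1_le_L2_norm) (use f in auto)
    also have "\<dots> \<le> (1/2)^j" using N[of j "r (Suc j)" "r j"] rN[of j] rSuc[of j] by simp
    finally show ?thesis .
  qed
  then have le: "(\<integral>\<^sup>+x. ennreal (d j x) \<partial>torus) \<le> ennreal ((1/2)^j)" for j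
    by (subst nn_integral_eq_integral[OF dint]) (auto simp: ennreal_leI, simp add: d_def)
  have "(\<integral>\<^sup>+x. (\<Sum>j. ennreal (d j x)) \<partial>torus) = (\<Sum>j. \<integral>\<^sup>+x. ennreal (d j x) \<partial>torus)"
    by (rule nn_integral_suminf) (use dL2 in measurable)
  also have "\<dots> \<le> (\<Sum>j. ennreal ((1/2)^j))" by (intro suminf_le le) auto
  also have "\<dots> = ennreal (\<Sum>j. (1/2)^j)" by (intro suminf_ennreal_eq) (auto intro!: summable_sums summable_geometric)
  also have "\<dots> < \<infinity>" by simp
  finally have "(\<integral>\<^sup>+x. (\<Sum>j. ennreal (d j x)) \<partial>torus) \<noteq> \<infinity>" by simp
  then have "AE x in torus. (\<Sum>j. ennreal (d j x)) \<noteq> \<infinity>"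
    by (intro nn_integral_PInf_AE) (use dL2 in measurable)
  then have conv: "AE x in torus. convergent (\<lambda>j. f (r j) x)"
  proof eventually_elim
    case (elim x)
    have "(\<Sum>j. ennreal (d j x)) \<noteq> top" using elim by simp
    then have "summable (\<lambda>j. d j x)"
      by (rule summable_suminf_not_top[rotated]) (simp add: d_def)
    then have "summable (\<lambda>j. f (r (Suc j)) x - f (r j) x)"
      unfolding d_def by (rule summable_norm_cancel)
    then obtain l where "(\<lambda>n. \<Sum>j<n. f (r (Suc j)) x - f (r j) x) \<longlonglongrightarrow> l"
      by (auto simp: summable_def sums_def)
    then have "(\<lambda>n. f (r n) x - f (r 0) x) \<longlonglongrightarrow> l"
      using sum_lessThan_telescope[of "\<lambda>j. f (r j) x"] by simp
    then have "(\<lambda>n. f (r n) x - f (r 0) x + f (r 0) x) \<longlonglongrightarrow> l + f (r 0) x"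
      by (intro tendsto_intros)
    then show ?case by (auto simp: convergent_def)
  qed
  define F where "F x = lim (\<lambda>j. f (r j) x)" for x
  have Fm: "F \<in> borel_measurable torus"
    unfolding F_def using f by (intro borel_measurable_lim_metric) auto
  have FL: "AE x in torus. (\<lambda>j. f (r j) x) \<longlonglongrightarrow> F x"
    using conv by eventually_elim (simp add: F_def convergent_LIMSEQ_iff)
  have key: "(\<integral>\<^sup>+x. ennreal ((norm (F x - f m x))\<^sup>2) \<partial>torus) \<le> ennreal (((1/2)^j)\<^sup>2)" if m: "m \<ge> N j" for m j
  proof -
    have "(\<integral>\<^sup>+x. ennreal ((norm (F x - f m x))\<^sup>2) \<partial>torus)
        \<le> (\<integral>\<^sup>+x. liminf (\<lambda>i. ennreal ((norm (f (r i) x - f m x))\<^sup>2)) \<partial>torus)"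
    proof (rule nn_integral_mono_AE)
      show "AE x in torus. ennreal ((norm (F x - f m x))\<^sup>2) \<le> liminf (\<lambda>i. ennreal ((norm (f (r i) x - f m x))\<^sup>2))"
        using FL
      proof eventually_elim
        case (elim x)
        have "(\<lambda>i. ennreal ((norm (f (r i) x - f m x))\<^sup>2)) \<longlonglongrightarrow> ennreal ((norm (F x - f m x))\<^sup>2)"
          by (intro tendsto_ennrealI tendsto_intros elim)
        from lim_imp_Liminf[OF _ this] show ?case by simp
      qed
    qed
    also have "\<dots> \<le> liminf (\<lambda>i. \<integral>\<^sup>+x. ennreal ((norm (f (r i) x - f m x))\<^sup>2) \<partial>torus)"
      by (rule nn_integral_liminf) (use f in measurable)
    also have "\<dots> \<le> ennreal (((1/2)^j)\<^sup>2)"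
    proof (rule Liminf_le)
      have "(\<integral>\<^sup>+x. ennreal ((norm (f (r i) x - f m x))\<^sup>2) \<partial>torus) \<le> ennreal (((1/2)^j)\<^sup>2)" if "i \<ge> j" for i
      proof -
        have L: "(\<lambda>x. f (r i) x - f m x) \<in> L2" using f by auto
        have "(\<integral>\<^sup>+x. ennreal ((norm (f (r i) x - f m x))\<^sup>2) \<partial>torus) = ennreal ((L2_norm (\<lambda>x. f (r i) x - f m x))\<^sup>2)"
          by (subst nn_integral_eq_integral[OF L2_integrable_sq[OF L]]) (auto simp: L2_norm_def)
        also have "\<dots> \<le> ennreal (((1/2)^j)\<^sup>2)"
          using N[of j "r i" m] m rN[of j] rmono[OF that]
          by (intro ennreal_leI power_mono) auto
        finally show ?thesis .
      qed
      then show "\<forall>\<^sub>F i in sequentially. (\<integral>\<^sup>+x. ennreal ((norm (f (r i) x - f m x))\<^sup>2) \<partial>torus) \<le> ennreal (((1/2)^j)\<^sup>2)"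
        by (auto simp: eventually_sequentially)
    qed simp
    finally show ?thesis .
  qed
  have diffL2: "(\<lambda>x. F x - f m x) \<in> L2" if "m \<ge> N j" for m j
    using key[OF that] Fm f[of m]
    by (auto simp: L2_def integrable_iff_bounded intro: le_less_trans)
  have F: "F \<in> L2" using L2_add[OF diffL2[of 0 "N 0"] f[of "N 0"]] by simp
  moreover have "(\<lambda>n. L2_norm (\<lambda>x. f n x - F x)) \<longlonglongrightarrow> 0"
  proof (rule LIMSEQ_I)
    fix e :: real assume "e > 0"
    then obtain j where j: "(1/2)^j < e" using real_arch_pow_inv[of e "1/2"] by auto
    have "norm (L2_norm (\<lambda>x. f n x - F x) - 0) < e" if "n \<ge> N j" for n
    proof -
      have "ennreal ((L2_norm (\<lambda>x. F x - f n x))\<^sup>2) \<le> ennreal (((1/2)^j)\<^sup>2)"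
        using key[OF that] by (subst (asm) nn_integral_eq_integral[OF L2_integrable_sq[OF diffL2[OF that]]]) (auto simp: L2_norm_def)
      then have "(L2_norm (\<lambda>x. F x - f n x))\<^sup>2 \<le> ((1/2)^j)\<^sup>2" by simp
      then have "L2_norm (\<lambda>x. F x - f n x) \<le> (1/2)^j" by (rule power2_le_imp_le) simp
      then show ?thesis using j by (simp add: L2_norm_minus_commute)
    qed
    then show "\<exists>no. \<forall>n\<ge>no. norm (L2_norm (\<lambda>x. f n x - F x) - 0) < e" by blast
  qed
  ultimately show ?thesis using that by blast
qed

section \<open>Trigonometric polynomials\<close>

subsection \<open>Integrals of the modes\<close>

lemma wavevector_0 [simp]: "wavevector 0 = 0"
  by (simp add: wavevector_def vec_eq_iff)

lemma wavevector_add: "wavevector (k + l) = wavevector k + wavevector l"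
  by (simp add: wavevector_def vec_eq_iff algebra_simps)

lemma wavevector_uminus: "wavevector (- k) = - wavevector k"
  by (simp add: wavevector_def vec_eq_iff)

lemma wavevector_diff: "wavevector (k - l) = wavevector k - wavevector l"
  by (simp add: wavevector_def vec_eq_iff algebra_simps)

lemma wavevector_nth: "wavevector k $ i = 2 * pi * of_int (k $ i)"
  by (simp add: wavevector_def)

lemma wavevector_eq_0_iff [simp]: "wavevector k = 0 \<longleftrightarrow> k = 0"
  by (simp add: wavevector_def vec_eq_iff)

lemma integral_torus_lborel:
  fixes g :: "real^3 \<Rightarrow> 'b::euclidean_space"
  assumes "g \<in> borel_measurable borel"
  shows "(LINT x|torus. g x) = (LINT x|lborel. indicator (cbox 0 1) x *\<^sub>R g x)"
proof -
  have "(LINT x|torus. g x) = (LINT x|lebesgue. indicator (cbox 0 1) x *\<^sub>R g x)"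
    unfolding torus_def by (rule integral_restrict_space) simp
  also have "\<dots> = (LINT x|lborel. indicator (cbox 0 1) x *\<^sub>R g x)"
    by (rule integral_completion) (use assms in measurable)
  finally show ?thesis .
qed

lemma integral_cis_unit_interval:
  fixes m :: int
  assumes "m \<noteq> 0"
  shows "(LINT t|lborel. indicator {0..1} t *\<^sub>R cis (2 * pi * of_int m * t)) = 0"
proof -
  define c where "c = 2 * pi * of_int m"
  have c: "c \<noteq> 0" using assms by (simp add: c_def)
  have "(LINT t|lborel. indicator {0..1} t *\<^sub>R cis (c * t))
      = - \<i> / c * cis (c * 1) - (- \<i> / c * cis (c * 0))"
  proof (rule integral_FTC_Icc)
    fix t
    have "((\<lambda>t. - \<i> / c * exp (t *\<^sub>R (\<i> * c))) has_vector_derivative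
        - \<i> / c * (exp (t *\<^sub>R (\<i> * c)) * (\<i> * c))) (at t within {0..1})"
      by (intro has_vector_derivative_mult_right exp_scaleR_has_vector_derivative_right)
    moreover have "exp (t *\<^sub>R (\<i> * c)) = cis (c * t)" for t
      by (simp add: cis_conv_exp scaleR_conv_of_real mult_ac)
    ultimately have "((\<lambda>t. - \<i> / c * cis (c * t)) has_vector_derivative
        - \<i> / c * (cis (c * t) * (\<i> * c))) (at t within {0..1})" by simp
    moreover have "- \<i> / c * (cis (c * t) * (\<i> * c)) = cis (c * t)"
      using c by (simp add: field_simps)
    ultimately show "((\<lambda>t. - \<i> / c * cis (c * t)) has_vector_derivative cis (c * t)) (at t within {0..1})"
      by (simp only:)
  qed (auto intro!: continuous_intros)
  moreover have "cis (c * 1) = 1"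
    by (metis c_def cis_multiple_2pi Ints_of_int mult.right_neutral)
  ultimately show ?thesis by (simp add: c_def)
qed

text \<open>
  Lebesgue measure is a product measure, so the integral is a product of three one-dimensional
  integrals; a nonzero component of the wave vector makes one of them an integral over full periods.
\<close>

lemma integral_torus_cis:
  "(LINT x|torus. cis (wavevector k \<bullet> x)) = (if k = 0 then 1 else 0)"
proof (cases "k = 0")
  case True
  then show ?thesis by simp
next
  case False
  then obtain i where i: "k $ i \<noteq> 0" by (auto simp: vec_eq_iff)
  define \<psi> :: "real^3 \<Rightarrow> real \<Rightarrow> complex"
    where "\<psi> b t = indicator {0..1} t *\<^sub>R cis ((wavevector k \<bullet> b) * t)" for b t
  interpret product_sigma_finite "\<lambda>_::real^3. lborel :: real measure" ..
  have split: "indicator (cbox 0 1) x *\<^sub>R cis (wavevector k \<bullet> x) = (\<Prod>b\<in>Basis. \<psi> b (x \<bullet> b))" for x :: "real^3"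
  proof -
    have "x \<in> cbox 0 1 \<longleftrightarrow> (\<forall>b\<in>Basis. x \<bullet> b \<in> {0..1})"
      by (auto simp: mem_box Basis_vec_def inner_axis inner_axis')
    then have "indicator (cbox 0 1) x = (\<Prod>b\<in>Basis. indicator {0..1} (x \<bullet> b) :: real)"
      by (auto simp: indicator_def prod_zero_iff)
    moreover have "cis (wavevector k \<bullet> x) = (\<Prod>b\<in>Basis. cis ((wavevector k \<bullet> b) * (x \<bullet> b)))"
    proof -
      have "cis (wavevector k \<bullet> x) = exp (\<Sum>b\<in>Basis. \<i> * complex_of_real ((wavevector k \<bullet> b) * (x \<bullet> b)))"
        by (subst euclidean_inner) (simp add: cis_conv_exp sum_distrib_left)
      then show ?thesis by (simp add: exp_sum cis_conv_exp)
    qed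
    ultimately show ?thesis
      by (simp add: \<psi>_def scaleR_conv_of_real prod.distrib)
  qed
  have [measurable]: "\<psi> b \<in> borel_measurable borel" for b
    unfolding \<psi>_def by (intro borel_measurable_scaleR borel_measurable_indicator
        borel_measurable_continuous_onI continuous_intros) auto
  have "(LINT x|torus. cis (wavevector k \<bullet> x)) = (LINT x|lborel. (\<Prod>b\<in>Basis. \<psi> b (x \<bullet> b)))"
    by (subst integral_torus_lborel) (auto simp: split intro!: borel_measurable_continuous_onI continuous_intros)
  also have "\<dots> = (LINT f|(\<Pi>\<^sub>M b\<in>Basis. lborel). (\<Prod>b\<in>Basis. \<psi> b ((\<Sum>c\<in>Basis. f c *\<^sub>R c) \<bullet> b)))"
    unfolding lborel_eq[where 'a="real^3"]
    by (subst integral_distr) simp_all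
  also have "\<dots> = (LINT f|(\<Pi>\<^sub>M b\<in>Basis. lborel). (\<Prod>b\<in>Basis. \<psi> b (f b)))"
    by (intro Bochner_Integration.integral_cong prod.cong refl) simp
  also have "\<dots> = (\<Prod>b\<in>Basis. LINT t|lborel. \<psi> b t)"
  proof (rule product_integral_prod)
    show "integrable lborel (\<psi> b)" for b
      unfolding \<psi>_def by (rule borel_integrable_compact) (auto intro!: continuous_intros)
  qed simp
  also have "\<dots> = 0"
  proof -
    have "(LINT t|lborel. \<psi> (axis i 1) t) = 0"
      using integral_cis_unit_interval[OF i] by (simp add: \<psi>_def inner_axis wavevector_nth)
    then show ?thesis by (intro prod_zero) (auto intro!: bexI[of _ "axis i 1"] simp: Basis_vec_def)
  qed
  finally show ?thesis using False by simp
qed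

lemma integrable_torus_continuous:
  fixes g :: "real^3 \<Rightarrow> 'b::euclidean_space"
  assumes "continuous_on UNIV g" shows "integrable torus g"
proof -
  have "bounded (g ` cbox 0 1)"
    by (intro compact_imp_bounded compact_continuous_image continuous_on_subset[OF assms]) auto
  then obtain M where M: "\<And>x. x \<in> cbox 0 1 \<Longrightarrow> norm (g x) \<le> M" by (auto simp: bounded_iff)
  show ?thesis
    by (rule torus.integrable_const_bound[where B=M])
       (use assms M in \<open>auto intro!: continuous_measurable_torus AE_I2\<close>)
qed

lemma integral_torus_cos: "(LINT x|torus. cos (wavevector k \<bullet> x)) = (if k = 0 then 1 else 0)"
  and integral_torus_sin: "(LINT x|torus. sin (wavevector k \<bullet> x)) = 0"
proof -
  have *: "integrable torus (\<lambda>x. cis (wavevector k \<bullet> x))"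
    by (intro integrable_torus_continuous continuous_intros)
  show "(LINT x|torus. cos (wavevector k \<bullet> x)) = (if k = 0 then 1 else 0)"
    using integral_bounded_linear[OF bounded_linear_Re *] integral_torus_cis[of k] by simp
  show "(LINT x|torus. sin (wavevector k \<bullet> x)) = 0"
    using integral_bounded_linear[OF bounded_linear_Im *] integral_torus_cis[of k] by simp
qed

subsection \<open>Closure properties\<close>

lemma trig_poly_cos: "trig_poly (\<lambda>x. cos (wavevector k \<bullet> x) *\<^sub>R a)"
  unfolding trig_poly_def by (rule exI[of _ "{k}"], rule exI[of _ "\<lambda>_. a"], rule exI[of _ "\<lambda>_. 0"]) simp

lemma trig_poly_sin: "trig_poly (\<lambda>x. sin (wavevector k \<bullet> x) *\<^sub>R a)"
  unfolding trig_poly_def by (rule exI[of _ "{k}"], rule exI[of _ "\<lambda>_. 0"], rule exI[of _ "\<lambda>_. a"]) simp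

lemma trig_poly_add:
  assumes "trig_poly f" "trig_poly g" shows "trig_poly (\<lambda>x. f x + g x)"
proof -
  obtain K a b where K: "finite K"
    and f: "f = (\<lambda>x. \<Sum>k\<in>K. cos (wavevector k \<bullet> x) *\<^sub>R a k + sin (wavevector k \<bullet> x) *\<^sub>R b k)"
    using assms(1) unfolding trig_poly_def by (elim exE conjE) (rule that)
  obtain L c d where L: "finite L"
    and g: "g = (\<lambda>x. \<Sum>k\<in>L. cos (wavevector k \<bullet> x) *\<^sub>R c k + sin (wavevector k \<bullet> x) *\<^sub>R d k)"
    using assms(2) unfolding trig_poly_def by (elim exE conjE) (rule that)
  define a' b' c' d' where "a' k = (if k \<in> K then a k else 0)" and "b' k = (if k \<in> K then b k else 0)"
    and "c' k = (if k \<in> L then c k else 0)" and "d' k = (if k \<in> L then d k else 0)" for k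
  have "f x = (\<Sum>k\<in>K \<union> L. cos (wavevector k \<bullet> x) *\<^sub>R a' k + sin (wavevector k \<bullet> x) *\<^sub>R b' k)" for x
    unfolding f using K L by (intro sum.mono_neutral_cong_left) (auto simp: a'_def b'_def)
  moreover have "g x = (\<Sum>k\<in>K \<union> L. cos (wavevector k \<bullet> x) *\<^sub>R c' k + sin (wavevector k \<bullet> x) *\<^sub>R d' k)" for x
    unfolding g using K L by (intro sum.mono_neutral_cong_left) (auto simp: c'_def d'_def)
  ultimately show ?thesis
    unfolding trig_poly_def using K L
    by (intro exI[of _ "K \<union> L"] exI[of _ "\<lambda>k. a' k + c' k"] exI[of _ "\<lambda>k. b' k + d' k"])
       (auto simp: sum.distrib scaleR_add_right)
qed

text \<open>
  Almost every property of trigonometric polynomials below is checked on the modes and extended by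
  additivity.
\<close>

lemma trig_poly_induct [consumes 1, case_names cos sin add]:
  assumes "trig_poly f"
    and "\<And>k a. P (\<lambda>x. cos (wavevector k \<bullet> x) *\<^sub>R a)" "\<And>k a. P (\<lambda>x. sin (wavevector k \<bullet> x) *\<^sub>R a)"
    and add: "\<And>f g. trig_poly f \<Longrightarrow> trig_poly g \<Longrightarrow> P f \<Longrightarrow> P g \<Longrightarrow> P (\<lambda>x. f x + g x)"
  shows "P f"
proof -
  obtain K a b where "finite K"
    and f: "f = (\<lambda>x. \<Sum>k\<in>K. cos (wavevector k \<bullet> x) *\<^sub>R a k + sin (wavevector k \<bullet> x) *\<^sub>R b k)"
    using assms(1) unfolding trig_poly_def by (elim exE conjE) (rule that)
  let ?S = "\<lambda>K x. \<Sum>k\<in>K. cos (wavevector k \<bullet> x) *\<^sub>R a k + sin (wavevector k \<bullet> x) *\<^sub>R b k"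
  have "trig_poly (?S K) \<and> P (?S K)" using \<open>finite K\<close>
  proof induction
    case empty
    then show ?case using assms(3)[of 0 0] trig_poly_sin[of 0 0] by simp
  next
    case (insert k K)
    have m: "trig_poly (\<lambda>x. cos (wavevector k \<bullet> x) *\<^sub>R a k + sin (wavevector k \<bullet> x) *\<^sub>R b k)"
      by (intro trig_poly_add trig_poly_cos trig_poly_sin)
    have "P (\<lambda>x. cos (wavevector k \<bullet> x) *\<^sub>R a k + sin (wavevector k \<bullet> x) *\<^sub>R b k)"
      by (intro add trig_poly_cos trig_poly_sin assms(2,3))
    then show ?case using insert m trig_poly_add[OF m, of "?S K"] add[OF m, of "?S K"] by simp
  qed
  then show ?thesis using f by simp
qed

lemma trig_poly_const [simp]: "trig_poly (\<lambda>x. a)"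
  using trig_poly_cos[of 0 a] by simp

lemma trig_poly_linear:
  assumes "linear h" "trig_poly f" shows "trig_poly (\<lambda>x. h (f x))"
proof -
  interpret linear h by fact
  show ?thesis using assms(2)
    by (induction rule: trig_poly_induct) (auto simp: scale add intro!: trig_poly_cos trig_poly_sin trig_poly_add)
qed

lemma trig_poly_cmul: "trig_poly f \<Longrightarrow> trig_poly (\<lambda>x. c *\<^sub>R f x)"
  by (rule trig_poly_linear[OF linear_scaleR])

lemma trig_poly_uminus: "trig_poly f \<Longrightarrow> trig_poly (\<lambda>x. - f x)"
  using trig_poly_cmul[of f "-1"] by simp

lemma trig_poly_diff: "trig_poly f \<Longrightarrow> trig_poly g \<Longrightarrow> trig_poly (\<lambda>x. f x - g x)"
  using trig_poly_add[OF _ trig_poly_uminus] by auto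

lemma trig_poly_sum: "(\<And>i. i \<in> I \<Longrightarrow> trig_poly (f i)) \<Longrightarrow> trig_poly (\<lambda>x. \<Sum>i\<in>I. f i x)"
  by (induction I rule: infinite_finite_induct) (auto intro: trig_poly_add)

lemma trig_poly_nth: "trig_poly f \<Longrightarrow> trig_poly (\<lambda>x. f x $ j)"
  by (rule trig_poly_linear[OF bounded_linear.linear[OF bounded_linear_vec_nth]])

text \<open>Products are handled mode by mode, by the product-to-sum formulas.\<close>

lemma trig_poly_mult:
  assumes "trig_poly \<theta>" "trig_poly f" shows "trig_poly (\<lambda>x. \<theta> x *\<^sub>R f x)"
proof -
  have cc: "trig_poly (\<lambda>x. (cos (wavevector k \<bullet> x) * cos (wavevector l \<bullet> x)) *\<^sub>R a)" for k l and a :: 'a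
    unfolding cos_times_cos inner_diff_left[symmetric] inner_add_left[symmetric]
      wavevector_add[symmetric] wavevector_diff[symmetric]
    using trig_poly_add[OF trig_poly_cos[of "k - l" "(1/2) *\<^sub>R a"] trig_poly_cos[of "k + l" "(1/2) *\<^sub>R a"]]
    by (simp add: scaleR_add_left add_divide_distrib)
  have ss: "trig_poly (\<lambda>x. (sin (wavevector k \<bullet> x) * sin (wavevector l \<bullet> x)) *\<^sub>R a)" for k l and a :: 'a
    unfolding sin_times_sin inner_diff_left[symmetric] inner_add_left[symmetric]
      wavevector_add[symmetric] wavevector_diff[symmetric]
    using trig_poly_diff[OF trig_poly_cos[of "k - l" "(1/2) *\<^sub>R a"] trig_poly_cos[of "k + l" "(1/2) *\<^sub>R a"]]
    by (simp add: scaleR_diff_left diff_divide_distrib)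
  have sc: "trig_poly (\<lambda>x. (sin (wavevector k \<bullet> x) * cos (wavevector l \<bullet> x)) *\<^sub>R a)" for k l and a :: 'a
    unfolding sin_times_cos inner_diff_left[symmetric] inner_add_left[symmetric]
      wavevector_add[symmetric] wavevector_diff[symmetric]
    using trig_poly_add[OF trig_poly_sin[of "k + l" "(1/2) *\<^sub>R a"] trig_poly_sin[of "k - l" "(1/2) *\<^sub>R a"]]
    by (simp add: scaleR_add_left add_divide_distrib)
  have cs: "trig_poly (\<lambda>x. (cos (wavevector k \<bullet> x) * sin (wavevector l \<bullet> x)) *\<^sub>R a)" for k l and a :: 'a
    using sc[of l k a] by (simp add: mult.commute)
  have c: "trig_poly (\<lambda>x. cos (wavevector k \<bullet> x) *\<^sub>R f x)" for k
    using assms(2) by (induction rule: trig_poly_induct) (auto simp: scaleR_add_right intro!: trig_poly_add cc cs)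
  have s: "trig_poly (\<lambda>x. sin (wavevector k \<bullet> x) *\<^sub>R f x)" for k
    using assms(2) by (induction rule: trig_poly_induct) (auto simp: scaleR_add_right intro!: trig_poly_add sc ss)
  show ?thesis using assms(1)
  proof (induction rule: trig_poly_induct)
    case (cos k a)
    from trig_poly_cmul[OF c[of k], of a] show ?case by (simp add: mult.commute)
  next
    case (sin k a)
    from trig_poly_cmul[OF s[of k], of a] show ?case by (simp add: mult.commute)
  next
    case (add f g)
    then show ?case by (auto simp: scaleR_add_left intro: trig_poly_add)
  qed
qed

lemma trig_poly_inner:
  fixes f g :: "real^3 \<Rightarrow> 'b::euclidean_space"
  assumes "trig_poly f" "trig_poly g" shows "trig_poly (\<lambda>x. f x \<bullet> g x)"
proof -
  have "trig_poly (\<lambda>x. (f x \<bullet> b) *\<^sub>R (g x \<bullet> b))" for b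
    using assms by (intro trig_poly_mult trig_poly_linear[where h="\<lambda>y. y \<bullet> b"])
      (auto simp: bounded_linear.linear bounded_linear_inner_left)
  then have "trig_poly (\<lambda>x. \<Sum>b\<in>Basis. (f x \<bullet> b) *\<^sub>R (g x \<bullet> b))" by (intro trig_poly_sum)
  moreover have "(\<lambda>x. \<Sum>b\<in>Basis. (f x \<bullet> b) *\<^sub>R (g x \<bullet> b)) = (\<lambda>x. f x \<bullet> g x)"
    by (rule ext) (simp add: euclidean_inner[of "f _" "g _"])
  ultimately show ?thesis by simp
qed

lemma trig_poly_continuous: "trig_poly f \<Longrightarrow> continuous_on A f"
  by (induction rule: trig_poly_induct) (auto intro!: continuous_intros)

lemma trig_poly_bounded: "trig_poly f \<Longrightarrow> \<exists>M. \<forall>x. norm (f x) \<le> M"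
proof (induction rule: trig_poly_induct)
  case (cos k a)
  then show ?case by (intro exI[of _ "norm a"]) (auto intro!: mult_left_le_one_le)
next
  case (sin k a)
  then show ?case by (intro exI[of _ "norm a"]) (auto intro!: mult_left_le_one_le)
next
  case (add f g)
  then obtain M N where "\<forall>x. norm (f x) \<le> M" "\<forall>x. norm (g x) \<le> N" by blast
  then have "\<forall>x. norm (f x + g x) \<le> M + N" by (meson add_mono norm_triangle_le)
  then show ?case by blast
qed

lemma trig_poly_measurable: "trig_poly f \<Longrightarrow> f \<in> borel_measurable torus"
  by (intro continuous_measurable_torus trig_poly_continuous)

lemma trig_poly_L2: assumes "trig_poly f" shows "f \<in> L2"
proof -
  obtain M where "\<forall>x. norm (f x) \<le> M" using trig_poly_bounded[OF assms] by blast
  then show ?thesis by (intro L2_bounded[of f M] trig_poly_measurable[OF assms]) auto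
qed

lemma trig_poly_mult_L2:
  assumes "trig_poly \<theta>" "f \<in> L2" shows "(\<lambda>x. \<theta> x *\<^sub>R f x) \<in> L2"
proof -
  obtain M where "\<forall>x. norm (\<theta> x) \<le> M" using trig_poly_bounded[OF assms(1)] by blast
  then show ?thesis by (intro L2_mult_bounded[where M=M] trig_poly_measurable assms) auto
qed

subsection \<open>Derivatives\<close>

lemma trig_mode_derivative:
  fixes a :: "'b::euclidean_space"
  shows "((\<lambda>x. cos (wavevector k \<bullet> x) *\<^sub>R a) has_derivative (\<lambda>h. (- sin (wavevector k \<bullet> x) * (wavevector k \<bullet> h)) *\<^sub>R a)) (at x)"
    "((\<lambda>x. sin (wavevector k \<bullet> x) *\<^sub>R a) has_derivative (\<lambda>h. (cos (wavevector k \<bullet> x) * (wavevector k \<bullet> h)) *\<^sub>R a)) (at x)"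
  by (auto intro!: derivative_eq_intros simp: algebra_simps)

lemma classical_partialI:
  "(f has_derivative f') (at x) \<Longrightarrow> classical_partial i f x = f' (axis i 1)"
  by (simp add: classical_partial_def frechet_derivative_at[symmetric])

lemma classical_partial_cos:
  "classical_partial i (\<lambda>x. cos (wavevector k \<bullet> x) *\<^sub>R a) = (\<lambda>x. sin (wavevector k \<bullet> x) *\<^sub>R ((- wavevector k $ i) *\<^sub>R a))"
  by (rule ext, subst classical_partialI[OF trig_mode_derivative(1)]) (simp add: inner_axis)

lemma classical_partial_sin:
  "classical_partial i (\<lambda>x. sin (wavevector k \<bullet> x) *\<^sub>R a) = (\<lambda>x. cos (wavevector k \<bullet> x) *\<^sub>R (wavevector k $ i *\<^sub>R a))"
  by (rule ext, subst classical_partialI[OF trig_mode_derivative(2)]) (simp add: inner_axis)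

lemma trig_poly_differentiable: "trig_poly f \<Longrightarrow> f differentiable at x"
  by (induction rule: trig_poly_induct) (auto intro: differentiable_add differentiableI trig_mode_derivative)

lemma trig_poly_has_derivative:
  "trig_poly f \<Longrightarrow> (f has_derivative frechet_derivative f (at x)) (at x)"
  using trig_poly_differentiable frechet_derivative_works by blast

lemma classical_partial_add:
  "trig_poly f \<Longrightarrow> trig_poly g \<Longrightarrow> classical_partial i (\<lambda>x. f x + g x) = (\<lambda>x. classical_partial i f x + classical_partial i g x)"
  by (rule ext, subst classical_partialI[OF has_derivative_add[OF
        trig_poly_has_derivative[where f=f] trig_poly_has_derivative[where f=g]]])
     (auto simp: classical_partial_def)

lemma classical_partial_linear:
  assumes "bounded_linear h" "trig_poly f"
  shows "classical_partial i (\<lambda>x. h (f x)) = (\<lambda>x. h (classical_partial i f x))"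
  by (rule ext, subst classical_partialI[OF bounded_linear.has_derivative[OF assms(1)
        trig_poly_has_derivative[OF assms(2)]]]) (simp add: classical_partial_def)

lemma classical_partial_mult:
  assumes "trig_poly \<theta>" "trig_poly f"
  shows "classical_partial i (\<lambda>x. \<theta> x *\<^sub>R f x) x = \<theta> x *\<^sub>R classical_partial i f x + classical_partial i \<theta> x *\<^sub>R f x"
proof -
  have "((\<lambda>x. \<theta> x *\<^sub>R f x) has_derivative
      (\<lambda>h. \<theta> x *\<^sub>R frechet_derivative f (at x) h + frechet_derivative \<theta> (at x) h *\<^sub>R f x)) (at x)"
    using assms[THEN trig_poly_differentiable] by (intro has_derivative_scaleR) (simp_all add: frechet_derivative_works[symmetric])
  then show ?thesis by (subst classical_partialI) (auto simp: classical_partial_def)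
qed

lemma trig_poly_classical_partial: "trig_poly f \<Longrightarrow> trig_poly (classical_partial i f)"
  by (induction rule: trig_poly_induct)
     (simp_all only: classical_partial_cos classical_partial_sin classical_partial_add
       trig_poly_cos trig_poly_sin trig_poly_add)

lemma trig_poly_integrable: "trig_poly f \<Longrightarrow> integrable torus f"
  by (simp add: L2_integrable trig_poly_L2)

lemma integral_torus_mode:
  fixes a :: "'b::euclidean_space"
  shows "(LINT x|torus. cos (wavevector k \<bullet> x) *\<^sub>R a) = (LINT x|torus. cos (wavevector k \<bullet> x)) *\<^sub>R a"
    "(LINT x|torus. sin (wavevector k \<bullet> x) *\<^sub>R a) = (LINT x|torus. sin (wavevector k \<bullet> x)) *\<^sub>R a"
  by (rule integral_scaleR_left; intro impI integrable_torus_continuous continuous_intros)+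

text \<open>
  Periodicity leaves no boundary term: differentiating a mode produces a multiple of a mode of the
  same frequency, and the multiple is zero when the frequency is.
\<close>

lemma integral_classical_partial:
  assumes "trig_poly f" shows "(LINT x|torus. classical_partial i f x) = 0"
  using assms
proof (induction rule: trig_poly_induct)
  case (cos k a)
  then show ?case by (simp only: classical_partial_cos) (simp only: integral_torus_mode integral_torus_sin scaleR_zero_left)
next
  case (sin k a)
  then show ?case by (simp only: classical_partial_sin) (simp add: integral_torus_mode integral_torus_cos del: scaleR_scaleR)
next
  case (add f g)
  then show ?case by (simp add: classical_partial_add trig_poly_integrable trig_poly_classical_partial)
qed

text \<open>
  Integration by parts is the previous vanishing statement applied to the product with the test
  function, which is again a trigonometric polynomial.
\<close>

lemma trig_poly_has_weak_partial:
  assumes "trig_poly f" shows "has_weak_partial i f (classical_partial i f)"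
  unfolding has_weak_partial_def
proof (intro conjI allI impI)
  fix \<theta> :: "real^3 \<Rightarrow> real" assume \<theta>: "trig_poly \<theta>"
  have "0 = (LINT x|torus. classical_partial i (\<lambda>x. \<theta> x *\<^sub>R f x) x)"
    by (simp add: integral_classical_partial trig_poly_mult \<theta> assms)
  also have "\<dots> = (LINT x|torus. \<theta> x *\<^sub>R classical_partial i f x) + (LINT x|torus. classical_partial i \<theta> x *\<^sub>R f x)"
    by (simp add: classical_partial_mult \<theta> assms trig_poly_integrable trig_poly_mult trig_poly_classical_partial)
  finally show "(LINT x|torus. classical_partial i \<theta> x *\<^sub>R f x) = - (LINT x|torus. \<theta> x *\<^sub>R classical_partial i f x)"
    by (simp add: eq_neg_iff_add_eq_0 add.commute)
qed (simp_all add: assms trig_poly_L2 trig_poly_classical_partial)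

section \<open>Completeness of the trigonometric system\<close>

subsection \<open>Trigonometric polynomials separate square-integrable functions\<close>

text \<open>
  The product of three circles, cosines and sines being collected in separate factors.
\<close>

definition torus_embedding :: "real^3 \<Rightarrow> (real^3) \<times> (real^3)" where
  "torus_embedding x = ((\<chi> j. cos (2 * pi * x $ j)), (\<chi> j. sin (2 * pi * x $ j)))"

lemma wavevector_axis_inner: "wavevector (axis j 1) \<bullet> x = 2 * pi * x $ j"
proof -
  have "wavevector (axis j 1) = (2 * pi) *\<^sub>R axis j 1"
    by (simp add: wavevector_def vec_eq_iff axis_def)
  then show ?thesis by (simp add: inner_axis')
qed

lemma trig_poly_torus_embedding: "trig_poly torus_embedding"
proof -
  have "trig_poly (\<lambda>x. \<Sum>j\<in>UNIV. cos (wavevector (axis j 1) \<bullet> x) *\<^sub>R (axis j 1, 0::real^3)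
      + sin (wavevector (axis j 1) \<bullet> x) *\<^sub>R (0::real^3, axis j 1))"
    by (intro trig_poly_sum trig_poly_add trig_poly_cos trig_poly_sin)
  also have "(\<lambda>x. \<Sum>j\<in>UNIV. cos (wavevector (axis j 1) \<bullet> x) *\<^sub>R (axis j 1, 0::real^3)
      + sin (wavevector (axis j 1) \<bullet> x) *\<^sub>R (0::real^3, axis j 1)) = torus_embedding"
    unfolding wavevector_axis_inner
    by (rule ext) (auto simp: torus_embedding_def prod_eq_iff fst_sum snd_sum vec_eq_iff axis_def if_distrib cong: if_cong)
  finally show ?thesis .
qed

lemma trig_poly_real_polynomial:
  assumes "real_polynomial_function q" shows "trig_poly (\<lambda>x. q (torus_embedding x))"
  using assms
proof induction
  case (linear h)
  then show ?case by (rule trig_poly_linear[OF bounded_linear.linear trig_poly_torus_embedding])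
next
  case (mult f g)
  then show ?case using trig_poly_mult[of "\<lambda>x. f (torus_embedding x)" "\<lambda>x. g (torus_embedding x)"] by simp
qed (auto intro: trig_poly_add)

lemma torus_embedding_inj:
  assumes "x \<in> box 0 1" "y \<in> box 0 1" "torus_embedding x = torus_embedding y"
  shows "x = y"
proof -
  have "x $ j = y $ j" for j
  proof -
    have "sin (2 * pi * x $ j) = sin (2 * pi * y $ j) \<and> cos (2 * pi * x $ j) = cos (2 * pi * y $ j)"
      using assms(3) by (simp add: torus_embedding_def vec_eq_iff)
    then obtain n :: int where "2 * pi * x $ j = 2 * pi * y $ j + 2 * pi * of_int n"
      unfolding sin_cos_eq_iff by blast
    then have n: "x $ j = y $ j + of_int n" by (simp flip: distrib_left)
    have "0 < x $ j" "x $ j < 1" "0 < y $ j" "y $ j < 1"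
      using assms(1,2) by (auto simp: mem_box_cart)
    then have "n < 1" "n > -1" using n by linarith+
    then show ?thesis using n by simp
  qed
  then show ?thesis by (simp add: vec_eq_iff)
qed

lemma AE_torus_box: "AE x in torus. x \<in> box 0 1"
proof -
  have "negligible (cbox 0 (1::real^3) - box 0 1)" by (rule negligible_frontier_interval)
  then have "AE x in lebesgue. x \<notin> cbox 0 (1::real^3) - box 0 1"
    by (intro AE_not_in) (simp add: negligible_iff_null_sets)
  then show ?thesis
    unfolding torus_def by (subst AE_restrict_space_iff) (auto elim: eventually_mono)
qed

text \<open>
  The torus embeds into a Euclidean space in such a way that polynomials pull back to
  trigonometric polynomials.  By the Stone-Weierstrass theorem the indicator function of a compact
  subset of the open cube is therefore a bounded pointwise limit of trigonometric polynomials.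
\<close>

lemma integral_compact_eq_0:
  fixes f :: "real^3 \<Rightarrow> real"
  assumes f: "f \<in> L2" and orth: "\<And>\<theta>::real^3 \<Rightarrow> real. trig_poly \<theta> \<Longrightarrow> (LINT x|torus. \<theta> x * f x) = 0"
    and C: "compact C" "C \<subseteq> box 0 1" "C \<noteq> {}"
  shows "(LINT x|torus. indicator C x * f x) = 0"
proof -
  let ?E = torus_embedding
  have contE: "continuous_on A ?E" for A by (rule trig_poly_continuous[OF trig_poly_torus_embedding])
  have EC: "compact (?E ` C)" "?E ` C \<noteq> {}" using C by (auto intro: compact_continuous_image contE)
  have EK: "compact (?E ` cbox 0 1)" by (intro compact_continuous_image contE) simp
  \<comment> \<open>a tent of slope \<open>n\<close> over the compact set decreases to its indicator function\<close>
  define h where "h n z = max 0 (1 - real n * infdist z (?E ` C))" for n z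
  have "\<exists>q. real_polynomial_function q \<and> (\<forall>z\<in>?E ` cbox 0 1. \<bar>h n z - q z\<bar> < inverse (real (Suc n)))" for n
  proof -
    have "continuous_on (?E ` cbox 0 1) (h n)"
      unfolding h_def by (intro continuous_intros)
    moreover have "0 < inverse (real (Suc n))" by simp
    ultimately obtain q where "real_polynomial_function q"
      "\<And>z. z \<in> ?E ` cbox 0 1 \<Longrightarrow> \<bar>h n z - q z\<bar> < inverse (real (Suc n))"
      by (rule Stone_Weierstrass_real_polynomial_function[OF EK]) (rule that)
    then show ?thesis by (intro exI[of _ q]) blast
  qed
  then obtain q where q: "\<And>n. real_polynomial_function (q n)"
    and qh: "\<And>n z. z \<in> ?E ` cbox 0 1 \<Longrightarrow> \<bar>h n z - q n z\<bar> < inverse (real (Suc n))"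
    by metis
  have h01: "0 \<le> h n z" "h n z \<le> 1" for n z by (auto simp: h_def infdist_nonneg)
  have bound: "\<bar>q n (?E x)\<bar> \<le> 2" if "x \<in> cbox 0 1" for n x
  proof -
    have "\<bar>h n (?E x) - q n (?E x)\<bar> < inverse (real (Suc n))" using that by (intro qh) auto
    moreover have "inverse (real (Suc n)) \<le> 1" by (simp add: field_simps)
    ultimately show ?thesis using h01[of n "?E x"] by linarith
  qed
  have hlim: "(\<lambda>n. h n (?E x)) \<longlonglongrightarrow> indicator C x" if "x \<in> box 0 1" for x
  proof (cases "x \<in> C")
    case True
    then have "h n (?E x) = 1" for n by (simp add: h_def)
    then show ?thesis using True by simp
  next
    case False
    then have "?E x \<notin> ?E ` C" using that C torus_embedding_inj by auto
    then have "infdist (?E x) (?E ` C) > 0"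
      using EC by (simp add: infdist_pos_not_in_closed compact_imp_closed)
    then obtain N where N: "real N * infdist (?E x) (?E ` C) > 1" using reals_Archimedean3 by blast
    have "h n (?E x) = 0" if "n \<ge> N" for n
    proof -
      have "real N * infdist (?E x) (?E ` C) \<le> real n * infdist (?E x) (?E ` C)"
        using that by (intro mult_right_mono infdist_nonneg) auto
      then show ?thesis using N by (simp add: h_def)
    qed
    then have "\<forall>\<^sub>F n in sequentially. 0 = h n (?E x)" by (auto simp: eventually_sequentially)
    then show ?thesis using False by (auto intro: Lim_transform_eventually[OF tendsto_const])
  qed
  have qlim: "(\<lambda>n. q n (?E x)) \<longlonglongrightarrow> indicator C x" if "x \<in> box 0 1" for x
  proof -
    have "x \<in> cbox 0 1" using that box_subset_cbox by blast
    then have "(\<lambda>n. h n (?E x) - q n (?E x)) \<longlonglongrightarrow> 0"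
      by (intro Lim_null_comparison[OF _ LIMSEQ_inverse_real_of_nat] always_eventually)
         (auto intro!: less_imp_le qh simp del: of_nat_Suc)
    from tendsto_diff[OF hlim[OF that] this] show ?thesis by simp
  qed
  have qm: "(\<lambda>x. q n (?E x)) \<in> borel_measurable torus" for n
    by (intro trig_poly_measurable trig_poly_real_polynomial q)
  have "(\<lambda>n. LINT x|torus. q n (?E x) * f x) \<longlonglongrightarrow> (LINT x|torus. indicator C x * f x)"
  proof (rule integral_dominated_convergence)
    have "C \<subseteq> cbox 0 1" using C(2) box_subset_cbox by blast
    moreover have "C \<in> sets lebesgue" using compact_imp_closed[OF C(1)] by simp
    ultimately have [measurable]: "C \<in> sets torus"
      unfolding torus_def by (subst sets_restrict_space_iff) auto
    show "(\<lambda>x. indicator C x * f x) \<in> borel_measurable torus"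
      using f by measurable
    show "(\<lambda>x. q n (?E x) * f x) \<in> borel_measurable torus" for n
      using f qm by measurable
    show "integrable torus (\<lambda>x. 2 * \<bar>f x\<bar>)" using L2_integrable[OF f] by simp
    show "AE x in torus. norm (q n (?E x) * f x) \<le> 2 * \<bar>f x\<bar>" for n
      by (rule AE_I2) (use bound in \<open>auto simp: abs_mult intro!: mult_right_mono\<close>)
    show "AE x in torus. (\<lambda>n. q n (?E x) * f x) \<longlonglongrightarrow> indicator C x * f x"
      using AE_torus_box by eventually_elim (intro tendsto_mult qlim tendsto_const)
  qed
  moreover have "(LINT x|torus. q n (?E x) * f x) = 0" for n
    by (intro orth trig_poly_real_polynomial q)
  ultimately show ?thesis by (simp add: LIMSEQ_const_iff)
qed

text \<open>
  By inner regularity the set where \<open>f\<close> is positive is exhausted by compact sets.  The integral of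
  \<open>f\<close> over each of them vanishes, so each of them is a null set.
\<close>

lemma positive_part_null:
  fixes f :: "real^3 \<Rightarrow> real"
  assumes f: "f \<in> L2" and orth: "\<And>\<theta>::real^3 \<Rightarrow> real. trig_poly \<theta> \<Longrightarrow> (LINT x|torus. \<theta> x * f x) = 0"
  shows "AE x in torus. f x \<le> 0"
proof -
  define P where "P = {x \<in> box 0 1. f x > 0}"
  have "{x \<in> space torus. f x > 0} \<in> sets torus" using f by measurable
  then have "{x \<in> cbox 0 1. f x > 0} \<in> sets lebesgue"
    unfolding torus_def by (subst (asm) sets_restrict_space_iff) auto
  then have "{x \<in> cbox 0 1. f x > 0} \<inter> box 0 1 \<in> sets lebesgue" by auto
  also have "{x \<in> cbox 0 1. f x > 0} \<inter> box 0 1 = P" using box_subset_cbox by (auto simp: P_def)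
  finally have P: "P \<in> sets lebesgue" .
  have "emeasure lebesgue P \<le> 0 + ennreal e" if "e > 0" for e :: real
  proof -
    obtain C where C: "closed C" "C \<subseteq> P" "emeasure lebesgue (P - C) < ennreal e"
      using sets_lebesgue_inner_closed[OF P \<open>e > 0\<close>] by metis
    have CB: "C \<subseteq> box 0 1" using C by (auto simp: P_def)
    then have cC: "compact C" using C by (meson bounded_box bounded_subset compact_eq_bounded_closed)
    have Cs: "C \<in> sets torus" using C CB box_subset_cbox[of 0 "1::real^3"]
      by (auto simp: torus_def sets_restrict_space_iff)
    have "emeasure lebesgue C = 0"
    proof (cases "C = {}")
      case False
      have z: "(LINT x|torus. indicator C x * f x) = 0"
        by (rule integral_compact_eq_0[OF f orth cC CB False])
      have "integrable torus (\<lambda>x. indicator C x *\<^sub>R f x)"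
        by (rule integrable_mult_indicator[OF Cs L2_integrable[OF f]])
      moreover have "0 \<le> indicator C x * f x" for x
        using C(2) by (cases "x \<in> C") (auto simp: P_def)
      ultimately have "AE x in torus. indicator C x * f x = 0"
        using integral_nonneg_eq_0_iff_AE[of torus "\<lambda>x. indicator C x * f x"] z by auto
      then have "AE x in torus. x \<notin> C"
        by eventually_elim (use C in \<open>auto simp: P_def indicator_def split: if_splits\<close>)
      then have "AE x in lebesgue. x \<notin> C"
        unfolding torus_def by (subst (asm) AE_restrict_space_iff)
          (use CB box_subset_cbox in \<open>auto elim!: eventually_mono\<close>)
      then show ?thesis using C(1) by (subst (asm) AE_iff_null_sets[symmetric]) auto
    qed simp
    moreover have "emeasure lebesgue P \<le> emeasure lebesgue C + emeasure lebesgue (P - C)"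
    proof -
      have "C \<in> sets lebesgue" using C(1) by simp
      with emeasure_subadditive[of C lebesgue "P - C"] P have
        "emeasure lebesgue (C \<union> (P - C)) \<le> emeasure lebesgue C + emeasure lebesgue (P - C)" by blast
      moreover have "C \<union> (P - C) = P" using C(2) by blast
      ultimately show ?thesis by (simp only:)
    qed
    ultimately show ?thesis using C(3) by simp
  qed
  then have "emeasure lebesgue P \<le> 0" by (rule ennreal_le_epsilon)
  then have "AE x in lebesgue. x \<notin> P" using P by (intro AE_not_in) (auto simp: null_sets_def)
  then have "AE x in torus. x \<notin> P"
    unfolding torus_def by (subst AE_restrict_space_iff) auto
  with AE_torus_box show ?thesis by eventually_elim (auto simp: P_def)
qed

theorem L2_eq_0_AE_if_orthogonal:
  fixes f :: "real^3 \<Rightarrow> 'b::euclidean_space"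
  assumes f: "f \<in> L2" and orth: "\<And>\<theta>::real^3 \<Rightarrow> real. trig_poly \<theta> \<Longrightarrow> (LINT x|torus. \<theta> x *\<^sub>R f x) = 0"
  shows "AE x in torus. f x = 0"
proof -
  have "AE x in torus. f x \<bullet> b = 0" for b
  proof -
    have fb: "(\<lambda>x. f x \<bullet> b) \<in> L2" by (rule L2_bounded_linear[OF bounded_linear_inner_left f])
    have o: "(LINT x|torus. \<theta> x * (f x \<bullet> b)) = 0" if "trig_poly \<theta>" for \<theta> :: "real^3 \<Rightarrow> real"
      using integral_inner_left[of b torus "\<lambda>x. \<theta> x *\<^sub>R f x"] orth[OF that]
        L2_integrable[OF trig_poly_mult_L2[OF that f]] by simp
    have "AE x in torus. f x \<bullet> b \<le> 0" by (rule positive_part_null[OF fb o])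
    moreover have "AE x in torus. - (f x \<bullet> b) \<le> 0"
      by (rule positive_part_null[OF L2_uminus[OF fb]]) (simp add: o)
    ultimately show ?thesis by eventually_elim simp
  qed
  then have "AE x in torus. \<forall>b\<in>Basis. f x \<bullet> b = 0" by (intro AE_finite_allI) auto
  then show ?thesis by eventually_elim (simp add: euclidean_all_zero_iff)
qed

subsection \<open>Fourier series of complex-valued functions\<close>

definition fcoeff :: "(real^3 \<Rightarrow> complex) \<Rightarrow> int^3 \<Rightarrow> complex" where
  "fcoeff f k = (LINT x|torus. f x * cis (- (wavevector k \<bullet> x)))"

definition fsum :: "(int^3) set \<Rightarrow> (int^3 \<Rightarrow> complex) \<Rightarrow> real^3 \<Rightarrow> complex" where
  "fsum K c x = (\<Sum>k\<in>K. c k * cis (wavevector k \<bullet> x))"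

abbreviation complexify :: "vfield \<Rightarrow> 3 \<Rightarrow> real^3 \<Rightarrow> complex" where
  "complexify f j \<equiv> \<lambda>x. complex_of_real (f x $ j)"

lemma fourier_coeff_nth: "fourier_coeff f k $ j = fcoeff (complexify f j) k"
  by (simp add: fourier_coeff_def fcoeff_def)

lemma trig_poly_mode: "trig_poly (\<lambda>x. c * cis (wavevector k \<bullet> x))"
proof -
  have "trig_poly (\<lambda>x. cos (wavevector k \<bullet> x) *\<^sub>R c + sin (wavevector k \<bullet> x) *\<^sub>R (\<i> * c))"
    by (intro trig_poly_add trig_poly_cos trig_poly_sin)
  also have "(\<lambda>x. cos (wavevector k \<bullet> x) *\<^sub>R c + sin (wavevector k \<bullet> x) *\<^sub>R (\<i> * c)) = (\<lambda>x. c * cis (wavevector k \<bullet> x))"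
    by (rule ext) (simp add: complex_eq_iff algebra_simps)
  finally show ?thesis .
qed

lemma trig_poly_fsum: "trig_poly (fsum K c)"
  unfolding fsum_def by (intro trig_poly_sum trig_poly_mode)

lemma fsum_L2: "fsum K c \<in> L2"
  by (rule trig_poly_L2[OF trig_poly_fsum])

lemma mult_cis_integrable:
  assumes "f \<in> L2" shows "integrable torus (\<lambda>x. f x * cis (- (wavevector k \<bullet> x)))"
proof (rule Bochner_Integration.integrable_bound[OF L2_integrable[OF assms]])
  have "(\<lambda>x. cis (- (wavevector k \<bullet> x))) \<in> borel_measurable torus"
    by (intro continuous_measurable_torus continuous_intros)
  then show "(\<lambda>x. f x * cis (- (wavevector k \<bullet> x))) \<in> borel_measurable torus"
    using assms by measurable
qed (auto simp: norm_mult)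

lemma fcoeff_add: "f \<in> L2 \<Longrightarrow> g \<in> L2 \<Longrightarrow> fcoeff (\<lambda>x. f x + g x) k = fcoeff f k + fcoeff g k"
  by (simp add: fcoeff_def distrib_right mult_cis_integrable)

lemma fcoeff_diff: "f \<in> L2 \<Longrightarrow> g \<in> L2 \<Longrightarrow> fcoeff (\<lambda>x. f x - g x) k = fcoeff f k - fcoeff g k"
  by (simp add: fcoeff_def left_diff_distrib mult_cis_integrable)

lemma fcoeff_mult: "fcoeff (\<lambda>x. c * f x) k = c * fcoeff f k"
  by (simp add: fcoeff_def mult.assoc)

lemma norm_fcoeff_le: assumes "f \<in> L2" shows "norm (fcoeff f k) \<le> L2_norm f"
proof -
  have "norm (fcoeff f k) \<le> (LINT x|torus. norm (f x * cis (- (wavevector k \<bullet> x))))"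
    unfolding fcoeff_def by (rule integral_norm_bound)
  also have "\<dots> \<le> L2_norm f" using L1_le_L2_norm[OF assms] by (simp add: norm_mult)
  finally show ?thesis .
qed

lemma fcoeff_mode: "fcoeff (\<lambda>x. c * cis (wavevector l \<bullet> x)) k = (if l = k then c else 0)"
proof -
  have "fcoeff (\<lambda>x. c * cis (wavevector l \<bullet> x)) k = c * (LINT x|torus. cis (wavevector (l - k) \<bullet> x))"
    by (simp add: fcoeff_def mult.assoc cis_mult wavevector_diff inner_diff_left)
  then show ?thesis by (simp add: integral_torus_cis)
qed

lemma fcoeff_fsum:
  assumes "finite K" shows "fcoeff (fsum K c) k = (if k \<in> K then c k else 0)"
  using assms
proof induction
  case empty
  then show ?case by (simp add: fcoeff_def fsum_def)
next
  case (insert l K)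
  have "fcoeff (fsum (insert l K) c) k = fcoeff (\<lambda>x. c l * cis (wavevector l \<bullet> x) + fsum K c x) k"
    by (rule arg_cong[where f="\<lambda>g. fcoeff g k"], rule ext) (use insert(1,2) in \<open>simp add: fsum_def\<close>)
  also have "\<dots> = (if l = k then c l else 0) + fcoeff (fsum K c) k"
    by (subst fcoeff_add) (auto simp: fcoeff_mode fsum_L2 trig_poly_L2 trig_poly_mode)
  finally show ?case using insert by auto
qed

lemma L2_inner_fsum:
  assumes "f \<in> L2" "finite K"
  shows "L2_inner f (fsum K c) = (\<Sum>k\<in>K. Re (cnj (c k) * fcoeff f k))"
proof -
  have inner: "z \<bullet> w = Re (z * cnj w)" for z w by (simp add: inner_complex_def)
  have "f x \<bullet> fsum K c x = (\<Sum>k\<in>K. Re (cnj (c k) * (f x * cis (- (wavevector k \<bullet> x)))))" for x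
    by (simp only: inner fsum_def cnj_sum complex_cnj_mult cis_cnj sum_distrib_left Re_sum mult_ac)
  then have "L2_inner f (fsum K c) = (\<Sum>k\<in>K. LINT x|torus. Re (cnj (c k) * (f x * cis (- (wavevector k \<bullet> x)))))"
    unfolding L2_inner_def using assms
    by (simp only:) (intro Bochner_Integration.integral_sum integrable_Re integrable_mult_right mult_cis_integrable)
  also have "\<dots> = (\<Sum>k\<in>K. Re (cnj (c k) * fcoeff f k))"
    using assms unfolding fcoeff_def by (subst integral_Re) (auto intro!: integrable_mult_right mult_cis_integrable)
  finally show ?thesis .
qed

lemma Re_cnj_mult_self: "Re (cnj z * z) = (norm z)\<^sup>2"
  by (simp add: cmod_power2 flip: power2_eq_square)

lemma L2_inner_fsum_fsum:
  assumes "finite K" shows "L2_inner (fsum K c) (fsum K c) = (\<Sum>k\<in>K. (norm (c k))\<^sup>2)"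
proof -
  have "L2_inner (fsum K c) (fsum K c) = (\<Sum>k\<in>K. Re (cnj (c k) * c k))"
    using assms by (subst L2_inner_fsum) (auto simp: fsum_L2 fcoeff_fsum)
  then show ?thesis by (simp only: Re_cnj_mult_self)
qed

lemma L2_norm_fsum_sq: "finite K \<Longrightarrow> (L2_norm (fsum K c))\<^sup>2 = (\<Sum>k\<in>K. (norm (c k))\<^sup>2)"
  by (simp add: L2_norm_sq L2_inner_fsum_fsum)

lemma L2_norm_fourier_remainder:
  assumes f: "f \<in> L2" and K: "finite K"
  shows "(L2_norm (\<lambda>x. f x - fsum K (fcoeff f) x))\<^sup>2 = (L2_norm f)\<^sup>2 - (\<Sum>k\<in>K. (norm (fcoeff f k))\<^sup>2)"
proof -
  have "L2_inner f (fsum K (fcoeff f)) = (\<Sum>k\<in>K. (norm (fcoeff f k))\<^sup>2)"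
    by (simp only: L2_inner_fsum[OF assms] Re_cnj_mult_self)
  then show ?thesis
    using assms by (simp add: L2_norm_sq L2_inner_diff_left L2_inner_diff_right fsum_L2 L2_diff L2_inner_fsum_fsum L2_inner_commute[of "fsum K _" f])
qed

lemma Bessel:
  assumes "f \<in> L2"
  shows "(\<lambda>k. (norm (fcoeff f k))\<^sup>2) summable_on UNIV"
proof (rule nonneg_bdd_above_summable_on)
  show "bdd_above (sum (\<lambda>k. (norm (fcoeff f k))\<^sup>2) ` {F. F \<subseteq> UNIV \<and> finite F})"
  proof (rule bdd_aboveI2)
    fix K :: "(int^3) set" assume "K \<in> {F. F \<subseteq> UNIV \<and> finite F}"
    then show "(\<Sum>k\<in>K. (norm (fcoeff f k))\<^sup>2) \<le> (L2_norm f)\<^sup>2"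
      using L2_norm_fourier_remainder[OF assms, of K] zero_le_power2[of "L2_norm (\<lambda>x. f x - fsum K (fcoeff f) x)"] by simp
  qed
qed simp

text \<open>An exhaustion of the lattice of wave vectors by finite sets.\<close>

definition cutoff :: "nat \<Rightarrow> (int^3) set" where
  "cutoff n = {k. to_nat k \<le> n}"

lemma finite_cutoff [simp]: "finite (cutoff n)"
proof -
  have "cutoff n \<subseteq> from_nat ` {..n}"
    by (auto simp: cutoff_def intro!: image_eqI[of _ from_nat "to_nat _"])
  then show ?thesis by (rule finite_subset) simp
qed

lemma cutoff_mono: "m \<le> n \<Longrightarrow> cutoff m \<subseteq> cutoff n"
  by (auto simp: cutoff_def)

lemma filterlim_cutoff: "filterlim cutoff (finite_subsets_at_top UNIV) sequentially"
  unfolding filterlim_finite_subsets_at_top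
proof (intro allI impI)
  fix X :: "(int^3) set" assume "finite X \<and> X \<subseteq> UNIV"
  then have "X \<subseteq> cutoff n" if "n \<ge> (\<Sum>k\<in>X. to_nat k)" for n
    using member_le_sum[of _ X to_nat] that by (force simp: cutoff_def)
  then show "\<forall>\<^sub>F n in sequentially. finite (cutoff n) \<and> X \<subseteq> cutoff n \<and> cutoff n \<subseteq> UNIV"
    unfolding eventually_sequentially by auto
qed

lemma has_sum_cutoff: "(f has_sum s) UNIV \<Longrightarrow> (\<lambda>n. sum f (cutoff n)) \<longlonglongrightarrow> s"
  unfolding has_sum_def by (rule filterlim_compose[OF _ filterlim_cutoff])

text \<open>
  The square of the distance of two partial sums is the difference of the partial sums of a convergent
  series of numbers.
\<close>

theorem Riesz_Fischer:
  assumes "(\<lambda>k. (norm (c k))\<^sup>2) summable_on UNIV"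
  obtains F where "F \<in> L2" "(\<lambda>n. L2_norm (\<lambda>x. fsum (cutoff n) c x - F x)) \<longlonglongrightarrow> 0"
proof -
  define S where "S n = (\<Sum>k\<in>cutoff n. (norm (c k))\<^sup>2)" for n
  have "convergent S"
    using has_sum_cutoff[OF has_sum_infsum[OF assms]] unfolding convergent_def S_def by blast
  then have "Cauchy S" by (rule convergent_Cauchy)
  have diff: "(L2_norm (\<lambda>x. fsum (cutoff m) c x - fsum (cutoff n) c x))\<^sup>2 = \<bar>S m - S n\<bar>" if "n \<le> m" for m n
  proof -
    note sub = cutoff_mono[OF that]
    have "(\<lambda>x. fsum (cutoff m) c x - fsum (cutoff n) c x) = fsum (cutoff m - cutoff n) c"
      by (rule ext) (simp add: fsum_def sum_diff[OF finite_cutoff sub])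
    then have "(L2_norm (\<lambda>x. fsum (cutoff m) c x - fsum (cutoff n) c x))\<^sup>2 = (\<Sum>k\<in>cutoff m - cutoff n. (norm (c k))\<^sup>2)"
      by (simp add: L2_norm_fsum_sq)
    moreover have "(\<Sum>k\<in>cutoff m - cutoff n. (norm (c k))\<^sup>2) = S m - S n"
      by (simp add: S_def sum_diff[OF finite_cutoff sub])
    moreover have "0 \<le> (\<Sum>k\<in>cutoff m - cutoff n. (norm (c k))\<^sup>2)" by (intro sum_nonneg) simp
    ultimately show ?thesis by simp
  qed
  have diff': "(L2_norm (\<lambda>x. fsum (cutoff m) c x - fsum (cutoff n) c x))\<^sup>2 = \<bar>S m - S n\<bar>" for m n
    using diff[of n m] diff[of m n] L2_norm_minus_commute[of "fsum (cutoff m) c" "fsum (cutoff n) c"]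
    by (cases "n \<le> m") (auto simp: abs_minus_commute)
  show thesis
  proof (rule L2_complete[of "\<lambda>n. fsum (cutoff n) c"])
    fix e :: real assume "e > 0"
    then have "e\<^sup>2 > 0" by simp
    with \<open>Cauchy S\<close> obtain N where N: "\<And>m n. m \<ge> N \<Longrightarrow> n \<ge> N \<Longrightarrow> \<bar>S m - S n\<bar> < e\<^sup>2"
      unfolding Cauchy_def dist_real_def by blast
    have "L2_norm (\<lambda>x. fsum (cutoff m) c x - fsum (cutoff n) c x) < e" if "m \<ge> N" "n \<ge> N" for m n
      by (rule power2_less_imp_less) (use N[OF that] \<open>e > 0\<close> in \<open>auto simp: diff'\<close>)
    then show "\<exists>N. \<forall>m\<ge>N. \<forall>n\<ge>N. L2_norm (\<lambda>x. fsum (cutoff m) c x - fsum (cutoff n) c x) < e" by blast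
  qed (use that fsum_L2 in auto)
qed

lemma tendsto_fcoeff:
  assumes "\<And>n. f n \<in> L2" "F \<in> L2" "(\<lambda>n. L2_norm (\<lambda>x. f n x - F x)) \<longlonglongrightarrow> 0"
  shows "(\<lambda>n. fcoeff (f n) k) \<longlonglongrightarrow> fcoeff F k"
proof -
  have "norm (fcoeff (f n) k - fcoeff F k) \<le> L2_norm (\<lambda>x. f n x - F x)" for n
    using norm_fcoeff_le[OF L2_diff[OF assms(1)[of n] assms(2)], of k] assms by (simp add: fcoeff_diff)
  then have "(\<lambda>n. fcoeff (f n) k - fcoeff F k) \<longlonglongrightarrow> 0"
    by (intro Lim_null_comparison[OF always_eventually assms(3)]) auto
  then show ?thesis by (simp add: LIM_zero_iff)
qed

text \<open>
  The complex coefficients determine the integrals against the real modes, which are the test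
  functions of the orthogonality criterion.
\<close>

lemma fcoeff_cos_sin:
  assumes f: "f \<in> L2"
  shows "(LINT x|torus. cos (wavevector k \<bullet> x) *\<^sub>R f x) = (fcoeff f k + fcoeff f (- k)) / 2"
    and "(LINT x|torus. sin (wavevector k \<bullet> x) *\<^sub>R f x) = \<i> * (fcoeff f k - fcoeff f (- k)) / 2"
proof -
  note i = mult_cis_integrable[OF f, of k] mult_cis_integrable[OF f, of "- k"]
  have "(fcoeff f k + fcoeff f (- k)) / 2 = (LINT x|torus. (f x * cis (- (wavevector k \<bullet> x)) + f x * cis (- (wavevector (- k) \<bullet> x))) / 2)"
    unfolding fcoeff_def using i by simp
  also have "\<dots> = (LINT x|torus. cos (wavevector k \<bullet> x) *\<^sub>R f x)"
    by (intro Bochner_Integration.integral_cong) (auto simp: complex_eq_iff wavevector_uminus)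
  finally show "(LINT x|torus. cos (wavevector k \<bullet> x) *\<^sub>R f x) = (fcoeff f k + fcoeff f (- k)) / 2" ..
  have "\<i> * (fcoeff f k - fcoeff f (- k)) / 2 = (LINT x|torus. \<i> * (f x * cis (- (wavevector k \<bullet> x)) - f x * cis (- (wavevector (- k) \<bullet> x))) / 2)"
    unfolding fcoeff_def using i by simp
  also have "\<dots> = (LINT x|torus. sin (wavevector k \<bullet> x) *\<^sub>R f x)"
    by (intro Bochner_Integration.integral_cong) (auto simp: complex_eq_iff wavevector_uminus)
  finally show "(LINT x|torus. sin (wavevector k \<bullet> x) *\<^sub>R f x) = \<i> * (fcoeff f k - fcoeff f (- k)) / 2" ..
qed

lemma fcoeff_eq_0_imp_AE:
  assumes f: "f \<in> L2" and z: "\<And>k. fcoeff f k = 0"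
  shows "AE x in torus. f x = 0"
proof (rule L2_eq_0_AE_if_orthogonal[OF f])
  fix \<theta> :: "real^3 \<Rightarrow> real" assume "trig_poly \<theta>"
  then show "(LINT x|torus. \<theta> x *\<^sub>R f x) = 0"
  proof (induction rule: trig_poly_induct)
    case (cos k a)
    have "(LINT x|torus. (cos (wavevector k \<bullet> x) *\<^sub>R a) *\<^sub>R f x) = (LINT x|torus. a *\<^sub>R (cos (wavevector k \<bullet> x) *\<^sub>R f x))"
      by (simp add: mult.commute)
    also have "\<dots> = 0" by (simp only: integral_scaleR_right fcoeff_cos_sin[OF f] z) simp
    finally show ?case .
  next
    case (sin k a)
    have "(LINT x|torus. (sin (wavevector k \<bullet> x) *\<^sub>R a) *\<^sub>R f x) = (LINT x|torus. a *\<^sub>R (sin (wavevector k \<bullet> x) *\<^sub>R f x))"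
      by (simp add: mult.commute)
    also have "\<dots> = 0" by (simp only: integral_scaleR_right fcoeff_cos_sin[OF f] z) simp
    finally show ?case .
  next
    case (add \<theta> \<eta>)
    then show ?case
      using L2_integrable[OF trig_poly_mult_L2[OF add(1) f]] L2_integrable[OF trig_poly_mult_L2[OF add(2) f]]
      by (simp add: scaleR_add_left)
  qed
qed

text \<open>
  The partial sums converge to some function by the Riesz-Fischer theorem.  That function has the same
  coefficients as \<open>f\<close>, so it is \<open>f\<close> almost everywhere.
\<close>

theorem fourier_series_L2:
  assumes f: "f \<in> L2"
  shows "(\<lambda>n. L2_norm (\<lambda>x. fsum (cutoff n) (fcoeff f) x - f x)) \<longlonglongrightarrow> 0"
proof -
  obtain F where F: "F \<in> L2" and lim: "(\<lambda>n. L2_norm (\<lambda>x. fsum (cutoff n) (fcoeff f) x - F x)) \<longlonglongrightarrow> 0"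
    by (rule Riesz_Fischer[OF Bessel[OF f]])
  have "fcoeff F k = fcoeff f k" for k
  proof (rule LIMSEQ_unique)
    show "(\<lambda>n. fcoeff (fsum (cutoff n) (fcoeff f)) k) \<longlonglongrightarrow> fcoeff F k"
      by (rule tendsto_fcoeff[OF fsum_L2 F lim])
    show "(\<lambda>n. fcoeff (fsum (cutoff n) (fcoeff f)) k) \<longlonglongrightarrow> fcoeff f k"
    proof (rule tendsto_eventually)
      show "\<forall>\<^sub>F n in sequentially. fcoeff (fsum (cutoff n) (fcoeff f)) k = fcoeff f k"
        unfolding eventually_sequentially
        by (rule exI[of _ "to_nat k"]) (auto simp: fcoeff_fsum, auto simp: cutoff_def)
    qed
  qed
  then have "AE x in torus. F x - f x = 0"
    by (intro fcoeff_eq_0_imp_AE) (auto simp: F f fcoeff_diff)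
  then have AE: "AE x in torus. F x = f x" by simp
  have "L2_norm (\<lambda>x. fsum (cutoff n) (fcoeff f) x - F x) = L2_norm (\<lambda>x. fsum (cutoff n) (fcoeff f) x - f x)" for n
    unfolding L2_norm_inner using AE
    by (intro arg_cong[where f=sqrt] L2_inner_cong_AE) (auto intro!: L2_diff fsum_L2 F f)
  then show ?thesis using lim by simp
qed

text \<open>
  The defect in Bessel's inequality is the squared norm of the remainder, which tends to zero.
\<close>

theorem Parseval:
  assumes f: "f \<in> L2"
  shows "((\<lambda>k. (norm (fcoeff f k))\<^sup>2) has_sum (L2_norm f)\<^sup>2) UNIV"
proof -
  have "(\<lambda>n. (L2_norm (\<lambda>x. fsum (cutoff n) (fcoeff f) x - f x))\<^sup>2) \<longlonglongrightarrow> 0\<^sup>2"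
    by (intro tendsto_power fourier_series_L2 f)
  then have "(\<lambda>n. (L2_norm f)\<^sup>2 - (\<Sum>k\<in>cutoff n. (norm (fcoeff f k))\<^sup>2)) \<longlonglongrightarrow> 0"
    by (subst (asm) L2_norm_minus_commute) (simp add: L2_norm_fourier_remainder f)
  then have "(\<lambda>n. (L2_norm f)\<^sup>2 - ((L2_norm f)\<^sup>2 - (\<Sum>k\<in>cutoff n. (norm (fcoeff f k))\<^sup>2))) \<longlonglongrightarrow> (L2_norm f)\<^sup>2 - 0"
    by (intro tendsto_intros)
  then have "(\<lambda>n. \<Sum>k\<in>cutoff n. (norm (fcoeff f k))\<^sup>2) \<longlonglongrightarrow> (L2_norm f)\<^sup>2" by simp
  moreover have "(\<lambda>n. \<Sum>k\<in>cutoff n. (norm (fcoeff f k))\<^sup>2) \<longlonglongrightarrow> (\<Sum>\<^sub>\<infinity>k. (norm (fcoeff f k))\<^sup>2)"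
    by (rule has_sum_cutoff[OF has_sum_infsum[OF Bessel[OF f]]])
  ultimately have "(\<Sum>\<^sub>\<infinity>k. (norm (fcoeff f k))\<^sup>2) = (L2_norm f)\<^sup>2" by (rule LIMSEQ_unique[rotated])
  then show ?thesis using has_sum_infsum[OF Bessel[OF f]] by simp
qed

section \<open>Weak derivatives and Sobolev norms\<close>

subsection \<open>Weak derivatives\<close>

lemma has_weak_partialD:
  assumes "has_weak_partial i f g"
  shows "f \<in> L2" "g \<in> L2"
    "\<And>\<theta>::real^3 \<Rightarrow> real. trig_poly \<theta> \<Longrightarrow> (LINT x|torus. classical_partial i \<theta> x *\<^sub>R f x) = - (LINT x|torus. \<theta> x *\<^sub>R g x)"
  using assms by (auto simp: has_weak_partial_def)

lemma trig_test_integrable: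
  fixes \<theta> :: "real^3 \<Rightarrow> real"
  assumes "trig_poly \<theta>" "f \<in> L2"
  shows "integrable torus (\<lambda>x. \<theta> x *\<^sub>R f x)" "integrable torus (\<lambda>x. classical_partial i \<theta> x *\<^sub>R f x)"
  by (intro L2_integrable trig_poly_mult_L2 trig_poly_classical_partial assms)+

lemma has_weak_partial_unique:
  assumes "has_weak_partial i f g" "has_weak_partial i f h"
  shows "AE x in torus. g x = h x"
proof -
  have "AE x in torus. g x - h x = 0"
  proof (rule L2_eq_0_AE_if_orthogonal)
    show "(\<lambda>x. g x - h x) \<in> L2" using assms by (auto dest: has_weak_partialD)
    fix \<theta> :: "real^3 \<Rightarrow> real" assume "trig_poly \<theta>"
    then show "(LINT x|torus. \<theta> x *\<^sub>R (g x - h x)) = 0"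
      using has_weak_partialD(3)[OF assms(1), of \<theta>] has_weak_partialD(3)[OF assms(2), of \<theta>]
        trig_test_integrable(1)[of \<theta> g] trig_test_integrable(1)[of \<theta> h] has_weak_partialD[OF assms(1)] has_weak_partialD[OF assms(2)]
      by (simp add: scaleR_diff_right)
  qed
  then show ?thesis by simp
qed

lemma has_weak_partial_weak_partial: "has_weak_partial i f g \<Longrightarrow> has_weak_partial i f (weak_partial i f)"
  unfolding weak_partial_def by (rule someI[of "has_weak_partial i f"])

lemma weak_partial_AE:
  assumes "has_weak_partial i f g" shows "AE x in torus. weak_partial i f x = g x"
  using has_weak_partial_weak_partial[OF assms] assms by (rule has_weak_partial_unique)

lemma has_weak_partial_add:
  assumes "has_weak_partial i f f'" "has_weak_partial i g g'"
  shows "has_weak_partial i (\<lambda>x. f x + g x) (\<lambda>x. f' x + g' x)"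
  unfolding has_weak_partial_def
proof (intro conjI allI impI)
  note D = has_weak_partialD[OF assms(1)] and E = has_weak_partialD[OF assms(2)]
  show "(\<lambda>x. f x + g x) \<in> L2" "(\<lambda>x. f' x + g' x) \<in> L2" by (intro L2_add D E)+
  fix \<theta> :: "real^3 \<Rightarrow> real" assume \<theta>: "trig_poly \<theta>"
  show "(LINT x|torus. classical_partial i \<theta> x *\<^sub>R (f x + g x)) = - (LINT x|torus. \<theta> x *\<^sub>R (f' x + g' x))"
    by (simp add: scaleR_add_right trig_test_integrable \<theta> D(1,2) E(1,2) D(3)[OF \<theta>] E(3)[OF \<theta>])
qed

lemma has_weak_partial_linear:
  assumes "bounded_linear h" "has_weak_partial i f f'"
  shows "has_weak_partial i (\<lambda>x. h (f x)) (\<lambda>x. h (f' x))"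
  unfolding has_weak_partial_def
proof (intro conjI allI impI)
  interpret bounded_linear h by fact
  note D = has_weak_partialD[OF assms(2)]
  show "(\<lambda>x. h (f x)) \<in> L2" "(\<lambda>x. h (f' x)) \<in> L2" by (rule L2_bounded_linear[OF assms(1) D(1)], rule L2_bounded_linear[OF assms(1) D(2)])
  fix \<theta> :: "real^3 \<Rightarrow> real" assume \<theta>: "trig_poly \<theta>"
  have "(LINT x|torus. classical_partial i \<theta> x *\<^sub>R h (f x)) = h (LINT x|torus. classical_partial i \<theta> x *\<^sub>R f x)"
    using integral_bounded_linear[OF assms(1) trig_test_integrable(2)[OF \<theta> D(1)]] by (simp add: scale)
  also have "\<dots> = - h (LINT x|torus. \<theta> x *\<^sub>R f' x)" by (simp add: D(3)[OF \<theta>] neg)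
  also have "\<dots> = - (LINT x|torus. \<theta> x *\<^sub>R h (f' x))"
    using integral_bounded_linear[OF assms(1) trig_test_integrable(1)[OF \<theta> D(2)]] by (simp add: scale)
  finally show "(LINT x|torus. classical_partial i \<theta> x *\<^sub>R h (f x)) = - (LINT x|torus. \<theta> x *\<^sub>R h (f' x))" .
qed

lemma has_weak_partial_scaleR:
  "has_weak_partial i f f' \<Longrightarrow> has_weak_partial i (\<lambda>x. c *\<^sub>R f x) (\<lambda>x. c *\<^sub>R f' x)"
  by (rule has_weak_partial_linear[OF bounded_linear_scaleR_right])

lemma has_weak_partial_0: "has_weak_partial i (\<lambda>x. 0) (\<lambda>x. 0)"
  by (simp add: has_weak_partial_def)

lemma has_weak_partial_sum:
  assumes "finite I" "\<And>j. j \<in> I \<Longrightarrow> has_weak_partial i (f j) (f' j)"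
  shows "has_weak_partial i (\<lambda>x. \<Sum>j\<in>I. f j x) (\<lambda>x. \<Sum>j\<in>I. f' j x)"
  using assms by (induction I rule: finite_induct) (auto simp: has_weak_partial_0 has_weak_partial_add)

lemma vec_eq_sum_axis: "(v::real^3) = (\<Sum>j\<in>UNIV. (v $ j) *\<^sub>R axis j 1)"
  by (simp add: vec_eq_iff axis_def if_distrib cong: if_cong)

lemma has_weak_partial_vecI:
  fixes f g :: vfield
  assumes "\<And>j. has_weak_partial i (\<lambda>x. f x $ j) (\<lambda>x. g x $ j)"
  shows "has_weak_partial i f g"
proof -
  have "has_weak_partial i (\<lambda>x. \<Sum>j\<in>UNIV. (f x $ j) *\<^sub>R axis j (1::real)) (\<lambda>x. \<Sum>j\<in>UNIV. (g x $ j) *\<^sub>R axis j 1)"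
    by (intro has_weak_partial_sum has_weak_partial_linear[OF bounded_linear_scaleR_left] assms) simp
  then show ?thesis by (simp flip: vec_eq_sum_axis)
qed

lemma has_weak_partial_nth:
  "has_weak_partial i f g \<Longrightarrow> has_weak_partial i (\<lambda>x. f x $ j) (\<lambda>x. g x $ j)"
  by (rule has_weak_partial_linear[OF bounded_linear_vec_nth])

lemma has_weak_partial_complexify:
  "has_weak_partial i f g \<Longrightarrow> has_weak_partial i (complexify f j) (complexify g j)"
  by (intro has_weak_partial_linear[OF bounded_linear_of_real] has_weak_partial_nth)

lemma tendsto_trig_test:
  fixes \<theta> :: "real^3 \<Rightarrow> real"
  assumes "trig_poly \<theta>" "\<And>n. f n \<in> L2" "F \<in> L2" "(\<lambda>n. L2_norm (\<lambda>x. f n x - F x)) \<longlonglongrightarrow> 0"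
  shows "(\<lambda>n. LINT x|torus. \<theta> x *\<^sub>R f n x) \<longlonglongrightarrow> (LINT x|torus. \<theta> x *\<^sub>R F x)"
proof -
  obtain M where M: "\<And>x. norm (\<theta> x) \<le> M" using trig_poly_bounded[OF assms(1)] by blast
  have "norm ((LINT x|torus. \<theta> x *\<^sub>R f n x) - (LINT x|torus. \<theta> x *\<^sub>R F x)) \<le> M * L2_norm (\<lambda>x. f n x - F x)" for n
  proof -
    have d: "(\<lambda>x. f n x - F x) \<in> L2" using assms by auto
    have "(LINT x|torus. \<theta> x *\<^sub>R f n x) - (LINT x|torus. \<theta> x *\<^sub>R F x) = (LINT x|torus. \<theta> x *\<^sub>R (f n x - F x))"
      using assms by (simp add: trig_test_integrable scaleR_diff_right)
    also have "norm \<dots> \<le> (LINT x|torus. norm (\<theta> x *\<^sub>R (f n x - F x)))"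
      by (rule integral_norm_bound)
    also have "\<dots> \<le> (LINT x|torus. M * norm (f n x - F x))"
    proof (rule integral_mono)
      show "integrable torus (\<lambda>x. norm (\<theta> x *\<^sub>R (f n x - F x)))"
        by (rule integrable_norm[OF trig_test_integrable(1)[OF assms(1) d]])
      show "integrable torus (\<lambda>x. M * norm (f n x - F x))"
        by (rule integrable_mult_right[OF integrable_norm[OF L2_integrable[OF d]]])
      show "norm (\<theta> x *\<^sub>R (f n x - F x)) \<le> M * norm (f n x - F x)" for x
        using mult_right_mono[OF M[of x] norm_ge_zero] by simp
    qed
    also have "\<dots> \<le> M * L2_norm (\<lambda>x. f n x - F x)"
      using L1_le_L2_norm[OF d] order_trans[OF norm_ge_zero M] by (simp add: mult_left_mono)
    finally show ?thesis .
  qed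
  then have *: "\<forall>\<^sub>F n in sequentially. norm ((LINT x|torus. \<theta> x *\<^sub>R f n x) - (LINT x|torus. \<theta> x *\<^sub>R F x))
      \<le> M * L2_norm (\<lambda>x. f n x - F x)" by (rule always_eventually[OF allI])
  have "(\<lambda>n. M * L2_norm (\<lambda>x. f n x - F x)) \<longlonglongrightarrow> 0"
    using tendsto_mult[OF tendsto_const assms(4), of M] by simp
  with * have "(\<lambda>n. (LINT x|torus. \<theta> x *\<^sub>R f n x) - (LINT x|torus. \<theta> x *\<^sub>R F x)) \<longlonglongrightarrow> 0"
    by (rule Lim_null_comparison)
  then show ?thesis by (simp add: LIM_zero_iff)
qed

text \<open>
  Weak differentiation is a closed operator: both sides of the defining identity are continuous in
  \<open>L\<^sup>2\<close> for each fixed test function.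
\<close>

lemma has_weak_partial_closed:
  assumes "\<And>n. has_weak_partial i (f n) (g n)" "F \<in> L2" "G \<in> L2"
    "(\<lambda>n. L2_norm (\<lambda>x. f n x - F x)) \<longlonglongrightarrow> 0" "(\<lambda>n. L2_norm (\<lambda>x. g n x - G x)) \<longlonglongrightarrow> 0"
  shows "has_weak_partial i F G"
  unfolding has_weak_partial_def
proof (intro conjI allI impI)
  fix \<theta> :: "real^3 \<Rightarrow> real" assume \<theta>: "trig_poly \<theta>"
  note D = has_weak_partialD[OF assms(1)]
  have "(\<lambda>n. LINT x|torus. classical_partial i \<theta> x *\<^sub>R f n x) \<longlonglongrightarrow> (LINT x|torus. classical_partial i \<theta> x *\<^sub>R F x)"
    by (intro tendsto_trig_test trig_poly_classical_partial \<theta> D assms)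
  moreover have "(\<lambda>n. - (LINT x|torus. \<theta> x *\<^sub>R g n x)) \<longlonglongrightarrow> - (LINT x|torus. \<theta> x *\<^sub>R G x)"
    by (intro tendsto_minus tendsto_trig_test \<theta> D assms)
  ultimately show "(LINT x|torus. classical_partial i \<theta> x *\<^sub>R F x) = - (LINT x|torus. \<theta> x *\<^sub>R G x)"
    unfolding D(3)[OF \<theta>] by (rule LIMSEQ_unique)
qed (use assms in auto)

text \<open>
  Test with the cosine and the sine of the given frequency.
\<close>

lemma fcoeff_weak_partial:
  assumes "has_weak_partial i f g"
  shows "fcoeff g k = \<i> * wavevector k $ i * fcoeff f k"
proof -
  note D = has_weak_partialD[OF assms]
  let ?c = "\<lambda>h. LINT x|torus. cos (wavevector k \<bullet> x) *\<^sub>R h x" and ?s = "\<lambda>h. LINT x|torus. sin (wavevector k \<bullet> x) *\<^sub>R h x"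
  have cs: "fcoeff h k = ?c h - \<i> * ?s h" if "h \<in> L2" for h
    by (simp add: fcoeff_cos_sin[OF that] algebra_simps) (simp add: field_simps)
  have "trig_poly (\<lambda>x. cos (wavevector k \<bullet> x))" "trig_poly (\<lambda>x. sin (wavevector k \<bullet> x))"
    using trig_poly_cos[of k "1::real"] trig_poly_sin[of k "1::real"] by simp_all
  note D3 = this[THEN D(3)]
  have "classical_partial i (\<lambda>x. cos (wavevector k \<bullet> x)) = (\<lambda>x. sin (wavevector k \<bullet> x) * (- wavevector k $ i))"
    "classical_partial i (\<lambda>x. sin (wavevector k \<bullet> x)) = (\<lambda>x. cos (wavevector k \<bullet> x) * wavevector k $ i)"
    using classical_partial_cos[of i k "1::real"] classical_partial_sin[of i k "1::real"] by simp_all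
  note D3 = D3[unfolded this]
  have "(- wavevector k $ i) *\<^sub>R ?s f = - ?c g"
    using D3(1) by (simp add: mult.commute flip: scaleR_scaleR integral_scaleR_right)
  moreover have "(wavevector k $ i) *\<^sub>R ?c f = - ?s g"
    using D3(2) by (simp add: mult.commute flip: scaleR_scaleR integral_scaleR_right)
  ultimately show ?thesis
    by (simp add: cs D scaleR_conv_of_real algebra_simps)
qed

lemma has_weak_partial_fsum:
  assumes "finite K"
  shows "has_weak_partial i (fsum K c) (fsum K (\<lambda>k. \<i> * wavevector k $ i * c k))"
proof -
  have "has_weak_partial i (\<lambda>x. c k * cis (wavevector k \<bullet> x)) (\<lambda>x. \<i> * wavevector k $ i * c k * cis (wavevector k \<bullet> x))" for k
  proof -
    have "has_weak_partial i (\<lambda>x. cos (wavevector k \<bullet> x) *\<^sub>R c k + sin (wavevector k \<bullet> x) *\<^sub>R (\<i> * c k))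
      (\<lambda>x. sin (wavevector k \<bullet> x) *\<^sub>R ((- wavevector k $ i) *\<^sub>R c k) + cos (wavevector k \<bullet> x) *\<^sub>R (wavevector k $ i *\<^sub>R (\<i> * c k)))"
      using trig_poly_has_weak_partial[OF trig_poly_cos[of k "c k"], of i] trig_poly_has_weak_partial[OF trig_poly_sin[of k "\<i> * c k"], of i]
      unfolding classical_partial_cos classical_partial_sin by (rule has_weak_partial_add)
    also have "(\<lambda>x. cos (wavevector k \<bullet> x) *\<^sub>R c k + sin (wavevector k \<bullet> x) *\<^sub>R (\<i> * c k)) = (\<lambda>x. c k * cis (wavevector k \<bullet> x))"
      by (rule ext) (simp add: complex_eq_iff algebra_simps)
    also have "(\<lambda>x. sin (wavevector k \<bullet> x) *\<^sub>R ((- wavevector k $ i) *\<^sub>R c k) + cos (wavevector k \<bullet> x) *\<^sub>R (wavevector k $ i *\<^sub>R (\<i> * c k)))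
      = (\<lambda>x. \<i> * wavevector k $ i * c k * cis (wavevector k \<bullet> x))"
      by (rule ext) (simp add: complex_eq_iff algebra_simps)
    finally show ?thesis .
  qed
  then show ?thesis unfolding fsum_def by (intro has_weak_partial_sum assms)
qed

text \<open>
  The derivatives of the partial sums of the Fourier series converge by the Riesz-Fischer theorem, and
  weak differentiation is closed.
\<close>

lemma has_weak_partial_complex_exists:
  assumes f: "f \<in> L2" and "(\<lambda>k. (wavevector k $ i)\<^sup>2 * (norm (fcoeff f k))\<^sup>2) summable_on UNIV"
  obtains g where "has_weak_partial i f g"
proof -
  have "(\<lambda>k. (norm (\<i> * wavevector k $ i * fcoeff f k))\<^sup>2) summable_on UNIV"
    using assms(2) by (simp add: norm_mult power_mult_distrib)
  then obtain g where "g \<in> L2"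
    "(\<lambda>n. L2_norm (\<lambda>x. fsum (cutoff n) (\<lambda>k. \<i> * wavevector k $ i * fcoeff f k) x - g x)) \<longlonglongrightarrow> 0"
    by (rule Riesz_Fischer)
  then have "has_weak_partial i f g"
    by (intro has_weak_partial_closed[OF has_weak_partial_fsum[OF finite_cutoff] f _ fourier_series_L2[OF f]])
  then show ?thesis by (rule that)
qed

subsection \<open>Sobolev spaces\<close>

lemma norm_vec3_sq: "(norm (v :: 'a::real_normed_vector^3))\<^sup>2 = (\<Sum>j\<in>UNIV. (norm (v $ j))\<^sup>2)"
  by (simp add: norm_vec_def L2_set_def sum_nonneg)

lemma vfield_L2_complexify: "f \<in> L2 \<Longrightarrow> complexify f j \<in> L2"
  by (rule L2_bounded_linear[OF bounded_linear_of_real L2_bounded_linear[OF bounded_linear_vec_nth]])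

lemma L2_norm_sq_integral: "(L2_norm f)\<^sup>2 = (LINT x|torus. (norm (f x))\<^sup>2)"
  by (simp add: L2_norm_sq L2_inner_def power2_norm_eq_inner)

lemma L2_norm_sq_components:
  assumes "f \<in> L2" shows "(L2_norm f)\<^sup>2 = (\<Sum>j\<in>UNIV. (L2_norm (complexify f j))\<^sup>2)"
proof -
  have "(L2_norm f)\<^sup>2 = (LINT x|torus. (\<Sum>j\<in>UNIV. (norm (complexify f j x))\<^sup>2))"
    by (simp add: L2_norm_sq_integral norm_vec3_sq)
  also have "\<dots> = (\<Sum>j\<in>UNIV. LINT x|torus. (norm (complexify f j x))\<^sup>2)"
    by (intro Bochner_Integration.integral_sum L2_integrable_sq vfield_L2_complexify assms)
  finally show ?thesis by (simp only: L2_norm_sq_integral)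
qed

lemma has_sum_finite_sum:
  fixes f :: "'i \<Rightarrow> 'a \<Rightarrow> real"
  assumes "finite I" "\<And>i. i \<in> I \<Longrightarrow> (f i has_sum s i) A"
  shows "((\<lambda>k. \<Sum>i\<in>I. f i k) has_sum (\<Sum>i\<in>I. s i)) A"
  using assms by (induction I rule: finite_induct) (auto intro: has_sum_add)

lemma Parseval_vfield:
  assumes "f \<in> L2" shows "((\<lambda>k. (norm (fourier_coeff f k))\<^sup>2) has_sum (L2_norm f)\<^sup>2) UNIV"
  unfolding L2_norm_sq_components[OF assms] norm_vec3_sq fourier_coeff_nth
  by (intro has_sum_finite_sum Parseval vfield_L2_complexify assms finite)

lemma Hs_L2: "f \<in> Hs s \<Longrightarrow> f \<in> L2"
  by (simp add: Hs_def)

abbreviation sobolev_term :: "real \<Rightarrow> vfield \<Rightarrow> int^3 \<Rightarrow> real" where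
  "sobolev_term s f k \<equiv> (1 + (norm (wavevector k))\<^sup>2) powr s * (norm (fourier_coeff f k))\<^sup>2"

lemma Hs_summable: "f \<in> Hs s \<Longrightarrow> sobolev_term s f summable_on UNIV"
  by (simp add: Hs_def)

lemma Hs_norm_nonneg [simp]: "0 \<le> Hs_norm s f"
  by (simp add: Hs_norm_def infsum_nonneg)

lemma Hs_norm_sq: "(Hs_norm s f)\<^sup>2 = infsum (sobolev_term s f) UNIV"
  by (simp add: Hs_norm_def infsum_nonneg)

lemma Hs_mono: assumes "r \<le> s" "f \<in> Hs s" shows "f \<in> Hs r" "Hs_norm r f \<le> Hs_norm s f"
proof -
  have le: "sobolev_term r f k \<le> sobolev_term s f k" for k
    using assms(1) by (intro mult_right_mono powr_mono) auto
  have sr: "sobolev_term r f summable_on UNIV"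
    by (rule summable_on_comparison_test[OF Hs_summable[OF assms(2)]]) (auto simp: le)
  then show "f \<in> Hs r" using assms by (simp add: Hs_def)
  show "Hs_norm r f \<le> Hs_norm s f"
    unfolding Hs_norm_def by (intro real_sqrt_le_mono infsum_mono sr Hs_summable assms le)
qed

lemma fourier_coeff_add:
  "f \<in> L2 \<Longrightarrow> g \<in> L2 \<Longrightarrow> fourier_coeff (\<lambda>x. f x + g x) k = fourier_coeff f k + fourier_coeff g k"
  by (simp add: vec_eq_iff fourier_coeff_nth fcoeff_add vfield_L2_complexify)

lemma fourier_coeff_scaleR: "fourier_coeff (\<lambda>x. c *\<^sub>R f x) k = c *\<^sub>R fourier_coeff f k"
  by (simp add: vec_eq_iff fourier_coeff_nth fcoeff_mult scaleR_conv_of_real[where 'a=complex])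

text \<open>
  The estimate \<open>(a + b)\<^sup>2 \<le> 2 a\<^sup>2 + 2 b\<^sup>2\<close> under the sum gives membership and a triangle inequality with
  the constant 2 at once.  The constant is harmless: the inequality only serves to establish limits and
  boundedness.
\<close>

lemma Hs_add:
  assumes "f \<in> Hs s" "g \<in> Hs s"
  shows "(\<lambda>x. f x + g x) \<in> Hs s" "Hs_norm s (\<lambda>x. f x + g x) \<le> 2 * (Hs_norm s f + Hs_norm s g)"
proof -
  have le: "sobolev_term s (\<lambda>x. f x + g x) k \<le> 2 * sobolev_term s f k + 2 * sobolev_term s g k" for k
  proof -
    have "(norm (fourier_coeff f k + fourier_coeff g k))\<^sup>2 \<le> (norm (fourier_coeff f k) + norm (fourier_coeff g k))\<^sup>2"
      by (intro power_mono norm_triangle_ineq) simp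
    also have "\<dots> \<le> 2 * (norm (fourier_coeff f k))\<^sup>2 + 2 * (norm (fourier_coeff g k))\<^sup>2"
      using sum_squares_bound[of "norm (fourier_coeff f k)" "norm (fourier_coeff g k)"] by (simp add: power2_sum)
    finally have "(1 + (norm (wavevector k))\<^sup>2) powr s * (norm (fourier_coeff f k + fourier_coeff g k))\<^sup>2
        \<le> (1 + (norm (wavevector k))\<^sup>2) powr s * (2 * (norm (fourier_coeff f k))\<^sup>2 + 2 * (norm (fourier_coeff g k))\<^sup>2)"
      by (rule mult_left_mono) simp
    then show ?thesis
      using assms by (simp add: fourier_coeff_add Hs_L2 distrib_left mult.left_commute)
  qed
  have sum: "(\<lambda>k. 2 * sobolev_term s f k + 2 * sobolev_term s g k) summable_on UNIV"
    by (intro summable_on_add summable_on_cmult_right Hs_summable assms)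
  have s: "sobolev_term s (\<lambda>x. f x + g x) summable_on UNIV"
    by (rule summable_on_comparison_test[OF sum]) (auto simp: le)
  then show "(\<lambda>x. f x + g x) \<in> Hs s" using assms by (auto simp: Hs_def)
  have "(Hs_norm s (\<lambda>x. f x + g x))\<^sup>2 \<le> (\<Sum>\<^sub>\<infinity>k. 2 * sobolev_term s f k + 2 * sobolev_term s g k)"
    unfolding Hs_norm_sq by (intro infsum_mono s sum le)
  also have "\<dots> = 2 * (Hs_norm s f)\<^sup>2 + 2 * (Hs_norm s g)\<^sup>2"
    unfolding Hs_norm_sq using Hs_summable[OF assms(1)] Hs_summable[OF assms(2)]
    by (simp add: infsum_add infsum_cmult_right summable_on_cmult_right)
  also have "\<dots> \<le> (2 * (Hs_norm s f + Hs_norm s g))\<^sup>2"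
    using mult_nonneg_nonneg[OF Hs_norm_nonneg Hs_norm_nonneg, of s f s g]
      zero_le_power2[of "Hs_norm s f"] zero_le_power2[of "Hs_norm s g"]
    by (simp add: power2_sum power_mult_distrib del: zero_le_power2)
  finally show "Hs_norm s (\<lambda>x. f x + g x) \<le> 2 * (Hs_norm s f + Hs_norm s g)"
    by (rule power2_le_imp_le) simp
qed

lemma Hs_scaleR:
  assumes "f \<in> Hs s" shows "(\<lambda>x. c *\<^sub>R f x) \<in> Hs s"
proof -
  have "sobolev_term s (\<lambda>x. c *\<^sub>R f x) = (\<lambda>k. c\<^sup>2 * sobolev_term s f k)"
    by (rule ext) (simp add: fourier_coeff_scaleR power_mult_distrib)
  moreover have "(\<lambda>k. c\<^sup>2 * sobolev_term s f k) summable_on UNIV"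
    by (intro summable_on_cmult_right Hs_summable assms)
  ultimately show ?thesis using assms by (auto simp: Hs_def)
qed

lemma Hs_norm_scaleR: "Hs_norm s (\<lambda>x. c *\<^sub>R f x) = \<bar>c\<bar> * Hs_norm s f"
proof -
  have "sobolev_term s (\<lambda>x. c *\<^sub>R f x) = (\<lambda>k. c\<^sup>2 * sobolev_term s f k)"
    by (rule ext) (simp add: fourier_coeff_scaleR power_mult_distrib)
  then show ?thesis
    by (simp add: Hs_norm_def infsum_cmult_right' real_sqrt_mult)
qed

lemma Hs_diff: "f \<in> Hs s \<Longrightarrow> g \<in> Hs s \<Longrightarrow> (\<lambda>x. f x - g x) \<in> Hs s"
  using Hs_add(1)[OF _ Hs_scaleR[where c="-1"]] by simp

lemma fourier_coeff_weak_partial: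
  assumes "has_weak_partial i f g"
  shows "(norm (fourier_coeff g k))\<^sup>2 = (wavevector k $ i)\<^sup>2 * (norm (fourier_coeff f k))\<^sup>2"
proof -
  have "fourier_coeff g k $ j = \<i> * wavevector k $ i * fourier_coeff f k $ j" for j
    unfolding fourier_coeff_nth by (rule fcoeff_weak_partial[OF has_weak_partial_complexify[OF assms]])
  then show ?thesis by (simp add: norm_vec3_sq norm_mult power_mult_distrib sum_distrib_left)
qed

text \<open>
  The components are differentiated as complex-valued functions; test functions being real, the real
  part of a weak derivative of a real function is again one.
\<close>

lemma Hs_1_has_weak_partial:
  assumes f: "f \<in> Hs 1" shows "has_weak_partial i f (weak_partial i f)"
proof -
  have "\<exists>g. has_weak_partial i (complexify f j) g" for j
  proof -
    have "(wavevector k $ i)\<^sup>2 * (norm (fcoeff (complexify f j) k))\<^sup>2 \<le> sobolev_term 1 f k" for k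
    proof (rule mult_mono)
      have "(wavevector k $ i)\<^sup>2 \<le> (norm (wavevector k))\<^sup>2"
        using component_le_norm_cart[of "wavevector k" i] by (metis abs_ge_zero power2_abs power_mono)
      then show "(wavevector k $ i)\<^sup>2 \<le> (1 + (norm (wavevector k))\<^sup>2) powr 1"
        by (simp add: add_nonneg_nonneg)
      have "norm (fcoeff (complexify f j) k) \<le> norm (fourier_coeff f k)"
        unfolding fourier_coeff_nth[symmetric] by (rule Finite_Cartesian_Product.norm_nth_le)
      then show "(norm (fcoeff (complexify f j) k))\<^sup>2 \<le> (norm (fourier_coeff f k))\<^sup>2"
        by (rule power_mono) simp
    qed auto
    then have "(\<lambda>k. (wavevector k $ i)\<^sup>2 * (norm (fcoeff (complexify f j) k))\<^sup>2) summable_on UNIV"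
      by (intro summable_on_comparison_test[OF Hs_summable[OF f]]) auto
    then show ?thesis
      by (rule has_weak_partial_complex_exists[OF vfield_L2_complexify[OF Hs_L2[OF f]]]) (rule exI)
  qed
  then obtain G where G: "\<And>j. has_weak_partial i (complexify f j) (G j)" by metis
  have "has_weak_partial i f (\<lambda>x. \<chi> j. Re (G j x))"
    by (rule has_weak_partial_vecI) (use has_weak_partial_linear[OF bounded_linear_Re G] in simp)
  then show ?thesis by (rule has_weak_partial_weak_partial)
qed

text \<open>
  Parseval's identity for the function and for each of its derivatives, added up.
\<close>

lemma Hs_1I:
  assumes "\<And>i. has_weak_partial i f (g i)"
  shows "f \<in> Hs 1" "(Hs_norm 1 f)\<^sup>2 = (L2_norm f)\<^sup>2 + (\<Sum>i\<in>UNIV. (L2_norm (g i))\<^sup>2)"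
proof -
  have f: "f \<in> L2" and g: "g i \<in> L2" for i using has_weak_partialD[OF assms] by auto
  have "((\<lambda>k. (norm (fourier_coeff f k))\<^sup>2 + (\<Sum>i\<in>UNIV. (norm (fourier_coeff (g i) k))\<^sup>2)) has_sum
      (L2_norm f)\<^sup>2 + (\<Sum>i\<in>UNIV. (L2_norm (g i))\<^sup>2)) UNIV"
    by (intro has_sum_add has_sum_finite_sum Parseval_vfield f g finite)
  also have "(\<lambda>k. (norm (fourier_coeff f k))\<^sup>2 + (\<Sum>i\<in>UNIV. (norm (fourier_coeff (g i) k))\<^sup>2)) = sobolev_term 1 f"
  proof
    fix k
    have "(\<Sum>i\<in>UNIV. (wavevector k $ i)\<^sup>2) = (norm (wavevector k))\<^sup>2" by (simp add: norm_vec3_sq)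
    then show "(norm (fourier_coeff f k))\<^sup>2 + (\<Sum>i\<in>UNIV. (norm (fourier_coeff (g i) k))\<^sup>2) = sobolev_term 1 f k"
      by (simp add: fourier_coeff_weak_partial[OF assms] algebra_simps add_nonneg_nonneg flip: sum_distrib_right)
  qed
  finally have s: "(sobolev_term 1 f has_sum (L2_norm f)\<^sup>2 + (\<Sum>i\<in>UNIV. (L2_norm (g i))\<^sup>2)) UNIV" .
  then show "f \<in> Hs 1" using f by (auto simp: Hs_def summable_on_def)
  show "(Hs_norm 1 f)\<^sup>2 = (L2_norm f)\<^sup>2 + (\<Sum>i\<in>UNIV. (L2_norm (g i))\<^sup>2)"
    unfolding Hs_norm_sq by (rule infsumI[OF s])
qed

lemma weak_partial_L2: "f \<in> Hs 1 \<Longrightarrow> weak_partial i f \<in> L2"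
  using Hs_1_has_weak_partial has_weak_partialD by blast

lemma Hs_norm_1_sq:
  "f \<in> Hs 1 \<Longrightarrow> (Hs_norm 1 f)\<^sup>2 = (L2_norm f)\<^sup>2 + (\<Sum>i\<in>UNIV. (L2_norm (weak_partial i f))\<^sup>2)"
  using Hs_1I(2)[of f "\<lambda>i. weak_partial i f"] Hs_1_has_weak_partial by blast

lemma L2_norm_le_Hs_norm_1: assumes "f \<in> Hs 1" shows "L2_norm f \<le> Hs_norm 1 f"
  by (rule power2_le_imp_le) (simp_all add: Hs_norm_1_sq[OF assms] sum_nonneg)

lemma weak_partial_norm_le: assumes "f \<in> Hs 1" shows "L2_norm (weak_partial i f) \<le> Hs_norm 1 f"
proof (rule power2_le_imp_le)
  have "(L2_norm (weak_partial i f))\<^sup>2 \<le> (\<Sum>i\<in>UNIV. (L2_norm (weak_partial i f))\<^sup>2)"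
    by (rule member_le_sum) auto
  then show "(L2_norm (weak_partial i f))\<^sup>2 \<le> (Hs_norm 1 f)\<^sup>2"
    by (simp add: Hs_norm_1_sq[OF assms] add_increasing)
qed simp

lemma trig_poly_Hs_1: "trig_poly f \<Longrightarrow> f \<in> Hs 1"
  by (rule Hs_1I(1)[OF trig_poly_has_weak_partial])

lemma weak_partial_add:
  assumes "f \<in> Hs 1" "g \<in> Hs 1"
  shows "AE x in torus. weak_partial i (\<lambda>x. f x + g x) x = weak_partial i f x + weak_partial i g x"
  by (rule weak_partial_AE[OF has_weak_partial_add]; rule Hs_1_has_weak_partial; fact)

lemma weak_partial_scaleR:
  assumes "f \<in> Hs 1"
  shows "AE x in torus. weak_partial i (\<lambda>x. c *\<^sub>R f x) x = c *\<^sub>R weak_partial i f x"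
  by (rule weak_partial_AE[OF has_weak_partial_scaleR]; rule Hs_1_has_weak_partial; fact)

lemma weak_partial_trig_poly:
  "trig_poly f \<Longrightarrow> AE x in torus. weak_partial i f x = classical_partial i f x"
  by (rule weak_partial_AE[OF trig_poly_has_weak_partial])

lemma Hs_norm_0_AE:
  assumes "f \<in> L2" "AE x in torus. f x = 0" shows "Hs_norm s f = 0"
proof -
  have "fourier_coeff f k = 0" for k
  proof -
    have "fcoeff (complexify f j) k = (LINT x|torus. 0)" for j
      unfolding fcoeff_def
      by (subst integral_cong_AE[where g="\<lambda>_. 0"])
         (use assms borel_measurable_integrable[OF mult_cis_integrable[OF vfield_L2_complexify]] in \<open>auto elim: eventually_mono\<close>)
    then show ?thesis by (simp add: vec_eq_iff fourier_coeff_nth)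
  qed
  then show ?thesis by (simp add: Hs_norm_def)
qed

section \<open>Sobolev embeddings\<close>

abbreviation weight :: "int^3 \<Rightarrow> real" where
  "weight k \<equiv> 1 + (norm (wavevector k))\<^sup>2"

lemma weight_pos: "0 < weight k"
  by (simp add: add_pos_nonneg)

text \<open>
  The sum over the integers is at most twice a sum over the natural numbers, which is compared with
  \<open>\<Sum>n. n powr (- 4/3)\<close>; the extra 1 in the comparison accounts for \<open>n = 0\<close>.
\<close>

lemma sum_int_powr_bounded:
  obtains G where "\<And>A :: int set. finite A \<Longrightarrow> (\<Sum>m\<in>A. (1 + (real_of_int m)\<^sup>2) powr (-2/3)) \<le> G"
proof -
  define h where "h n = (1 + (real n)\<^sup>2) powr (-2/3)" for n
  have le: "h n \<le> real n powr (-4/3) + (if n = 0 then 1 else 0)" for n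
  proof (cases "n = 0")
    case False
    have "h n \<le> ((real n)\<^sup>2) powr (-2/3)"
      unfolding h_def using False by (intro powr_mono2') auto
    also have "\<dots> = (real n powr 2) powr (-2/3)" by simp
    also have "\<dots> = real n powr (-4/3)" unfolding powr_powr by simp
    finally show ?thesis using False by simp
  qed (simp add: h_def)
  have "summable (\<lambda>n. real n powr (-4/3) + (if n = 0 then 1 else 0))"
    by (rule summable_add[OF _ summable_finite[of "{0}"]]) (auto simp: summable_real_powr_iff)
  then have sh: "summable h"
    by (rule summable_comparison_test') (use le in \<open>auto simp: h_def\<close>)
  have inj: "(\<Sum>m\<in>B. h (nat \<bar>m\<bar>)) \<le> suminf h" if "finite B" "inj_on (\<lambda>m. nat \<bar>m\<bar>) B" for B :: "int set"
    unfolding sum.reindex[OF that(2), unfolded comp_def, symmetric]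
    using that by (intro sum_le_suminf sh) (auto simp: h_def)
  have "(\<Sum>m\<in>A. (1 + (real_of_int m)\<^sup>2) powr (-2/3)) \<le> suminf h + suminf h" if A: "finite A" for A :: "int set"
  proof -
    have "(\<Sum>m\<in>A. (1 + (real_of_int m)\<^sup>2) powr (-2/3)) = (\<Sum>m\<in>A. h (nat \<bar>m\<bar>))"
      by (intro sum.cong) (auto simp: h_def)
    also have "\<dots> = (\<Sum>m\<in>{m\<in>A. m \<ge> 0} \<union> {m\<in>A. m < 0}. h (nat \<bar>m\<bar>))"
      by (intro sum.cong) auto
    also have "\<dots> = (\<Sum>m\<in>{m\<in>A. m \<ge> 0}. h (nat \<bar>m\<bar>)) + (\<Sum>m\<in>{m\<in>A. m < 0}. h (nat \<bar>m\<bar>))"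
      using A by (intro sum.union_disjoint) auto
    also have "\<dots> \<le> suminf h + suminf h"
      using A by (intro add_mono inj) (auto simp: inj_on_def)
    finally show ?thesis .
  qed
  then show ?thesis by (rule that)
qed

text \<open>
  In dimension three the fourth power of the frequency is just enough for summability.  The sum is
  compared with a product of three one-dimensional sums, each coordinate receiving the exponent
  \<open>4/3 > 1\<close>.
\<close>

lemma inverse_weight_sq_bounded:
  obtains S where "\<And>F. finite F \<Longrightarrow> (\<Sum>k\<in>F. inverse ((weight k)\<^sup>2)) \<le> S"
proof -
  obtain G where G: "\<And>A :: int set. finite A \<Longrightarrow> (\<Sum>m\<in>A. (1 + (real_of_int m)\<^sup>2) powr (-2/3)) \<le> G"
    by (rule sum_int_powr_bounded) blast
  have le: "inverse ((weight k)\<^sup>2) \<le> (\<Prod>i\<in>UNIV. (1 + (real_of_int (k $ i))\<^sup>2) powr (-2/3))" for k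
  proof -
    have "weight k powr (-2/3) \<le> (1 + (real_of_int (k $ i))\<^sup>2) powr (-2/3)" for i
    proof (rule powr_mono2')
      have "(real_of_int (k $ i))\<^sup>2 \<le> (wavevector k $ i)\<^sup>2"
      proof -
        have "1 \<le> 2 * pi" using pi_gt3 by simp
        then have "1 \<le> (2 * pi)\<^sup>2" by (rule one_le_power)
        then have "1 * (real_of_int (k $ i))\<^sup>2 \<le> (2 * pi)\<^sup>2 * (real_of_int (k $ i))\<^sup>2"
          by (rule mult_right_mono) simp
        then show ?thesis by (simp add: wavevector_nth power_mult_distrib)
      qed
      also have "\<dots> \<le> (norm (wavevector k))\<^sup>2"
        using component_le_norm_cart[of "wavevector k" i] by (metis abs_ge_zero power2_abs power_mono)
      finally show "1 + (real_of_int (k $ i))\<^sup>2 \<le> weight k" by simp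
    qed (auto simp: add_pos_nonneg)
    then have "(\<Prod>i\<in>(UNIV::3 set). weight k powr (-2/3)) \<le> (\<Prod>i\<in>UNIV. (1 + (real_of_int (k $ i))\<^sup>2) powr (-2/3))"
      by (intro prod_mono) auto
    also have "(\<Prod>i\<in>(UNIV::3 set). weight k powr (-2/3)) = weight k powr (-2)"
      using weight_pos[of k] by (simp add: powr_power)
    also have "\<dots> = inverse ((weight k)\<^sup>2)"
      using weight_pos[of k] by (simp add: powr_minus powr_numeral)
    finally show ?thesis .
  qed
  have "(\<Sum>k\<in>F. inverse ((weight k)\<^sup>2)) \<le> G ^ 3" if F: "finite F" for F
  proof -
    define A where "A = (\<Union>k\<in>F. range (\<lambda>i. k $ i))"
    have A: "finite A" using F by (auto simp: A_def)
    let ?g = "\<lambda>m. (1 + (real_of_int m)\<^sup>2) powr (-2/3)"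
    have inj: "inj_on (\<lambda>k i. k $ i) F" by (auto simp: inj_on_def vec_eq_iff dest: fun_cong)
    have "(\<Sum>k\<in>F. inverse ((weight k)\<^sup>2)) \<le> (\<Sum>k\<in>F. \<Prod>i\<in>UNIV. ?g (k $ i))"
      by (intro sum_mono le)
    also have "\<dots> = (\<Sum>p\<in>(\<lambda>k i. k $ i) ` F. \<Prod>i\<in>UNIV. ?g (p i))"
      by (simp add: sum.reindex[OF inj])
    also have "\<dots> \<le> (\<Sum>p\<in>PiE (UNIV::3 set) (\<lambda>_. A). \<Prod>i\<in>UNIV. ?g (p i))"
    proof (rule sum_mono2)
      show "finite (PiE (UNIV::3 set) (\<lambda>_. A))" using A by (intro finite_PiE) auto
      show "(\<lambda>k i. k $ i) ` F \<subseteq> PiE (UNIV::3 set) (\<lambda>_. A)" by (auto simp: A_def)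
    qed (auto intro: prod_nonneg)
    also have "\<dots> = (\<Prod>i\<in>(UNIV::3 set). \<Sum>m\<in>A. ?g m)"
      by (rule prod_sum_PiE[symmetric]) (use A in auto)
    also have "\<dots> = (\<Sum>m\<in>A. ?g m) ^ 3" by simp
    also have "\<dots> \<le> G ^ 3" by (intro power_mono G A sum_nonneg) auto
    finally show ?thesis .
  qed
  then show ?thesis by (rule that)
qed

text \<open>
  Any bound for these sums would do; fixing one lets all embedding estimates share it.
\<close>

definition embedding_const :: real where
  "embedding_const = (SOME S. \<forall>F. finite F \<longrightarrow> (\<Sum>k\<in>F. inverse ((weight k)\<^sup>2)) \<le> S)"

lemma sum_inverse_weight_sq_le: "finite F \<Longrightarrow> (\<Sum>k\<in>F. inverse ((weight k)\<^sup>2)) \<le> embedding_const"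
proof -
  obtain S where "\<And>F. finite F \<Longrightarrow> (\<Sum>k\<in>F. inverse ((weight k)\<^sup>2)) \<le> S"
    by (rule inverse_weight_sq_bounded) blast
  then have "\<exists>S. \<forall>F. finite F \<longrightarrow> (\<Sum>k\<in>F. inverse ((weight k)\<^sup>2)) \<le> S" by blast
  from someI_ex[OF this] show "finite F \<Longrightarrow> (\<Sum>k\<in>F. inverse ((weight k)\<^sup>2)) \<le> embedding_const"
    unfolding embedding_const_def by blast
qed

lemma embedding_const_nonneg: "0 \<le> embedding_const"
  using sum_inverse_weight_sq_le[of "{}"] by simp

subsection \<open>Fourth powers of functions with one derivative\<close>

text \<open>
  The square of a trigonometric polynomial has the convolution of the coefficients with themselves
  as coefficients.  Distributing the weights over the two factors, Cauchy-Schwarz on each line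
  \<open>k + l = n\<close> costs only the constant from above.
\<close>

lemma fourth_power_fsum_le:
  assumes K: "finite K"
  shows "(L2_norm (\<lambda>x. fsum K c x * fsum K c x))\<^sup>2 \<le> embedding_const * (\<Sum>k\<in>K. weight k * (norm (c k))\<^sup>2)\<^sup>2"
proof -
  define P where "P n = {p \<in> K \<times> K. fst p + snd p = n}" for n
  define N where "N = (\<lambda>p. fst p + snd p) ` (K \<times> K)"
  define d where "d n = (\<Sum>p\<in>P n. c (fst p) * c (snd p))" for n
  have fin: "finite (K \<times> K)" "finite N" "finite (P n)" for n using K by (auto simp: N_def P_def)
  have "fsum K c x * fsum K c x = fsum N d x" for x
  proof -
    let ?t = "\<lambda>p. c (fst p) * c (snd p) * cis (wavevector (fst p + snd p) \<bullet> x)"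
    have "fsum K c x * fsum K c x = (\<Sum>p\<in>K \<times> K. ?t p)"
      by (simp add: fsum_def sum_product sum.cartesian_product case_prod_beta wavevector_add inner_add_left
          mult_ac flip: cis_mult)
    also have "\<dots> = (\<Sum>n\<in>N. \<Sum>p\<in>P n. ?t p)"
      unfolding N_def P_def by (rule sum.image_gen[OF fin(1)])
    also have "\<dots> = fsum N d x"
      unfolding fsum_def d_def sum_distrib_right by (intro sum.cong refl) (auto simp: P_def)
    finally show ?thesis .
  qed
  then have "(L2_norm (\<lambda>x. fsum K c x * fsum K c x))\<^sup>2 = (\<Sum>n\<in>N. (norm (d n))\<^sup>2)"
    using L2_norm_fsum_sq[OF fin(2), of d] by simp
  also have "\<dots> \<le> (\<Sum>n\<in>N. embedding_const * (\<Sum>p\<in>P n. weight (fst p) * (norm (c (fst p)))\<^sup>2 * (weight (snd p) * (norm (c (snd p)))\<^sup>2)))"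
  proof (rule sum_mono)
    fix n
    \<comment> \<open>the weights are taken out of the first factor, leaving a convolution of inverse weights, and
      put into the second one\<close>
    define a b where "a p = inverse (sqrt (weight (fst p) * weight (snd p)))"
      and "b p = sqrt (weight (fst p) * weight (snd p)) * (norm (c (fst p)) * norm (c (snd p)))" for p
    have w: "0 < weight k * weight l" for k l using weight_pos by (intro mult_pos_pos)
    have "norm (d n) \<le> (\<Sum>p\<in>P n. a p * b p)"
    proof -
      have "norm (c (fst p) * c (snd p)) = a p * b p" for p
        using w[of "fst p" "snd p"] by (simp add: a_def b_def norm_mult field_simps)
      then show ?thesis unfolding d_def using norm_sum[of "\<lambda>p. c (fst p) * c (snd p)" "P n"] by simp
    qed
    then have "(norm (d n))\<^sup>2 \<le> (\<Sum>p\<in>P n. a p * b p)\<^sup>2" by (intro power_mono) auto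
    also have "\<dots> \<le> (\<Sum>p\<in>P n. (a p)\<^sup>2) * (\<Sum>p\<in>P n. (b p)\<^sup>2)" by (rule Cauchy_Schwarz_ineq_sum)
    also have "\<dots> \<le> embedding_const * (\<Sum>p\<in>P n. (b p)\<^sup>2)"
    proof (rule mult_right_mono)
      have "(a p)\<^sup>2 \<le> (1/2) * inverse ((weight (fst p))\<^sup>2) + (1/2) * inverse ((weight (snd p))\<^sup>2)" for p
      proof -
        have "(a p)\<^sup>2 = inverse (weight (fst p)) * inverse (weight (snd p))"
          using w[of "fst p" "snd p"] by (simp add: a_def power_inverse less_imp_le)
        also have "2 * \<dots> \<le> (inverse (weight (fst p)))\<^sup>2 + (inverse (weight (snd p)))\<^sup>2"
          using sum_squares_bound[of "inverse (weight (fst p))" "inverse (weight (snd p))"] by (simp only: mult.assoc)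
        finally show ?thesis by (simp add: power_inverse)
      qed
      then have "(\<Sum>p\<in>P n. (a p)\<^sup>2) \<le> (\<Sum>p\<in>P n. (1/2) * inverse ((weight (fst p))\<^sup>2) + (1/2) * inverse ((weight (snd p))\<^sup>2))"
        by (intro sum_mono)
      also have "\<dots> = (1/2) * (\<Sum>p\<in>P n. inverse ((weight (fst p))\<^sup>2)) + (1/2) * (\<Sum>p\<in>P n. inverse ((weight (snd p))\<^sup>2))"
        by (simp only: sum.distrib sum_distrib_left)
      also have "(\<Sum>p\<in>P n. inverse ((weight (fst p))\<^sup>2)) = (\<Sum>k\<in>fst ` P n. inverse ((weight k)\<^sup>2))"
        by (subst sum.reindex) (auto simp: inj_on_def P_def)
      also have "(\<Sum>p\<in>P n. inverse ((weight (snd p))\<^sup>2)) = (\<Sum>k\<in>snd ` P n. inverse ((weight k)\<^sup>2))"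
        by (subst sum.reindex) (auto simp: inj_on_def P_def)
      also have "(1/2) * (\<Sum>k\<in>fst ` P n. inverse ((weight k)\<^sup>2)) + (1/2) * (\<Sum>k\<in>snd ` P n. inverse ((weight k)\<^sup>2))
          \<le> (1/2) * embedding_const + (1/2) * embedding_const"
        by (intro add_mono mult_left_mono sum_inverse_weight_sq_le finite_imageI fin) auto
      finally show "(\<Sum>p\<in>P n. (a p)\<^sup>2) \<le> embedding_const" by simp
    qed (auto intro: sum_nonneg)
    also have "(\<Sum>p\<in>P n. (b p)\<^sup>2) = (\<Sum>p\<in>P n. weight (fst p) * (norm (c (fst p)))\<^sup>2 * (weight (snd p) * (norm (c (snd p)))\<^sup>2))"
      using w by (intro sum.cong refl) (simp add: b_def power_mult_distrib less_imp_le mult_ac)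
    finally show "(norm (d n))\<^sup>2 \<le> embedding_const * (\<Sum>p\<in>P n. weight (fst p) * (norm (c (fst p)))\<^sup>2 * (weight (snd p) * (norm (c (snd p)))\<^sup>2))" .
  qed
  also have "\<dots> = embedding_const * (\<Sum>p\<in>K \<times> K. weight (fst p) * (norm (c (fst p)))\<^sup>2 * (weight (snd p) * (norm (c (snd p)))\<^sup>2))"
    unfolding sum_distrib_left[symmetric] N_def P_def by (subst sum.image_gen[OF fin(1)]) (rule refl)
  also have "\<dots> = embedding_const * (\<Sum>k\<in>K. weight k * (norm (c k))\<^sup>2)\<^sup>2"
    unfolding power2_eq_square[of "\<Sum>k\<in>K. weight k * (norm (c k))\<^sup>2"] sum_product sum.cartesian_product
    by (intro arg_cong2[where f="(*)"] refl sum.cong) auto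
  finally show ?thesis .
qed

text \<open>
  The bound for trigonometric polynomials passes to the limit by Fatou's lemma along a subsequence of
  the Fourier series that converges almost everywhere.
\<close>

lemma square_L2:
  assumes f: "f \<in> L2" and H: "\<And>K. finite K \<Longrightarrow> (\<Sum>k\<in>K. weight k * (norm (fcoeff f k))\<^sup>2) \<le> H"
  shows "(\<lambda>x. (norm (f x))\<^sup>2) \<in> L2" "(L2_norm (\<lambda>x. (norm (f x))\<^sup>2))\<^sup>2 \<le> embedding_const * H\<^sup>2"
proof -
  let ?S = "\<lambda>n. fsum (cutoff n) (fcoeff f)"
  obtain r where r: "strict_mono r" "AE x in torus. (\<lambda>n. ?S (r n) x) \<longlonglongrightarrow> f x"
    by (rule L2_subseq_AE[OF fsum_L2 f fourier_series_L2[OF f]])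
  have "(\<integral>\<^sup>+x. ennreal ((norm (f x))^4) \<partial>torus) \<le> (\<integral>\<^sup>+x. liminf (\<lambda>n. ennreal ((norm (?S (r n) x))^4)) \<partial>torus)"
  proof (rule nn_integral_mono_AE)
    show "AE x in torus. ennreal ((norm (f x))^4) \<le> liminf (\<lambda>n. ennreal ((norm (?S (r n) x))^4))"
      using r(2)
    proof eventually_elim
      case (elim x)
      have "(\<lambda>n. ennreal ((norm (?S (r n) x))^4)) \<longlonglongrightarrow> ennreal ((norm (f x))^4)"
        by (intro tendsto_ennrealI tendsto_intros elim)
      from lim_imp_Liminf[OF _ this] show ?case by simp
    qed
  qed
  also have "\<dots> \<le> liminf (\<lambda>n. \<integral>\<^sup>+x. ennreal ((norm (?S (r n) x))^4) \<partial>torus)"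
    by (rule nn_integral_liminf) (use fsum_L2 in measurable)
  also have "\<dots> \<le> ennreal (embedding_const * H\<^sup>2)"
  proof (rule Liminf_le[OF _ always_eventually[OF allI]])
    fix n
    have sq: "(\<lambda>x. ?S (r n) x * ?S (r n) x) \<in> L2"
    proof -
      obtain M where M: "\<And>x. norm (?S (r n) x) \<le> M" using trig_poly_bounded[OF trig_poly_fsum] by blast
      show ?thesis
        by (rule L2_bounded[where M="M * M"])
           (use fsum_L2 M in \<open>auto simp: norm_mult intro!: mult_mono order_trans[OF norm_ge_zero]\<close>)
    qed
    have "(\<integral>\<^sup>+x. ennreal ((norm (?S (r n) x))^4) \<partial>torus) = (\<integral>\<^sup>+x. ennreal ((norm (?S (r n) x * ?S (r n) x))\<^sup>2) \<partial>torus)"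
      by (intro nn_integral_cong arg_cong[where f=ennreal]) (simp add: norm_mult power4_eq_xxxx power2_eq_square)
    also have "\<dots> = ennreal ((L2_norm (\<lambda>x. ?S (r n) x * ?S (r n) x))\<^sup>2)"
      by (subst nn_integral_eq_integral[OF L2_integrable_sq[OF sq]]) (auto simp: L2_norm_sq_integral)
    also have "\<dots> \<le> ennreal (embedding_const * H\<^sup>2)"
    proof (rule ennreal_leI)
      have "(L2_norm (\<lambda>x. ?S (r n) x * ?S (r n) x))\<^sup>2 \<le> embedding_const * (\<Sum>k\<in>cutoff (r n). weight k * (norm (fcoeff f k))\<^sup>2)\<^sup>2"
        by (rule fourth_power_fsum_le) simp
      also have "\<dots> \<le> embedding_const * H\<^sup>2"
        by (intro mult_left_mono power_mono H sum_nonneg embedding_const_nonneg mult_nonneg_nonneg) (auto intro: add_nonneg_nonneg)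
      finally show "(L2_norm (\<lambda>x. ?S (r n) x * ?S (r n) x))\<^sup>2 \<le> embedding_const * H\<^sup>2" .
    qed
    finally show "(\<integral>\<^sup>+x. ennreal ((norm (?S (r n) x))^4) \<partial>torus) \<le> ennreal (embedding_const * H\<^sup>2)" .
  qed simp
  finally have le: "(\<integral>\<^sup>+x. ennreal ((norm (f x))^4) \<partial>torus) \<le> ennreal (embedding_const * H\<^sup>2)" .
  have eq: "(norm ((norm (f x))\<^sup>2))\<^sup>2 = (norm (f x))^4" for x by (simp flip: power_mult)
  have m: "(\<lambda>x. (norm (f x))^4) \<in> borel_measurable torus" using f by measurable
  have int: "integrable torus (\<lambda>x. (norm (f x))^4)"
    using m le by (auto simp: integrable_iff_bounded intro: le_less_trans)
  show L: "(\<lambda>x. (norm (f x))\<^sup>2) \<in> L2"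
    using f int unfolding L2_def eq by auto
  have "ennreal ((L2_norm (\<lambda>x. (norm (f x))\<^sup>2))\<^sup>2) \<le> ennreal (embedding_const * H\<^sup>2)"
    using le by (subst (asm) nn_integral_eq_integral[OF int]) (auto simp only: L2_norm_sq_integral eq intro!: AE_I2 zero_le_power norm_ge_zero)
  then show "(L2_norm (\<lambda>x. (norm (f x))\<^sup>2))\<^sup>2 \<le> embedding_const * H\<^sup>2"
    by (simp add: embedding_const_nonneg)
qed

lemma norm_fcoeff_complexify_le: "norm (fcoeff (complexify f j) k) \<le> norm (fourier_coeff f k)"
  unfolding fourier_coeff_nth[symmetric] by (rule Finite_Cartesian_Product.norm_nth_le)

lemma weighted_sum_le_Hs_norm:
  assumes "f \<in> Hs s" "finite K"
  shows "(\<Sum>k\<in>K. weight k powr s * (norm (fcoeff (complexify f j) k))\<^sup>2) \<le> (Hs_norm s f)\<^sup>2"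
proof -
  have "(\<Sum>k\<in>K. weight k powr s * (norm (fcoeff (complexify f j) k))\<^sup>2) \<le> (\<Sum>k\<in>K. sobolev_term s f k)"
    by (intro sum_mono mult_left_mono power_mono norm_fcoeff_complexify_le) auto
  also have "\<dots> \<le> (Hs_norm s f)\<^sup>2"
    unfolding Hs_norm_sq by (intro finite_sum_le_infsum Hs_summable assms) auto
  finally show ?thesis .
qed

lemma vfield_square_L2:
  assumes f: "f \<in> Hs 1"
  shows "(\<lambda>x. (norm (f x))\<^sup>2) \<in> L2"
    "L2_norm (\<lambda>x. (norm (f x))\<^sup>2) \<le> 3 * sqrt embedding_const * (Hs_norm 1 f)\<^sup>2"
proof -
  let ?h = "\<lambda>j x. (norm (complexify f j x))\<^sup>2"
  have H: "(\<Sum>k\<in>K. weight k * (norm (fcoeff (complexify f j) k))\<^sup>2) \<le> (Hs_norm 1 f)\<^sup>2" if "finite K" for K j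
    using weighted_sum_le_Hs_norm[OF f that, of j] weight_pos by (simp add: less_imp_le)
  note sq = square_L2[OF vfield_L2_complexify[OF Hs_L2[OF f]] H]
  have h: "?h j \<in> L2" for j by (rule sq(1))
  have hn: "L2_norm (?h j) \<le> sqrt embedding_const * (Hs_norm 1 f)\<^sup>2" for j
  proof (rule power2_le_imp_le)
    show "(L2_norm (?h j))\<^sup>2 \<le> (sqrt embedding_const * (Hs_norm 1 f)\<^sup>2)\<^sup>2"
      using sq(2)[of j] embedding_const_nonneg by (simp add: power_mult_distrib)
  qed (simp add: embedding_const_nonneg)
  have eq: "(\<lambda>x. (norm (f x))\<^sup>2) = (\<lambda>x. \<Sum>j\<in>UNIV. ?h j x)" by (simp add: norm_vec3_sq)
  show "(\<lambda>x. (norm (f x))\<^sup>2) \<in> L2" unfolding eq by (intro L2_sum h)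
  have "L2_norm (\<lambda>x. \<Sum>j\<in>J. ?h j x) \<le> (\<Sum>j\<in>J. L2_norm (?h j))" if "finite J" for J
    using that
  proof induction
    case (insert j J)
    then show ?case using L2_norm_triangle[OF h[of j] L2_sum[of J ?h, OF h]] by simp
  qed (simp add: L2_norm_def)
  then have "L2_norm (\<lambda>x. \<Sum>j\<in>UNIV. ?h j x) \<le> (\<Sum>j\<in>UNIV. L2_norm (?h j))" by simp
  also have "\<dots> \<le> (\<Sum>j\<in>(UNIV::3 set). sqrt embedding_const * (Hs_norm 1 f)\<^sup>2)" by (intro sum_mono hn)
  finally show "L2_norm (\<lambda>x. (norm (f x))\<^sup>2) \<le> 3 * sqrt embedding_const * (Hs_norm 1 f)\<^sup>2"
    by (simp add: eq)
qed

text \<open>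
  The form in which the embedding of \<open>H\<^sup>1\<close> into \<open>L\<^sup>4\<close> enters the advection form.
\<close>

lemma norm_product_L2:
  assumes f: "f \<in> Hs 1" and g: "g \<in> Hs 1"
  shows "(\<lambda>x. norm (f x) * norm (g x)) \<in> L2"
    "L2_norm (\<lambda>x. norm (f x) * norm (g x)) \<le> 3 * sqrt embedding_const * Hs_norm 1 f * Hs_norm 1 g"
proof -
  let ?n = "\<lambda>x. norm (f x) * norm (g x)"
  note F = vfield_square_L2[OF f] and G = vfield_square_L2[OF g]
  show n: "?n \<in> L2"
  proof (rule L2_dominated[OF L2_add[OF F(1) G(1)]])
    show "?n \<in> borel_measurable torus" using f g by (auto dest!: Hs_L2)
    have "norm (?n x) \<le> norm ((norm (f x))\<^sup>2 + (norm (g x))\<^sup>2)" for x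
      using sum_squares_bound[of "norm (f x)" "norm (g x)"] mult_nonneg_nonneg[OF norm_ge_zero norm_ge_zero, of "f x" "g x"]
      unfolding real_norm_def by linarith
    then show "AE x in torus. norm (?n x) \<le> norm ((norm (f x))\<^sup>2 + (norm (g x))\<^sup>2)" by simp
  qed
  have "(L2_norm ?n)\<^sup>2 = L2_inner (\<lambda>x. (norm (f x))\<^sup>2) (\<lambda>x. (norm (g x))\<^sup>2)"
    by (simp add: L2_norm_sq_integral L2_inner_def power_mult_distrib)
  also have "\<dots> \<le> L2_norm (\<lambda>x. (norm (f x))\<^sup>2) * L2_norm (\<lambda>x. (norm (g x))\<^sup>2)"
    using L2_Cauchy_Schwarz[OF F(1) G(1)] by linarith
  also have "\<dots> \<le> (3 * sqrt embedding_const * (Hs_norm 1 f)\<^sup>2) * (3 * sqrt embedding_const * (Hs_norm 1 g)\<^sup>2)"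
    by (intro mult_mono F G) (auto simp: embedding_const_nonneg)
  also have "\<dots> = (3 * sqrt embedding_const * Hs_norm 1 f * Hs_norm 1 g)\<^sup>2"
    by (simp add: power2_eq_square mult_ac)
  finally show "L2_norm ?n \<le> 3 * sqrt embedding_const * Hs_norm 1 f * Hs_norm 1 g"
    by (rule power2_le_imp_le) (simp add: embedding_const_nonneg)
qed

subsection \<open>Bounded derivatives\<close>

text \<open>
  Every partial sum of the Fourier series obeys the bound, and a subsequence converges almost
  everywhere.
\<close>

lemma AE_bounded_by_fcoeff_sum:
  assumes f: "f \<in> L2" and M: "\<And>K. finite K \<Longrightarrow> (\<Sum>k\<in>K. norm (fcoeff f k)) \<le> M"
  shows "AE x in torus. norm (f x) \<le> M"
proof -
  let ?S = "\<lambda>n. fsum (cutoff n) (fcoeff f)"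
  obtain r where r: "strict_mono r" "AE x in torus. (\<lambda>n. ?S (r n) x) \<longlonglongrightarrow> f x"
    by (rule L2_subseq_AE[OF fsum_L2 f fourier_series_L2[OF f]])
  have b: "norm (?S n x) \<le> M" for n x
  proof -
    have "norm (?S n x) \<le> (\<Sum>k\<in>cutoff n. norm (fcoeff f k * cis (wavevector k \<bullet> x)))"
      unfolding fsum_def by (rule norm_sum)
    also have "\<dots> \<le> M" using M[of "cutoff n"] by (simp add: norm_mult)
    finally show ?thesis .
  qed
  show ?thesis using r(2)
  proof eventually_elim
    case (elim x)
    show ?case by (rule tendsto_upperbound[OF tendsto_norm[OF elim]]) (simp_all add: b)
  qed
qed

text \<open>
  Writing \<open>\<bar>k\<bar> \<le> (1 + \<bar>k\<bar>\<^sup>2)\<^sup>-\<^sup>1 (1 + \<bar>k\<bar>\<^sup>2)\<^sup>3\<^sup>/\<^sup>2\<close>, Cauchy-Schwarz bounds the sum of the Fourier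
  coefficients of a derivative: the first factor is square summable, the second one, times the
  coefficients, is what the \<open>H\<^sup>3\<close> norm measures.
\<close>

lemma weak_partial_bounded:
  assumes f: "f \<in> Hs 3"
  shows "AE x in torus. norm (weak_partial i f x) \<le> 3 * sqrt embedding_const * Hs_norm 3 f"
proof -
  let ?M = "sqrt embedding_const * Hs_norm 3 f"
  have f1: "f \<in> Hs 1" by (rule Hs_mono[OF _ f]) simp
  note wp = Hs_1_has_weak_partial[OF f1, of i]
  have "AE x in torus. norm (complexify (weak_partial i f) j x) \<le> ?M" for j
  proof (rule AE_bounded_by_fcoeff_sum)
    show "complexify (weak_partial i f) j \<in> L2" by (intro vfield_L2_complexify weak_partial_L2 f1)
    fix K :: "(int^3) set" assume K: "finite K"
    let ?c = "fcoeff (complexify f j)"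
    have "norm (fcoeff (complexify (weak_partial i f) j) k) \<le> inverse (weight k) * (weight k powr (3/2) * norm (?c k))" for k
    proof -
      have "\<bar>wavevector k $ i\<bar> \<le> sqrt (weight k)"
        using component_le_norm_cart[of "wavevector k" i] by (intro real_le_rsqrt) (metis abs_ge_zero add_increasing order.refl power_mono zero_le_one)
      also have "sqrt (weight k) = inverse (weight k) * weight k powr (3/2)"
      proof -
        have "weight k powr (3/2) = weight k powr 1 * weight k powr (1/2)" unfolding powr_add[symmetric] by simp
        then show ?thesis using weight_pos[of k] by (simp add: powr_half_sqrt less_imp_le)
      qed
      finally have "\<bar>wavevector k $ i\<bar> * norm (?c k) \<le> inverse (weight k) * weight k powr (3/2) * norm (?c k)"
        by (rule mult_right_mono) simp
      moreover have "norm (fcoeff (complexify (weak_partial i f) j) k) = \<bar>wavevector k $ i\<bar> * norm (?c k)"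
        by (simp add: fcoeff_weak_partial[OF has_weak_partial_complexify[OF wp]] norm_mult)
      ultimately show ?thesis by (simp only: mult.assoc)
    qed
    then have "(\<Sum>k\<in>K. norm (fcoeff (complexify (weak_partial i f) j) k))
        \<le> (\<Sum>k\<in>K. inverse (weight k) * (weight k powr (3/2) * norm (?c k)))" by (rule sum_mono)
    also have "\<dots> \<le> ?M"
    proof (rule power2_le_imp_le)
      have "(\<Sum>k\<in>K. inverse (weight k) * (weight k powr (3/2) * norm (?c k)))\<^sup>2
          \<le> (\<Sum>k\<in>K. (inverse (weight k))\<^sup>2) * (\<Sum>k\<in>K. (weight k powr (3/2) * norm (?c k))\<^sup>2)"
        by (rule Cauchy_Schwarz_ineq_sum)
      also have "(\<Sum>k\<in>K. (weight k powr (3/2) * norm (?c k))\<^sup>2) = (\<Sum>k\<in>K. weight k powr 3 * (norm (?c k))\<^sup>2)"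
        by (intro sum.cong refl) (simp add: power_mult_distrib power2_eq_square flip: powr_add)
      also have "(\<Sum>k\<in>K. (inverse (weight k))\<^sup>2) * (\<Sum>k\<in>K. weight k powr 3 * (norm (?c k))\<^sup>2)
          \<le> embedding_const * (Hs_norm 3 f)\<^sup>2"
        using sum_inverse_weight_sq_le[OF K] weighted_sum_le_Hs_norm[OF f K]
        by (intro mult_mono) (auto simp: power_inverse embedding_const_nonneg intro!: sum_nonneg mult_nonneg_nonneg)
      also have "\<dots> = ?M\<^sup>2" by (simp add: power_mult_distrib embedding_const_nonneg)
      finally show "(\<Sum>k\<in>K. inverse (weight k) * (weight k powr (3/2) * norm (?c k)))\<^sup>2 \<le> ?M\<^sup>2" .
    qed (simp add: embedding_const_nonneg)
    finally show "(\<Sum>k\<in>K. norm (fcoeff (complexify (weak_partial i f) j) k)) \<le> ?M" .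
  qed
  then have "AE x in torus. \<forall>j\<in>UNIV. norm (complexify (weak_partial i f) j x) \<le> ?M"
    by (intro AE_finite_allI) auto
  then show ?thesis
  proof eventually_elim
    case (elim x)
    have "norm (weak_partial i f x) \<le> (\<Sum>j\<in>UNIV. \<bar>weak_partial i f x $ j\<bar>)" by (rule norm_le_l1_cart)
    also have "\<dots> \<le> (\<Sum>j\<in>(UNIV::3 set). ?M)" using elim by (intro sum_mono) simp
    finally show ?case by simp
  qed
qed

section \<open>The solenoidal spaces and the operators A and B\<close>

subsection \<open>Solenoidal spaces\<close>

lemma VpolyD:
  assumes "\<phi> \<in> Vpoly"
  shows "trig_poly \<phi>" "(\<Sum>i\<in>UNIV. classical_partial i \<phi> x $ i) = 0" "(LINT x|torus. \<phi> x) = 0"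
    "\<phi> \<in> Hs 1" "\<phi> \<in> L2"
  using assms by (auto simp: Vpoly_def trig_poly_Hs_1 trig_poly_L2)

lemma Vpoly_add: "f \<in> Vpoly \<Longrightarrow> g \<in> Vpoly \<Longrightarrow> (\<lambda>x. f x + g x) \<in> Vpoly"
  by (auto simp: Vpoly_def trig_poly_add classical_partial_add sum.distrib trig_poly_integrable)

lemma Vpoly_scaleR: "f \<in> Vpoly \<Longrightarrow> (\<lambda>x. c *\<^sub>R f x) \<in> Vpoly"
  by (auto simp: Vpoly_def trig_poly_cmul classical_partial_linear[OF bounded_linear_scaleR_right] simp flip: sum_distrib_left)

lemma Vspace_Hs_1: "f \<in> Vspace \<Longrightarrow> f \<in> Hs 1"
  by (simp add: Vspace_def)

lemma Vspace_L2: "f \<in> Vspace \<Longrightarrow> f \<in> L2"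
  by (intro Hs_L2[where s=1] Vspace_Hs_1)

lemma Vpoly_subset_Vspace: "f \<in> Vpoly \<Longrightarrow> f \<in> Vspace"
  using Hs_norm_0_AE[of "\<lambda>x. f x - f x" 1] by (auto simp: Vspace_def VpolyD(4) intro!: bexI[of _ f])

lemma Vspace_add:
  assumes "f \<in> Vspace" "g \<in> Vspace" shows "(\<lambda>x. f x + g x) \<in> Vspace"
  unfolding Vspace_def
proof (intro CollectI conjI allI impI)
  show "(\<lambda>x. f x + g x) \<in> Hs 1" by (intro Hs_add Vspace_Hs_1 assms)
  fix e :: real assume "e > 0"
  then have e: "e / 4 > 0" by simp
  obtain \<phi> where p: "\<phi> \<in> Vpoly" "Hs_norm 1 (\<lambda>x. f x - \<phi> x) < e / 4"
    using assms(1) e unfolding Vspace_def by blast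
  obtain \<psi> where q: "\<psi> \<in> Vpoly" "Hs_norm 1 (\<lambda>x. g x - \<psi> x) < e / 4"
    using assms(2) e unfolding Vspace_def by blast
  have "Hs_norm 1 (\<lambda>x. (f x - \<phi> x) + (g x - \<psi> x)) \<le> 2 * (Hs_norm 1 (\<lambda>x. f x - \<phi> x) + Hs_norm 1 (\<lambda>x. g x - \<psi> x))"
    by (intro Hs_add(2) Hs_diff Vspace_Hs_1 assms VpolyD(4) p q)
  also have "\<dots> < e" using p q by simp
  finally have "Hs_norm 1 (\<lambda>x. (f x + g x) - (\<phi> x + \<psi> x)) < e" by (simp add: algebra_simps)
  then show "\<exists>\<eta>\<in>Vpoly. Hs_norm 1 (\<lambda>x. (f x + g x) - \<eta> x) < e"
    by (rule bexI[of _ "\<lambda>x. \<phi> x + \<psi> x"]) (intro Vpoly_add p q)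
qed

lemma Vspace_scaleR:
  assumes "f \<in> Vspace" shows "(\<lambda>x. c *\<^sub>R f x) \<in> Vspace"
  unfolding Vspace_def
proof (intro CollectI conjI allI impI)
  show "(\<lambda>x. c *\<^sub>R f x) \<in> Hs 1" by (intro Hs_scaleR Vspace_Hs_1 assms)
  fix e :: real assume "e > 0"
  then have e: "e / (\<bar>c\<bar> + 1) > 0" by simp
  obtain \<phi> where p: "\<phi> \<in> Vpoly" "Hs_norm 1 (\<lambda>x. f x - \<phi> x) < e / (\<bar>c\<bar> + 1)"
    using assms(1) e unfolding Vspace_def by blast
  have "Hs_norm 1 (\<lambda>x. c *\<^sub>R f x - c *\<^sub>R \<phi> x) = \<bar>c\<bar> * Hs_norm 1 (\<lambda>x. f x - \<phi> x)"
    using Hs_norm_scaleR[of 1 c "\<lambda>x. f x - \<phi> x"] by (simp add: scaleR_diff_right)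
  also have "\<dots> \<le> (\<bar>c\<bar> + 1) * Hs_norm 1 (\<lambda>x. f x - \<phi> x)" by (simp add: distrib_right)
  also have "\<dots> < e" using p(2) by (simp add: pos_less_divide_eq mult.commute)
  finally show "\<exists>\<eta>\<in>Vpoly. Hs_norm 1 (\<lambda>x. c *\<^sub>R f x - \<eta> x) < e"
    by (rule bexI[of _ "\<lambda>x. c *\<^sub>R \<phi> x"]) (intro Vpoly_scaleR p)
qed

lemma Vspace_diff: "f \<in> Vspace \<Longrightarrow> g \<in> Vspace \<Longrightarrow> (\<lambda>x. f x - g x) \<in> Vspace"
  using Vspace_add[OF _ Vspace_scaleR[where c="-1"]] by simp

lemma Vspace_subset_Hspace: "f \<in> Vspace \<Longrightarrow> f \<in> Hspace"
proof -
  assume f: "f \<in> Vspace"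
  have "\<exists>\<phi>\<in>Vpoly. L2_norm (\<lambda>x. f x - \<phi> x) < e" if e: "e > 0" for e :: real
  proof -
    obtain \<phi> where p: "\<phi> \<in> Vpoly" "Hs_norm 1 (\<lambda>x. f x - \<phi> x) < e"
      using f e unfolding Vspace_def by blast
    have "L2_norm (\<lambda>x. f x - \<phi> x) \<le> Hs_norm 1 (\<lambda>x. f x - \<phi> x)"
      by (intro L2_norm_le_Hs_norm_1 Hs_diff Vspace_Hs_1 f VpolyD p)
    with p show ?thesis by (intro bexI[of _ \<phi>]) auto
  qed
  then show "f \<in> Hspace" using Vspace_L2[OF f] by (simp add: Hspace_def)
qed

lemma Hspace_L2: "f \<in> Hspace \<Longrightarrow> f \<in> L2"
  by (simp add: Hspace_def)

lemma orthogonal_Hspace: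
  assumes d: "d \<in> L2" and orth: "\<And>\<psi>. \<psi> \<in> Vpoly \<Longrightarrow> L2_inner d \<psi> = 0" and f: "f \<in> Hspace"
  shows "L2_inner d f = 0"
proof -
  have "\<bar>L2_inner d f\<bar> \<le> e" if "e > 0" for e
  proof -
    have "e / (L2_norm d + 1) > 0" using that by (simp add: add_nonneg_pos)
    then obtain \<psi> where p: "\<psi> \<in> Vpoly" "L2_norm (\<lambda>x. f x - \<psi> x) < e / (L2_norm d + 1)"
      using f unfolding Hspace_def by blast
    have "L2_inner d f = L2_inner d (\<lambda>x. f x - \<psi> x)"
      using L2_inner_diff_right[OF Hspace_L2[OF f] VpolyD(5)[OF p(1)] d] orth[OF p(1)] by simp
    then have "\<bar>L2_inner d f\<bar> \<le> L2_norm d * L2_norm (\<lambda>x. f x - \<psi> x)"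
      using L2_Cauchy_Schwarz[OF d L2_diff[OF Hspace_L2[OF f] VpolyD(5)[OF p(1)]]] by simp
    also have "\<dots> \<le> (L2_norm d + 1) * L2_norm (\<lambda>x. f x - \<psi> x)" by (simp add: distrib_right)
    also have "\<dots> \<le> e" using p(2) L2_norm_nonneg[of d] by (simp add: pos_less_divide_eq mult.commute add_nonneg_pos)
    finally show ?thesis .
  qed
  then have "\<bar>L2_inner d f\<bar> \<le> 0" by (rule field_le_epsilon[of _ 0, simplified])
  then show ?thesis by simp
qed

text \<open>Gradients are orthogonal to solenoidal fields: integrate by parts.\<close>

lemma gradient_orthogonal_Vpoly:
  fixes p :: "real^3 \<Rightarrow> real"
  assumes p: "\<And>i. has_weak_partial i p (g i)" and \<psi>: "\<psi> \<in> Vpoly"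
  shows "L2_inner (\<lambda>x. \<chi> i. g i x) \<psi> = 0"
proof -
  note t = VpolyD(1)[OF \<psi>]
  have cp: "classical_partial i (\<lambda>x. \<psi> x $ j) = (\<lambda>x. classical_partial i \<psi> x $ j)" for i j
    by (rule classical_partial_linear[OF bounded_linear_vec_nth t])
  have pL2: "p \<in> L2" and gL2: "g i \<in> L2" for i using has_weak_partialD[OF p] by auto
  have int: "integrable torus (\<lambda>x. \<psi> x $ i *\<^sub>R g i x)" "integrable torus (\<lambda>x. classical_partial i \<psi> x $ i *\<^sub>R p x)" for i
    using trig_test_integrable[OF trig_poly_nth[OF t], of "g i" i] trig_test_integrable(2)[OF trig_poly_nth[OF t] pL2, of i i] gL2
    by (simp_all add: cp)
  have "L2_inner (\<lambda>x. \<chi> i. g i x) \<psi> = (LINT x|torus. (\<Sum>i\<in>UNIV. \<psi> x $ i *\<^sub>R g i x))"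
    by (simp add: L2_inner_def inner_vec_def mult.commute)
  also have "\<dots> = (\<Sum>i\<in>UNIV. LINT x|torus. \<psi> x $ i *\<^sub>R g i x)"
    by (intro Bochner_Integration.integral_sum int)
  also have "\<dots> = (\<Sum>i\<in>UNIV. - (LINT x|torus. classical_partial i \<psi> x $ i *\<^sub>R p x))"
    using has_weak_partialD(3)[OF p trig_poly_nth[OF t]] by (intro sum.cong refl) (simp add: cp)
  also have "\<dots> = - (LINT x|torus. (\<Sum>i\<in>UNIV. classical_partial i \<psi> x $ i *\<^sub>R p x))"
    by (subst Bochner_Integration.integral_sum, rule int) (simp add: sum_negf)
  also have "\<dots> = 0"
    using VpolyD(2)[OF \<psi>] by (simp flip: sum_distrib_right)
  finally show ?thesis .
qed

lemma vector_field_L2: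
  assumes "\<And>i. g i \<in> L2" shows "(\<lambda>x. (\<chi> i. g i x) :: real^3) \<in> L2"
proof -
  have "(\<lambda>x. \<Sum>i\<in>UNIV. g i x *\<^sub>R axis i (1::real)) \<in> L2"
    by (intro L2_sum L2_bounded_linear[OF bounded_linear_scaleR_left assms])
  also have "(\<lambda>x. \<Sum>i\<in>UNIV. g i x *\<^sub>R axis i (1::real)) = (\<lambda>x. \<chi> i. g i x)"
    by (rule ext) (subst (2) vec_eq_sum_axis, simp)
  finally show ?thesis .
qed

lemma gradient_orthogonal_Vspace:
  fixes p :: "real^3 \<Rightarrow> real"
  assumes p: "\<And>i. has_weak_partial i p (g i)" and \<psi>: "\<psi> \<in> Vspace"
  shows "L2_inner (\<lambda>x. \<chi> i. g i x) \<psi> = 0"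
  by (rule orthogonal_Hspace[OF vector_field_L2 gradient_orthogonal_Vpoly[OF p] Vspace_subset_Hspace[OF \<psi>]])
     (rule has_weak_partialD(2)[OF p])

subsection \<open>The Leray projection of trigonometric polynomials\<close>

text \<open>
  The projection removes from the amplitude of each mode its component along the wave vector.  What
  is removed is the gradient of a mode, or a constant, and both are orthogonal to \<open>V\<close>.
\<close>

lemma solenoidal_mode:
  fixes k :: "int^3" and a :: "real^3"
  assumes "k \<noteq> 0"
  defines "a' \<equiv> a - ((a \<bullet> wavevector k) / (wavevector k \<bullet> wavevector k)) *\<^sub>R wavevector k"
  shows "(\<lambda>x. cos (wavevector k \<bullet> x) *\<^sub>R a') \<in> Vpoly" "(\<lambda>x. sin (wavevector k \<bullet> x) *\<^sub>R a') \<in> Vpoly"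
proof -
  have "wavevector k \<bullet> a' = 0"
    using assms by (simp add: a'_def inner_diff_right inner_commute)
  then have z: "(\<Sum>i\<in>UNIV. wavevector k $ i * a' $ i) = 0" by (simp add: inner_vec_def)
  have "(\<Sum>i\<in>UNIV. (c *\<^sub>R (- wavevector k $ i *\<^sub>R a')) $ i) = 0" "(\<Sum>i\<in>UNIV. (c *\<^sub>R (wavevector k $ i *\<^sub>R a')) $ i) = 0" for c
    using z by (simp_all add: sum_negf mult.assoc flip: sum_distrib_left)
  then show "(\<lambda>x. cos (wavevector k \<bullet> x) *\<^sub>R a') \<in> Vpoly" "(\<lambda>x. sin (wavevector k \<bullet> x) *\<^sub>R a') \<in> Vpoly"
    using assms(1) unfolding Vpoly_def
    by (auto simp only: mem_Collect_eq trig_poly_cos trig_poly_sin classical_partial_cos classical_partial_sin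
        integral_torus_mode integral_torus_cos integral_torus_sin if_False scaleR_zero_left)
qed

lemma leray_mode:
  fixes S T :: "real^3 \<Rightarrow> real"
  defines "c a k \<equiv> (a \<bullet> wavevector k) / (wavevector k \<bullet> wavevector k)"
  assumes h: "(\<lambda>x. T x *\<^sub>R (a - c a k *\<^sub>R wavevector k)) \<in> Vpoly"
    and S: "\<And>i b :: real. has_weak_partial i (\<lambda>x. S x *\<^sub>R b) (\<lambda>x. T x *\<^sub>R (wavevector k $ i *\<^sub>R b))"
  shows "\<exists>h\<in>Vpoly. \<forall>\<psi>\<in>Vpoly. L2_inner (\<lambda>x. T x *\<^sub>R a - h x) \<psi> = 0"
proof (intro bexI[OF _ h] ballI)
  fix \<psi> assume "\<psi> \<in> Vpoly"
  from gradient_orthogonal_Vpoly[OF S this, of "c a k"]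
  have "L2_inner (\<lambda>x. \<chi> i. T x *\<^sub>R (wavevector k $ i *\<^sub>R c a k)) \<psi> = 0" .
  also have "(\<lambda>x. \<chi> i. T x *\<^sub>R (wavevector k $ i *\<^sub>R c a k)) = (\<lambda>x. T x *\<^sub>R a - T x *\<^sub>R (a - c a k *\<^sub>R wavevector k))"
    by (rule ext) (simp add: vec_eq_iff scaleR_diff_right mult.commute)
  finally show "L2_inner (\<lambda>x. T x *\<^sub>R a - T x *\<^sub>R (a - c a k *\<^sub>R wavevector k)) \<psi> = 0" .
qed

lemma leray_exists:
  fixes g :: vfield
  assumes "trig_poly g"
  shows "\<exists>h\<in>Vpoly. \<forall>\<psi>\<in>Vpoly. L2_inner (\<lambda>x. g x - h x) \<psi> = 0"
  using assms
proof (induction rule: trig_poly_induct)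
  case (cos k a)
  show ?case
  proof (cases "k = 0")
    case True
    have "(\<lambda>x. 0) \<in> Vpoly" using Vpoly_def classical_partial_sin[of _ 0 0] by (auto simp: classical_partial_def)
    moreover have "L2_inner (\<lambda>x. a) \<psi> = 0" if "\<psi> \<in> Vpoly" for \<psi>
      using VpolyD(3)[OF that] integral_inner_right[of a torus \<psi>] L2_integrable[OF VpolyD(5)[OF that]]
      by (simp add: L2_inner_def)
    ultimately show ?thesis using True by (intro bexI[of _ "\<lambda>x. 0"]) auto
  next
    case False
    show ?thesis
      using trig_poly_has_weak_partial[OF trig_poly_sin] unfolding classical_partial_sin
      by (rule leray_mode[OF solenoidal_mode(1)[OF False]])
  qed
next
  case (sin k a)
  show ?case
  proof (cases "k = 0")
    case True
    have "(\<lambda>x. 0) \<in> Vpoly" using Vpoly_def classical_partial_sin[of _ 0 0] by (auto simp: classical_partial_def)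
    then show ?thesis using True by (intro bexI[of _ "\<lambda>x. 0"]) (auto simp: L2_inner_def)
  next
    case False
    have "has_weak_partial i (\<lambda>x. - cos (wavevector k \<bullet> x) *\<^sub>R b) (\<lambda>x. sin (wavevector k \<bullet> x) *\<^sub>R (wavevector k $ i *\<^sub>R b))" for i and b :: real
      using trig_poly_has_weak_partial[OF trig_poly_cos[of k "- b"], of i] unfolding classical_partial_cos by simp
    then show ?thesis by (rule leray_mode[OF solenoidal_mode(2)[OF False]])
  qed
next
  case (add f g)
  then obtain h1 h2 where h: "h1 \<in> Vpoly" "h2 \<in> Vpoly"
    "\<And>\<psi>. \<psi> \<in> Vpoly \<Longrightarrow> L2_inner (\<lambda>x. f x - h1 x) \<psi> = 0" "\<And>\<psi>. \<psi> \<in> Vpoly \<Longrightarrow> L2_inner (\<lambda>x. g x - h2 x) \<psi> = 0"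
    by blast
  have "L2_inner (\<lambda>x. f x + g x - (h1 x + h2 x)) \<psi> = 0" if "\<psi> \<in> Vpoly" for \<psi>
  proof -
    have "L2_inner (\<lambda>x. (f x - h1 x) + (g x - h2 x)) \<psi> = 0"
      using h(3,4)[OF that] L2_inner_add_left[OF L2_diff[OF trig_poly_L2[OF add(1)] VpolyD(5)[OF h(1)]]
        L2_diff[OF trig_poly_L2[OF add(2)] VpolyD(5)[OF h(2)]] VpolyD(5)[OF that]] by simp
    then show ?thesis by (simp add: algebra_simps)
  qed
  then show ?case by (intro bexI[OF _ Vpoly_add[OF h(1,2)]] ballI)
qed

text \<open>
  A trigonometric polynomial has a projection, which is all that the choice in the definition of the
  projector needs; testing with \<open>V\<close> does not see the difference.
\<close>

lemma leray_inner:
  assumes g: "trig_poly g" "f \<in> L2" "AE x in torus. f x = g x" and \<psi>: "\<psi> \<in> Vspace"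
  shows "L2_inner (leray f) \<psi> = L2_inner f \<psi>"
proof -
  obtain h where h: "h \<in> Vpoly" "\<And>\<psi>. \<psi> \<in> Vpoly \<Longrightarrow> L2_inner (\<lambda>x. g x - h x) \<psi> = 0"
    using leray_exists[OF g(1)] by blast
  have L: "g \<in> L2" "h \<in> L2" using g h by (auto intro: trig_poly_L2 VpolyD)
  have "L2_inner (\<lambda>x. f x - h x) \<eta> = 0" if "\<eta> \<in> Hspace" for \<eta>
  proof -
    have "L2_inner (\<lambda>x. f x - h x) \<eta> = L2_inner (\<lambda>x. g x - h x) \<eta>"
      using g(3) by (intro L2_inner_cong_AE L2_diff g(2) L Hspace_L2 that) auto
    then show ?thesis using orthogonal_Hspace[OF L2_diff[OF L] h(2) that] by simp
  qed
  then have "\<exists>h. h \<in> Hspace \<and> (\<forall>\<eta>\<in>Hspace. L2_inner (\<lambda>x. f x - h x) \<eta> = 0)"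
    using h(1) Vpoly_subset_Vspace Vspace_subset_Hspace by blast
  then have *: "leray f \<in> Hspace \<and> (\<forall>\<eta>\<in>Hspace. L2_inner (\<lambda>x. f x - leray f x) \<eta> = 0)"
    unfolding leray_def by (rule someI_ex)
  then have "L2_inner (\<lambda>x. f x - leray f x) \<psi> = 0" using Vspace_subset_Hspace[OF \<psi>] by blast
  then show ?thesis
    using L2_inner_diff_left[OF g(2) Hspace_L2 Vspace_L2[OF \<psi>], of "leray f"] * by simp
qed

subsection \<open>Multilinear forms on V\<close>

lemma linear_on_VD:
  assumes "linear_on_V F" "f \<in> Vspace" "g \<in> Vspace"
  shows "F (\<lambda>x. f x + g x) = F f + F g" "F (\<lambda>x. c *\<^sub>R f x) = c * F f" "F (\<lambda>x. f x - g x) = F f - F g"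
proof -
  have add: "F (\<lambda>x. f x + g x) = F f + F g" if "g \<in> Vspace" for g
    using assms that by (auto simp: linear_on_V_def)
  show "F (\<lambda>x. f x + g x) = F f + F g" by (rule add[OF assms(3)])
  have sc: "F (\<lambda>x. c *\<^sub>R f x) = c * F f" if "f \<in> Vspace" for c f
    using assms(1) that by (auto simp: linear_on_V_def)
  show "F (\<lambda>x. c *\<^sub>R f x) = c * F f" by (rule sc[OF assms(2)])
  show "F (\<lambda>x. f x - g x) = F f - F g"
    using add[OF Vspace_scaleR[OF assms(3), of "-1"]] sc[OF assms(3), of "-1"] by simp
qed

lemma linear_on_V_add: "linear_on_V F \<Longrightarrow> linear_on_V G \<Longrightarrow> linear_on_V (\<lambda>w. F w + G w)"
  by (auto simp: linear_on_V_def algebra_simps)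

lemma linear_on_V_diff: "linear_on_V F \<Longrightarrow> linear_on_V G \<Longrightarrow> linear_on_V (\<lambda>w. F w - G w)"
  by (auto simp: linear_on_V_def algebra_simps)

text \<open>
  The density of the polynomials, in the form in which it is used for the uniqueness of extensions.
\<close>

lemma linear_on_V_vanishes:
  assumes lin: "linear_on_V F" and bd: "\<And>w. w \<in> Vspace \<Longrightarrow> \<bar>F w\<bar> \<le> C * Hs_norm 1 w"
    and z: "\<And>w. w \<in> Vpoly \<Longrightarrow> F w = 0" and w: "w \<in> Vspace"
  shows "F w = 0"
proof -
  have "\<bar>F w\<bar> \<le> e" if e: "e > 0" for e
  proof -
    have "e / (\<bar>C\<bar> + 1) > 0" using e by simp
    then obtain \<phi> where p: "\<phi> \<in> Vpoly" "Hs_norm 1 (\<lambda>x. w x - \<phi> x) < e / (\<bar>C\<bar> + 1)"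
      using w unfolding Vspace_def by blast
    note pV = Vpoly_subset_Vspace[OF p(1)]
    have "\<bar>F w\<bar> = \<bar>F (\<lambda>x. w x - \<phi> x)\<bar>" using linear_on_VD(3)[OF lin w pV] z[OF p(1)] by simp
    also have "\<dots> \<le> C * Hs_norm 1 (\<lambda>x. w x - \<phi> x)" by (intro bd Vspace_diff w pV)
    also have "\<dots> \<le> (\<bar>C\<bar> + 1) * Hs_norm 1 (\<lambda>x. w x - \<phi> x)" by (intro mult_right_mono) auto
    also have "\<dots> \<le> e" using p(2) by (simp add: pos_less_divide_eq mult.commute)
    finally show ?thesis .
  qed
  then have "\<bar>F w\<bar> \<le> 0" by (rule field_le_epsilon[of _ 0, simplified])
  then show ?thesis by simp
qed

subsection \<open>The Dirichlet form represents A\<close>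

definition grad_inner :: "vfield \<Rightarrow> vfield \<Rightarrow> real" where
  "grad_inner f g = (\<Sum>i\<in>UNIV. L2_inner (weak_partial i f) (weak_partial i g))"

lemma grad_inner_commute: "grad_inner f g = grad_inner g f"
  by (simp add: grad_inner_def L2_inner_commute)

lemma grad_inner_add_left:
  assumes "f \<in> Hs 1" "g \<in> Hs 1" "h \<in> Hs 1"
  shows "grad_inner (\<lambda>x. f x + g x) h = grad_inner f h + grad_inner g h"
proof -
  have "L2_inner (weak_partial i (\<lambda>x. f x + g x)) (weak_partial i h)
      = L2_inner (weak_partial i f) (weak_partial i h) + L2_inner (weak_partial i g) (weak_partial i h)" for i
  proof -
    have "L2_inner (weak_partial i (\<lambda>x. f x + g x)) (weak_partial i h)
        = L2_inner (\<lambda>x. weak_partial i f x + weak_partial i g x) (weak_partial i h)"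
      using weak_partial_add[OF assms(1,2)]
      by (intro L2_inner_cong_AE weak_partial_L2 Hs_add L2_add assms) auto
    then show ?thesis by (simp add: L2_inner_add_left weak_partial_L2 assms)
  qed
  then show ?thesis by (simp add: grad_inner_def sum.distrib)
qed

lemma grad_inner_scaleR_left:
  assumes "f \<in> Hs 1" "h \<in> Hs 1"
  shows "grad_inner (\<lambda>x. c *\<^sub>R f x) h = c * grad_inner f h"
proof -
  have "L2_inner (weak_partial i (\<lambda>x. c *\<^sub>R f x)) (weak_partial i h) = c * L2_inner (weak_partial i f) (weak_partial i h)" for i
  proof -
    have "L2_inner (weak_partial i (\<lambda>x. c *\<^sub>R f x)) (weak_partial i h)
        = L2_inner (\<lambda>x. c *\<^sub>R weak_partial i f x) (weak_partial i h)"
      using weak_partial_scaleR[OF assms(1)]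
      by (intro L2_inner_cong_AE weak_partial_L2 Hs_scaleR L2_scaleR assms) auto
    then show ?thesis by (simp add: L2_inner_scaleR_left)
  qed
  then show ?thesis by (simp add: grad_inner_def sum_distrib_left)
qed

lemma grad_inner_bounded:
  assumes "f \<in> Hs 1" "g \<in> Hs 1"
  shows "\<bar>grad_inner f g\<bar> \<le> 3 * Hs_norm 1 f * Hs_norm 1 g"
proof -
  have "\<bar>grad_inner f g\<bar> \<le> (\<Sum>i\<in>UNIV. \<bar>L2_inner (weak_partial i f) (weak_partial i g)\<bar>)"
    unfolding grad_inner_def by (rule sum_abs)
  also have "\<dots> \<le> (\<Sum>i\<in>(UNIV::3 set). Hs_norm 1 f * Hs_norm 1 g)"
  proof (rule sum_mono)
    fix i
    have "\<bar>L2_inner (weak_partial i f) (weak_partial i g)\<bar> \<le> L2_norm (weak_partial i f) * L2_norm (weak_partial i g)"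
      by (intro L2_Cauchy_Schwarz weak_partial_L2 assms)
    also have "\<dots> \<le> Hs_norm 1 f * Hs_norm 1 g" by (intro mult_mono weak_partial_norm_le assms) auto
    finally show "\<bar>L2_inner (weak_partial i f) (weak_partial i g)\<bar> \<le> Hs_norm 1 f * Hs_norm 1 g" .
  qed
  finally show ?thesis by simp
qed

lemma linear_on_V_grad_inner: "g \<in> Vspace \<Longrightarrow> linear_on_V (\<lambda>f. grad_inner f g)"
  by (auto simp: linear_on_V_def grad_inner_add_left grad_inner_scaleR_left Vspace_Hs_1)

lemma L2_inner_classical_partial:
  fixes f \<phi> :: vfield
  assumes f: "trig_poly f" and \<phi>: "has_weak_partial i \<phi> g"
  shows "L2_inner (classical_partial i f) \<phi> = - L2_inner f g"
proof -
  have L: "\<phi> \<in> L2" "g \<in> L2" using has_weak_partialD[OF \<phi>] by auto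
  have cp: "classical_partial i (\<lambda>x. f x $ j) = (\<lambda>x. classical_partial i f x $ j)" for j
    by (rule classical_partial_linear[OF bounded_linear_vec_nth f])
  have nth: "(\<lambda>x. \<phi> x $ j) \<in> L2" "(\<lambda>x. g x $ j) \<in> L2" for j
    by (rule L2_bounded_linear[OF bounded_linear_vec_nth]; fact)+
  note int1 = trig_test_integrable(1)[OF trig_poly_nth[OF f] nth(2)]
  note int2 = trig_test_integrable(2)[OF trig_poly_nth[OF f] nth(1), of i, unfolded cp]
  have "L2_inner (classical_partial i f) \<phi> = (\<Sum>j\<in>UNIV. LINT x|torus. classical_partial i f x $ j *\<^sub>R \<phi> x $ j)"
    unfolding L2_inner_def inner_vec_def inner_real_def
    by (subst Bochner_Integration.integral_sum[symmetric]) (use int2 in auto)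
  also have "\<dots> = (\<Sum>j\<in>UNIV. - (LINT x|torus. f x $ j *\<^sub>R g x $ j))"
    using has_weak_partialD(3)[OF has_weak_partial_nth[OF \<phi>] trig_poly_nth[OF f]] by (intro sum.cong refl) (simp add: cp)
  also have "\<dots> = - L2_inner f g"
    unfolding L2_inner_def inner_vec_def inner_real_def
    by (subst Bochner_Integration.integral_sum) (use int1 in \<open>auto simp: sum_negf\<close>)
  finally show ?thesis .
qed

text \<open>
  Weak partial derivatives are chosen representatives, so iterating them requires insensitivity to
  null sets.
\<close>

lemma has_weak_partial_cong_AE:
  assumes "has_weak_partial i f g" "f' \<in> L2" "AE x in torus. f' x = f x"
  shows "has_weak_partial i f' g"
  unfolding has_weak_partial_def
proof (intro conjI allI impI)
  fix \<theta> :: "real^3 \<Rightarrow> real" assume \<theta>: "trig_poly \<theta>"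
  note D = has_weak_partialD[OF assms(1)]
  have "(LINT x|torus. classical_partial i \<theta> x *\<^sub>R f' x) = (LINT x|torus. classical_partial i \<theta> x *\<^sub>R f x)"
    using trig_test_integrable(2)[OF \<theta> assms(2), of i] trig_test_integrable(2)[OF \<theta> D(1), of i] assms(3)
    by (intro integral_cong_AE) (auto elim!: eventually_mono)
  then show "(LINT x|torus. classical_partial i \<theta> x *\<^sub>R f' x) = - (LINT x|torus. \<theta> x *\<^sub>R g x)"
    by (simp add: D(3)[OF \<theta>])
qed (use assms has_weak_partialD in auto)

lemma L2_inner_leray_laplacian:
  assumes w: "w \<in> Vpoly" and \<phi>: "\<phi> \<in> Vspace"
  shows "L2_inner (leray (\<lambda>x. - laplacian w x)) \<phi> = grad_inner w \<phi>"
proof -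
  note t = VpolyD(1)[OF w]
  let ?c = "classical_partial" and ?w = "weak_partial"
  have AE2: "AE x in torus. ?w i (?w i w) x = ?c i (?c i w) x" for i
    by (rule weak_partial_AE[OF has_weak_partial_cong_AE[OF trig_poly_has_weak_partial[OF trig_poly_classical_partial[OF t]]
          weak_partial_L2[OF VpolyD(4)[OF w]] weak_partial_trig_poly[OF t]]])
  have L2w: "?w i (?w i w) \<in> L2" for i
    by (rule has_weak_partialD(2)[OF has_weak_partial_weak_partial[OF
          has_weak_partial_cong_AE[OF trig_poly_has_weak_partial[OF trig_poly_classical_partial[OF t]]
          weak_partial_L2[OF VpolyD(4)[OF w]] weak_partial_trig_poly[OF t]]]])
  define g where "g x = - (\<Sum>i\<in>UNIV. ?c i (?c i w) x)" for x
  have g: "trig_poly g" unfolding g_def by (intro trig_poly_uminus trig_poly_sum trig_poly_classical_partial t)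
  have lL: "(\<lambda>x. - laplacian w x) \<in> L2" unfolding laplacian_def by (intro L2_uminus L2_sum L2w)
  have "AE x in torus. \<forall>i\<in>UNIV. ?w i (?w i w) x = ?c i (?c i w) x" by (intro AE_finite_allI AE2) simp
  then have AE: "AE x in torus. - laplacian w x = g x"
    by eventually_elim (simp add: laplacian_def g_def)
  note \<phi>1 = Vspace_Hs_1[OF \<phi>]
  have "L2_inner (leray (\<lambda>x. - laplacian w x)) \<phi> = L2_inner (\<lambda>x. - laplacian w x) \<phi>"
    by (rule leray_inner[OF g lL AE \<phi>])
  also have "\<dots> = L2_inner g \<phi>"
    by (rule L2_inner_cong_AE[OF lL trig_poly_L2[OF g] Vspace_L2[OF \<phi>] Vspace_L2[OF \<phi>] AE]) simp
  also have "\<dots> = - (\<Sum>i\<in>UNIV. L2_inner (?c i (?c i w)) \<phi>)"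
  proof -
    have "L2_inner g \<phi> = - L2_inner (\<lambda>x. \<Sum>i\<in>UNIV. ?c i (?c i w) x) \<phi>"
      using L2_inner_scaleR_left[of "-1" "\<lambda>x. \<Sum>i\<in>UNIV. ?c i (?c i w) x" \<phi>] by (simp add: g_def[abs_def])
    also have "L2_inner (\<lambda>x. \<Sum>i\<in>UNIV. ?c i (?c i w) x) \<phi> = (\<Sum>i\<in>UNIV. L2_inner (?c i (?c i w)) \<phi>)"
      by (intro L2_inner_sum_left trig_poly_L2 trig_poly_classical_partial t Vspace_L2 \<phi>)
    finally show ?thesis .
  qed
  also have "\<dots> = (\<Sum>i\<in>UNIV. L2_inner (?c i w) (?w i \<phi>))"
    by (simp add: L2_inner_classical_partial[OF trig_poly_classical_partial[OF t] Hs_1_has_weak_partial[OF \<phi>1]] sum_negf)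
  also have "\<dots> = grad_inner w \<phi>"
    unfolding grad_inner_def
  proof (rule sum.cong[OF refl])
    fix i
    have "AE x in torus. ?c i w x = ?w i w x"
      using weak_partial_trig_poly[OF t, of i] by (rule eventually_mono) simp
    then show "L2_inner (?c i w) (?w i \<phi>) = L2_inner (?w i w) (?w i \<phi>)"
      by (rule L2_inner_cong_AE[OF trig_poly_L2[OF trig_poly_classical_partial[OF t]] weak_partial_L2[OF VpolyD(4)[OF w]]
            weak_partial_L2[OF \<phi>1] weak_partial_L2[OF \<phi>1]]) simp
  qed
  finally show ?thesis .
qed

lemma extends_A_grad_inner: "extends_A grad_inner"
  unfolding extends_A_def
proof (intro conjI ballI)
  show "linear_on_V (grad_inner w)" if "w \<in> Vspace" for w
  proof -
    have "grad_inner w = (\<lambda>f. grad_inner f w)" by (rule ext) (rule grad_inner_commute)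
    then show ?thesis using linear_on_V_grad_inner[OF that] by simp
  qed
  show "\<exists>C. \<forall>w\<in>Vspace. \<forall>\<phi>\<in>Vspace. \<bar>grad_inner w \<phi>\<bar> \<le> C * Hs_norm 1 w * Hs_norm 1 \<phi>"
    by (rule exI[of _ 3]) (simp add: grad_inner_bounded Vspace_Hs_1)
qed (simp_all add: linear_on_V_grad_inner L2_inner_leray_laplacian)

text \<open>
  Since an extension exists, the chosen operator is one; two extensions differ by a bounded form that
  vanishes on the polynomials.
\<close>

theorem A_op_eq:
  assumes "w \<in> Vspace" "\<phi> \<in> Vspace" shows "A_op w \<phi> = grad_inner w \<phi>"
proof -
  have A: "extends_A A_op" unfolding A_op_def by (rule someI[of extends_A, OF extends_A_grad_inner])
  then obtain C where C: "\<And>w \<phi>. w \<in> Vspace \<Longrightarrow> \<phi> \<in> Vspace \<Longrightarrow> \<bar>A_op w \<phi>\<bar> \<le> C * Hs_norm 1 w * Hs_norm 1 \<phi>"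
    unfolding extends_A_def by blast
  have "A_op w \<phi> - grad_inner w \<phi> = 0"
  proof (rule linear_on_V_vanishes[OF _ _ _ assms(1)])
    show "linear_on_V (\<lambda>w. A_op w \<phi> - grad_inner w \<phi>)"
      using A assms(2) by (intro linear_on_V_diff linear_on_V_grad_inner) (auto simp: extends_A_def)
    fix w assume w: "w \<in> Vspace"
    have "\<bar>A_op w \<phi> - grad_inner w \<phi>\<bar> \<le> \<bar>A_op w \<phi>\<bar> + \<bar>grad_inner w \<phi>\<bar>" by simp
    also have "\<dots> \<le> C * Hs_norm 1 w * Hs_norm 1 \<phi> + 3 * Hs_norm 1 w * Hs_norm 1 \<phi>"
      by (intro add_mono C grad_inner_bounded Vspace_Hs_1 w assms)
    finally show "\<bar>A_op w \<phi> - grad_inner w \<phi>\<bar> \<le> ((C + 3) * Hs_norm 1 \<phi>) * Hs_norm 1 w"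
      by (simp add: algebra_simps)
  next
    fix w assume "w \<in> Vpoly"
    then show "A_op w \<phi> - grad_inner w \<phi> = 0"
      using A assms(2) by (simp add: extends_A_def L2_inner_leray_laplacian)
  qed
  then show ?thesis by simp
qed

subsection \<open>The advection form represents B\<close>

lemma advect_measurable:
  assumes "w1 \<in> Hs 1" "w2 \<in> Hs 1" shows "advect w1 w2 \<in> borel_measurable torus"
proof -
  have "weak_partial i w2 \<in> borel_measurable torus" "(\<lambda>x. w1 x $ i) \<in> borel_measurable torus" for i
    using weak_partial_L2[OF assms(2)] L2_bounded_linear[OF bounded_linear_vec_nth Hs_L2[OF assms(1)]] by (auto dest: L2_measurable)
  then show ?thesis unfolding advect_def[abs_def] by measurable
qed

lemma advect_inner_sum: "advect w1 w2 x \<bullet> \<phi> x = (\<Sum>i\<in>UNIV. w1 x $ i * (weak_partial i w2 x \<bullet> \<phi> x))"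
  by (simp add: advect_def inner_sum_left)

text \<open>
  The product of the outer factors is in \<open>L\<^sup>2\<close> by the embedding into \<open>L\<^sup>4\<close>, and so is the derivative.
\<close>

lemma advect_term:
  assumes w1: "w1 \<in> Hs 1" and w2: "w2 \<in> Hs 1" and \<phi>: "\<phi> \<in> Hs 1"
  shows "integrable torus (\<lambda>x. w1 x $ i * (weak_partial i w2 x \<bullet> \<phi> x))"
    "\<bar>LINT x|torus. w1 x $ i * (weak_partial i w2 x \<bullet> \<phi> x)\<bar>
      \<le> 3 * sqrt embedding_const * Hs_norm 1 w1 * Hs_norm 1 w2 * Hs_norm 1 \<phi>"
proof -
  let ?t = "\<lambda>x. w1 x $ i * (weak_partial i w2 x \<bullet> \<phi> x)"
  let ?N = "\<lambda>x. norm (w1 x) * norm (\<phi> x)" and ?d = "weak_partial i w2"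
  note N = norm_product_L2[OF w1 \<phi>] and d = weak_partial_L2[OF w2, of i]
  have nN: "norm (?N x) = ?N x" for x by simp
  have le: "\<bar>?t x\<bar> \<le> ?N x * norm (?d x)" for x
  proof -
    have "\<bar>?t x\<bar> = \<bar>w1 x $ i\<bar> * \<bar>?d x \<bullet> \<phi> x\<bar>" by (rule abs_mult)
    also have "\<dots> \<le> norm (w1 x) * (norm (?d x) * norm (\<phi> x))"
      by (intro mult_mono component_le_norm_cart Cauchy_Schwarz_ineq2) auto
    finally show ?thesis by (simp only: mult_ac)
  qed
  have intN: "integrable torus (\<lambda>x. ?N x * norm (?d x))"
    using L2_product_integrable[OF N(1) d] unfolding nN .
  have m: "?t \<in> borel_measurable torus"
    using d L2_bounded_linear[OF bounded_linear_vec_nth Hs_L2[OF w1], of i] Hs_L2[OF \<phi>] by measurable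
  show i: "integrable torus ?t"
    by (rule Bochner_Integration.integrable_bound[OF intN m]) (use le in \<open>auto intro: order_trans[OF _ abs_ge_self]\<close>)
  have dn: "(\<lambda>x. norm (?d x)) \<in> L2" by (rule L2_dominated[OF d]) (use d in auto)
  have "\<bar>LINT x|torus. ?t x\<bar> \<le> (LINT x|torus. \<bar>?t x\<bar>)" by (rule integral_abs_bound)
  also have "\<dots> \<le> (LINT x|torus. ?N x * norm (?d x))"
    by (intro integral_mono integrable_abs i intN le)
  also have "\<dots> = L2_inner ?N (\<lambda>x. norm (?d x))" by (simp add: L2_inner_def)
  also have "\<dots> \<le> L2_norm ?N * L2_norm (\<lambda>x. norm (?d x))" using L2_Cauchy_Schwarz[OF N(1) dn] by linarith
  also have "L2_norm (\<lambda>x. norm (?d x)) = L2_norm ?d" by (simp add: L2_norm_def)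
  also have "L2_norm ?N * L2_norm ?d \<le> (3 * sqrt embedding_const * Hs_norm 1 w1 * Hs_norm 1 \<phi>) * Hs_norm 1 w2"
    by (intro mult_mono N weak_partial_norm_le w2) (auto simp: embedding_const_nonneg)
  finally show "\<bar>LINT x|torus. ?t x\<bar> \<le> 3 * sqrt embedding_const * Hs_norm 1 w1 * Hs_norm 1 w2 * Hs_norm 1 \<phi>"
    by (simp only: mult_ac)
qed

lemma advect_integrable:
  assumes "w1 \<in> Hs 1" "w2 \<in> Hs 1" "\<phi> \<in> Hs 1"
  shows "integrable torus (\<lambda>x. advect w1 w2 x \<bullet> \<phi> x)"
  unfolding advect_inner_sum by (intro Bochner_Integration.integrable_sum advect_term assms)

lemma advect_bounded:
  assumes "w1 \<in> Hs 1" "w2 \<in> Hs 1" "\<phi> \<in> Hs 1"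
  shows "\<bar>L2_inner (advect w1 w2) \<phi>\<bar> \<le> 9 * sqrt embedding_const * Hs_norm 1 w1 * Hs_norm 1 w2 * Hs_norm 1 \<phi>"
proof -
  have "L2_inner (advect w1 w2) \<phi> = (\<Sum>i\<in>UNIV. LINT x|torus. w1 x $ i * (weak_partial i w2 x \<bullet> \<phi> x))"
    unfolding L2_inner_def advect_inner_sum by (intro Bochner_Integration.integral_sum advect_term assms)
  also have "\<bar>\<dots>\<bar> \<le> (\<Sum>i\<in>UNIV. \<bar>LINT x|torus. w1 x $ i * (weak_partial i w2 x \<bullet> \<phi> x)\<bar>)" by (rule sum_abs)
  also have "\<dots> \<le> (\<Sum>i\<in>(UNIV::3 set). 3 * sqrt embedding_const * Hs_norm 1 w1 * Hs_norm 1 w2 * Hs_norm 1 \<phi>)"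
    by (intro sum_mono advect_term assms)
  finally show ?thesis by simp
qed

lemma linear_advect_3:
  "w1 \<in> Vspace \<Longrightarrow> w2 \<in> Vspace \<Longrightarrow> linear_on_V (\<lambda>\<phi>. L2_inner (advect w1 w2) \<phi>)"
  by (auto simp: linear_on_V_def L2_inner_scaleR_right, simp add: L2_inner_def inner_add_right advect_integrable Vspace_Hs_1)

lemma linear_advect_1:
  assumes "w2 \<in> Vspace" "\<phi> \<in> Vspace" shows "linear_on_V (\<lambda>w1. L2_inner (advect w1 w2) \<phi>)"
proof -
  have "advect (\<lambda>x. f x + g x) w2 = (\<lambda>x. advect f w2 x + advect g w2 x)" for f g
    by (rule ext) (simp add: advect_def scaleR_add_left sum.distrib)
  moreover have "advect (\<lambda>x. c *\<^sub>R f x) w2 = (\<lambda>x. c *\<^sub>R advect f w2 x)" for c f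
    by (rule ext) (simp add: advect_def scaleR_sum_right)
  ultimately show ?thesis
    using assms by (auto simp: linear_on_V_def L2_inner_scaleR_left)
      (simp add: L2_inner_def inner_add_left advect_integrable Vspace_Hs_1)
qed

lemma linear_advect_2:
  assumes w1: "w1 \<in> Vspace" and \<phi>: "\<phi> \<in> Vspace" shows "linear_on_V (\<lambda>w2. L2_inner (advect w1 w2) \<phi>)"
  unfolding linear_on_V_def
proof (intro conjI ballI allI)
  note h = Vspace_Hs_1[OF w1] Vspace_Hs_1[OF \<phi>]
  fix f g assume fg: "f \<in> Vspace" "g \<in> Vspace"
  note f = Vspace_Hs_1[OF fg(1)] and g = Vspace_Hs_1[OF fg(2)]
  have "AE x in torus. \<forall>i\<in>UNIV. weak_partial i (\<lambda>x. f x + g x) x = weak_partial i f x + weak_partial i g x"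
    by (intro AE_finite_allI weak_partial_add f g) simp
  then have "AE x in torus. advect w1 (\<lambda>x. f x + g x) x \<bullet> \<phi> x = advect w1 f x \<bullet> \<phi> x + advect w1 g x \<bullet> \<phi> x"
    by eventually_elim (simp add: advect_inner_sum inner_add_left distrib_left sum.distrib)
  then have "L2_inner (advect w1 (\<lambda>x. f x + g x)) \<phi> = (LINT x|torus. advect w1 f x \<bullet> \<phi> x + advect w1 g x \<bullet> \<phi> x)"
    unfolding L2_inner_def
    by (intro integral_cong_AE borel_measurable_integrable advect_integrable Bochner_Integration.integrable_add h f g Hs_add)
  then show "L2_inner (advect w1 (\<lambda>x. f x + g x)) \<phi> = L2_inner (advect w1 f) \<phi> + L2_inner (advect w1 g) \<phi>"
    by (simp add: L2_inner_def advect_integrable h f g)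
next
  note h = Vspace_Hs_1[OF w1] Vspace_Hs_1[OF \<phi>]
  fix c f assume "f \<in> Vspace"
  then have f: "f \<in> Hs 1" by (rule Vspace_Hs_1)
  have "AE x in torus. \<forall>i\<in>UNIV. weak_partial i (\<lambda>x. c *\<^sub>R f x) x = c *\<^sub>R weak_partial i f x"
    by (intro AE_finite_allI weak_partial_scaleR f) simp
  then have "AE x in torus. advect w1 (\<lambda>x. c *\<^sub>R f x) x \<bullet> \<phi> x = c * (advect w1 f x \<bullet> \<phi> x)"
    by eventually_elim (simp add: advect_inner_sum sum_distrib_left mult_ac)
  then have "L2_inner (advect w1 (\<lambda>x. c *\<^sub>R f x)) \<phi> = (LINT x|torus. c * (advect w1 f x \<bullet> \<phi> x))"
    unfolding L2_inner_def
    by (intro integral_cong_AE borel_measurable_integrable advect_integrable integrable_mult_right h f Hs_scaleR)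
  then show "L2_inner (advect w1 (\<lambda>x. c *\<^sub>R f x)) \<phi> = c * L2_inner (advect w1 f) \<phi>"
    by (simp add: L2_inner_def)
qed

lemma advect_trig_poly:
  assumes "trig_poly w1" "trig_poly w2"
  shows "trig_poly (\<lambda>x. \<Sum>i\<in>UNIV. (w1 x $ i) *\<^sub>R classical_partial i w2 x)"
    "AE x in torus. advect w1 w2 x = (\<Sum>i\<in>UNIV. (w1 x $ i) *\<^sub>R classical_partial i w2 x)"
proof -
  show "trig_poly (\<lambda>x. \<Sum>i\<in>UNIV. (w1 x $ i) *\<^sub>R classical_partial i w2 x)"
    by (intro trig_poly_sum trig_poly_mult trig_poly_nth trig_poly_classical_partial assms)
  have "AE x in torus. \<forall>i\<in>UNIV. weak_partial i w2 x = classical_partial i w2 x"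
    by (intro AE_finite_allI weak_partial_trig_poly assms) simp
  then show "AE x in torus. advect w1 w2 x = (\<Sum>i\<in>UNIV. (w1 x $ i) *\<^sub>R classical_partial i w2 x)"
    by eventually_elim (simp add: advect_def)
qed

lemma advect_trig_poly_L2:
  assumes "trig_poly w1" "trig_poly w2" shows "advect w1 w2 \<in> L2"
  by (rule L2_cong_AE[OF trig_poly_L2[OF advect_trig_poly(1)[OF assms]]])
     (use advect_trig_poly(2)[OF assms] in \<open>auto intro: advect_measurable trig_poly_Hs_1 assms\<close>)

lemma extends_B_advect: "extends_B (\<lambda>w1 w2 \<phi>. L2_inner (advect w1 w2) \<phi>)"
  unfolding extends_B_def
proof (intro conjI ballI)
  show "\<exists>C. \<forall>w1\<in>Vspace. \<forall>w2\<in>Vspace. \<forall>\<phi>\<in>Vspace.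
      \<bar>L2_inner (advect w1 w2) \<phi>\<bar> \<le> C * Hs_norm 1 w1 * Hs_norm 1 w2 * Hs_norm 1 \<phi>"
    by (intro exI[of _ "9 * sqrt embedding_const"] ballI advect_bounded Vspace_Hs_1)
  show "L2_inner (advect w1 w2) \<phi> = L2_inner (leray (advect w1 w2)) \<phi>"
    if "w1 \<in> Vpoly" "w2 \<in> Vpoly" "\<phi> \<in> Vspace" for w1 w2 \<phi>
    using advect_trig_poly[OF VpolyD(1) VpolyD(1), OF that(1,2)] advect_trig_poly_L2[OF VpolyD(1) VpolyD(1), OF that(1,2)]
    by (intro leray_inner[symmetric] that)
qed (intro linear_advect_1 linear_advect_2 linear_advect_3; assumption)+

text \<open>
  As for \<open>A\<close>, but both arguments have to be extended: first the second one with the first one a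
  polynomial, then the first one with the second one arbitrary.
\<close>

theorem B_op_eq:
  assumes w1: "w1 \<in> Vspace" and w2: "w2 \<in> Vspace" and \<phi>: "\<phi> \<in> Vspace"
  shows "B_op w1 w2 \<phi> = L2_inner (advect w1 w2) \<phi>"
proof -
  have B: "extends_B B_op" unfolding B_op_def by (rule someI[of extends_B, OF extends_B_advect])
  then obtain C where C: "\<And>w1 w2 \<phi>. w1 \<in> Vspace \<Longrightarrow> w2 \<in> Vspace \<Longrightarrow> \<phi> \<in> Vspace \<Longrightarrow>
      \<bar>B_op w1 w2 \<phi>\<bar> \<le> C * Hs_norm 1 w1 * Hs_norm 1 w2 * Hs_norm 1 \<phi>"
    unfolding extends_B_def by blast
  let ?d = "\<lambda>w1 w2. B_op w1 w2 \<phi> - L2_inner (advect w1 w2) \<phi>"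
  let ?C = "C + 9 * sqrt embedding_const"
  have bd: "\<bar>?d v w\<bar> \<le> ?C * Hs_norm 1 v * Hs_norm 1 w * Hs_norm 1 \<phi>" if "v \<in> Vspace" "w \<in> Vspace" for v w
  proof -
    have "\<bar>?d v w\<bar> \<le> \<bar>B_op v w \<phi>\<bar> + \<bar>L2_inner (advect v w) \<phi>\<bar>" by simp
    also have "\<dots> \<le> C * Hs_norm 1 v * Hs_norm 1 w * Hs_norm 1 \<phi> + 9 * sqrt embedding_const * Hs_norm 1 v * Hs_norm 1 w * Hs_norm 1 \<phi>"
      by (intro add_mono C advect_bounded Vspace_Hs_1 that \<phi>)
    finally show ?thesis by (simp only: distrib_right)
  qed
  have lin: "linear_on_V (\<lambda>w. ?d v w)" "linear_on_V (\<lambda>w. ?d w v)" if "v \<in> Vspace" for v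
    using B that \<phi> by (auto intro!: linear_on_V_diff linear_advect_1 linear_advect_2 simp: extends_B_def)
  have poly: "?d v w = 0" if v: "v \<in> Vpoly" and w: "w \<in> Vspace" for v w
  proof (rule linear_on_V_vanishes[OF lin(1) _ _ w])
    show V: "v \<in> Vspace" by (rule Vpoly_subset_Vspace[OF v])
    show "\<bar>?d v z\<bar> \<le> (?C * Hs_norm 1 v * Hs_norm 1 \<phi>) * Hs_norm 1 z" if "z \<in> Vspace" for z
      using bd[OF V that] by (simp only: mult_ac)
    show "?d v z = 0" if "z \<in> Vpoly" for z
      using B extends_B_advect v that \<phi> unfolding extends_B_def by simp
  qed
  have "?d w1 w2 = 0"
  proof (rule linear_on_V_vanishes[OF lin(2)[OF w2] _ _ w1])
    show "\<bar>?d z w2\<bar> \<le> (?C * Hs_norm 1 w2 * Hs_norm 1 \<phi>) * Hs_norm 1 z" if "z \<in> Vspace" for z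
      using bd[OF that w2] by (simp only: mult_ac)
    show "?d z w2 = 0" if "z \<in> Vpoly" for z by (rule poly[OF that w2])
  qed
  then show ?thesis by simp
qed

subsection \<open>Cancellation and the gradient bound\<close>

text \<open>
  For polynomials the integrand is \<open>v \<bullet> \<nabla>(\<bar>w\<bar>\<^sup>2 / 2)\<close>, the product of a solenoidal field and a gradient.
\<close>

lemma advect_cancel_poly:
  assumes v: "v \<in> Vpoly" and w: "w \<in> Vpoly" shows "L2_inner (advect v w) w = 0"
proof -
  note tv = VpolyD(1)[OF v] and tw = VpolyD(1)[OF w]
  have q: "trig_poly (\<lambda>x. (1/2) *\<^sub>R (w x \<bullet> w x))" by (intro trig_poly_cmul trig_poly_inner tw)
  have cq: "classical_partial i (\<lambda>x. (1/2) *\<^sub>R (w x \<bullet> w x)) = (\<lambda>x. classical_partial i w x \<bullet> w x)" for i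
  proof
    fix x
    note D = trig_poly_has_derivative[OF tw, of x]
    have "((\<lambda>x. (1/2) *\<^sub>R (w x \<bullet> w x)) has_derivative
        (\<lambda>h. (1/2) *\<^sub>R (w x \<bullet> frechet_derivative w (at x) h + frechet_derivative w (at x) h \<bullet> w x))) (at x)"
      by (intro has_derivative_scaleR_right has_derivative_inner D)
    from classical_partialI[OF this, of i]
    show "classical_partial i (\<lambda>x. (1/2) *\<^sub>R (w x \<bullet> w x)) x = classical_partial i w x \<bullet> w x"
      by (simp add: classical_partial_def inner_commute)
  qed
  have "L2_inner (\<lambda>x. \<chi> i. classical_partial i w x \<bullet> w x) v = 0"
    using trig_poly_has_weak_partial[OF q] unfolding cq by (rule gradient_orthogonal_Vpoly[OF _ v])
  moreover have "L2_inner (advect v w) w = L2_inner (\<lambda>x. \<Sum>i\<in>UNIV. (v x $ i) *\<^sub>R classical_partial i w x) w"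
    using advect_trig_poly(2)[OF tv tw]
    by (intro L2_inner_cong_AE advect_trig_poly_L2 trig_poly_L2 advect_trig_poly(1) tv tw) auto
  moreover have "L2_inner (\<lambda>x. \<Sum>i\<in>UNIV. (v x $ i) *\<^sub>R classical_partial i w x) w
      = L2_inner (\<lambda>x. \<chi> i. classical_partial i w x \<bullet> w x) v"
    by (simp add: L2_inner_def inner_sum_left inner_vec_def[of _ "v _"] mult.commute)
  ultimately show ?thesis by simp
qed

text \<open>
  By polarisation the cancellation becomes a trilinear identity, which extends from polynomials to
  \<open>V\<close> in one argument at a time.
\<close>

theorem advect_cancel:
  assumes v: "v \<in> Vspace" and w: "w \<in> Vspace" shows "L2_inner (advect v w) w = 0"
proof -
  let ?s = "\<lambda>v w z. L2_inner (advect v w) z + L2_inner (advect v z) w"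
  let ?C = "18 * sqrt embedding_const"
  have bd: "\<bar>?s v w z\<bar> \<le> ?C * Hs_norm 1 v * Hs_norm 1 w * Hs_norm 1 z" if "v \<in> Vspace" "w \<in> Vspace" "z \<in> Vspace" for v w z
  proof -
    have "\<bar>?s v w z\<bar> \<le> \<bar>L2_inner (advect v w) z\<bar> + \<bar>L2_inner (advect v z) w\<bar>" by simp
    also have "\<dots> \<le> 9 * sqrt embedding_const * Hs_norm 1 v * Hs_norm 1 w * Hs_norm 1 z
        + 9 * sqrt embedding_const * Hs_norm 1 v * Hs_norm 1 z * Hs_norm 1 w"
      by (intro add_mono advect_bounded Vspace_Hs_1 that)
    finally show ?thesis by (simp add: mult_ac)
  qed
  have lin1: "linear_on_V (\<lambda>v. ?s v w z)" and lin2: "linear_on_V (\<lambda>w. ?s v w z)" and lin3: "linear_on_V (\<lambda>z. ?s v w z)"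
    if "v \<in> Vspace" "w \<in> Vspace" "z \<in> Vspace" for v w z
    using that by (auto intro!: linear_on_V_add linear_advect_1 linear_advect_2 linear_advect_3)
  note V = Vpoly_subset_Vspace
  have s0: "?s v w z = 0" if v: "v \<in> Vpoly" and w: "w \<in> Vpoly" and z: "z \<in> Vpoly" for v w z
  proof -
    note l2 = linear_on_VD(1)[OF linear_advect_2 V[OF w] V[OF z]] and l3 = linear_on_VD(1)[OF linear_advect_3 V[OF w] V[OF z]]
    have "0 = L2_inner (advect v (\<lambda>x. w x + z x)) (\<lambda>x. w x + z x)"
      using advect_cancel_poly[OF v Vpoly_add[OF w z]] by simp
    also have "\<dots> = L2_inner (advect v w) w + L2_inner (advect v w) z + (L2_inner (advect v z) w + L2_inner (advect v z) z)"
      by (simp add: l2 l3 V v w z Vspace_add)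
    also have "\<dots> = ?s v w z" by (simp add: advect_cancel_poly v w z)
    finally show ?thesis ..
  qed
  have s1: "?s v w z = 0" if v: "v \<in> Vspace" and w: "w \<in> Vpoly" and z: "z \<in> Vpoly" for v w z
  proof (rule linear_on_V_vanishes[OF lin1[OF v V[OF w] V[OF z]] _ _ v])
    show "\<bar>?s y w z\<bar> \<le> (?C * Hs_norm 1 w * Hs_norm 1 z) * Hs_norm 1 y" if "y \<in> Vspace" for y
      using bd[OF that V[OF w] V[OF z]] by (simp only: mult_ac)
  qed (rule s0[OF _ w z])
  have s2: "?s v w z = 0" if v: "v \<in> Vspace" and w: "w \<in> Vspace" and z: "z \<in> Vpoly" for v w z
  proof (rule linear_on_V_vanishes[OF lin2[OF v w V[OF z]] _ _ w])
    show "\<bar>?s v y z\<bar> \<le> (?C * Hs_norm 1 v * Hs_norm 1 z) * Hs_norm 1 y" if "y \<in> Vspace" for y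
      using bd[OF v that V[OF z]] by (simp only: mult_ac)
  qed (rule s1[OF v _ z])
  have "?s v w w = 0"
  proof (rule linear_on_V_vanishes[OF lin3[OF v w w] _ _ w])
    show "\<bar>?s v w y\<bar> \<le> (?C * Hs_norm 1 v * Hs_norm 1 w) * Hs_norm 1 y" if "y \<in> Vspace" for y
      using bd[OF v w that] by (simp only: mult_ac)
  qed (rule s2[OF v w])
  then show ?thesis by simp
qed

theorem advect_gradient_bound:
  assumes v: "v \<in> Hs 3" and w: "w \<in> Hs 1"
  shows "\<bar>L2_inner (advect w v) w\<bar> \<le> 9 * sqrt embedding_const * Hs_norm 3 v * (L2_norm w)\<^sup>2"
proof -
  let ?M = "3 * sqrt embedding_const * Hs_norm 3 v"
  have v1: "v \<in> Hs 1" by (rule Hs_mono[OF _ v]) simp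
  have "AE x in torus. \<forall>i\<in>UNIV. norm (weak_partial i v x) \<le> ?M"
    by (intro AE_finite_allI weak_partial_bounded v) simp
  then have le: "AE x in torus. \<bar>advect w v x \<bullet> w x\<bar> \<le> 3 * ?M * (norm (w x))\<^sup>2"
  proof eventually_elim
    case (elim x)
    have "\<bar>advect w v x \<bullet> w x\<bar> \<le> (\<Sum>i\<in>UNIV. \<bar>w x $ i * (weak_partial i v x \<bullet> w x)\<bar>)"
      unfolding advect_inner_sum by (rule sum_abs)
    also have "\<dots> \<le> (\<Sum>i\<in>(UNIV::3 set). norm (w x) * (?M * norm (w x)))"
    proof (rule sum_mono)
      fix i :: 3
      have "\<bar>weak_partial i v x \<bullet> w x\<bar> \<le> norm (weak_partial i v x) * norm (w x)" by (rule Cauchy_Schwarz_ineq2)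
      also have "\<dots> \<le> ?M * norm (w x)" using elim by (intro mult_right_mono) auto
      finally show "\<bar>w x $ i * (weak_partial i v x \<bullet> w x)\<bar> \<le> norm (w x) * (?M * norm (w x))"
        unfolding abs_mult by (intro mult_mono component_le_norm_cart) auto
    qed
    finally show ?case by (simp add: power2_eq_square mult_ac)
  qed
  have "\<bar>L2_inner (advect w v) w\<bar> \<le> (LINT x|torus. \<bar>advect w v x \<bullet> w x\<bar>)"
    unfolding L2_inner_def by (rule integral_abs_bound)
  also have "\<dots> \<le> (LINT x|torus. 3 * ?M * (norm (w x))\<^sup>2)"
    by (intro integral_mono_AE integrable_abs advect_integrable integrable_mult_right L2_integrable_sq Hs_L2[OF w] w v1 le)
  also have "\<dots> = 9 * sqrt embedding_const * Hs_norm 3 v * (L2_norm w)\<^sup>2"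
    by (simp add: L2_norm_sq_integral)
  finally show ?thesis .
qed

section \<open>Curves in Sobolev spaces\<close>

lemma tendsto_Hs_norm_mono:
  assumes "\<And>\<tau>. \<tau> \<in> J \<Longrightarrow> f \<tau> \<in> Hs r" "q \<le> r" "((\<lambda>\<tau>. Hs_norm r (f \<tau>)) \<longlongrightarrow> 0) (at t within J)"
  shows "((\<lambda>\<tau>. Hs_norm q (f \<tau>)) \<longlongrightarrow> 0) (at t within J)"
proof (rule Lim_null_comparison[OF _ assms(3)])
  show "\<forall>\<^sub>F \<tau> in at t within J. norm (Hs_norm q (f \<tau>)) \<le> Hs_norm r (f \<tau>)"
    using Hs_mono(2)[OF assms(2,1)] by (auto simp: eventually_at_filter)
qed

lemma tendsto_Hs_norm_diff:
  assumes "\<And>\<tau>. \<tau> \<in> J \<Longrightarrow> f \<tau> \<in> Hs r" "\<And>\<tau>. \<tau> \<in> J \<Longrightarrow> g \<tau> \<in> Hs r"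
    and lim: "((\<lambda>\<tau>. Hs_norm r (f \<tau>)) \<longlongrightarrow> 0) (at t within J)" "((\<lambda>\<tau>. Hs_norm r (g \<tau>)) \<longlongrightarrow> 0) (at t within J)"
  shows "((\<lambda>\<tau>. Hs_norm r (\<lambda>x. f \<tau> x - g \<tau> x)) \<longlongrightarrow> 0) (at t within J)"
proof (rule Lim_null_comparison)
  have "Hs_norm r (\<lambda>x. f \<tau> x - g \<tau> x) \<le> 2 * (Hs_norm r (f \<tau>) + Hs_norm r (g \<tau>))" if "\<tau> \<in> J" for \<tau>
    using Hs_add(2)[OF assms(1)[OF that] Hs_scaleR[OF assms(2)[OF that], of "-1"]] Hs_norm_scaleR[of r "-1" "g \<tau>"] by simp
  then show "\<forall>\<^sub>F \<tau> in at t within J. norm (Hs_norm r (\<lambda>x. f \<tau> x - g \<tau> x)) \<le> 2 * (Hs_norm r (f \<tau>) + Hs_norm r (g \<tau>))"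
    by (auto simp: eventually_at_filter)
  show "((\<lambda>\<tau>. 2 * (Hs_norm r (f \<tau>) + Hs_norm r (g \<tau>))) \<longlongrightarrow> 0) (at t within J)"
    using tendsto_mult[OF tendsto_const tendsto_add[OF lim], of 2] by simp
qed

lemma curve_C0_imp_V:
  assumes "curve_C0 J (Hs r \<inter> Vspace) (Hs_norm r) u" "1 \<le> r"
  shows "curve_C0 J Vspace (Hs_norm 1) u"
  unfolding curve_C0_def
proof (intro ballI conjI)
  have u: "u \<tau> \<in> Hs r" "u \<tau> \<in> Vspace" if "\<tau> \<in> J" for \<tau>
    using assms(1) that by (auto simp: curve_C0_def)
  fix t assume t: "t \<in> J"
  show "u t \<in> Vspace" by (rule u(2)[OF t])
  show "((\<lambda>\<tau>. Hs_norm 1 (\<lambda>x. u \<tau> x - u t x)) \<longlongrightarrow> 0) (at t within J)"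
    using assms(1) t by (intro tendsto_Hs_norm_mono[OF Hs_diff[OF u(1) u(1)[OF t]] assms(2)]) (auto simp: curve_C0_def)
qed

lemma curve_C1_imp_V:
  assumes "curve_C1 J (Hs r \<inter> Vspace) (Hs_norm r) u u'" "1 \<le> r"
  shows "curve_C1 J Vspace (Hs_norm 1) u u'"
  unfolding curve_C1_def
proof (intro ballI conjI)
  show "curve_C0 J Vspace (Hs_norm 1) u" "curve_C0 J Vspace (Hs_norm 1) u'"
    using assms by (auto simp: curve_C1_def intro: curve_C0_imp_V)
  have u: "u \<tau> \<in> Hs r" "u' \<tau> \<in> Hs r" if "\<tau> \<in> J" for \<tau>
    using assms(1) that by (auto simp: curve_C0_def curve_C1_def)
  fix t assume t: "t \<in> J"
  show "((\<lambda>\<tau>. Hs_norm 1 (\<lambda>x. (1 / (\<tau> - t)) *\<^sub>R (u \<tau> x - u t x) - u' t x)) \<longlongrightarrow> 0) (at t within J)"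
    using assms(1) t
    by (intro tendsto_Hs_norm_mono[OF Hs_diff[OF Hs_scaleR[OF Hs_diff[OF u(1) u(1)[OF t]]] u(2)[OF t]] assms(2)])
       (auto simp: curve_C1_def)
qed

lemma curve_C0_subset: "curve_C0 J X N u \<Longrightarrow> I \<subseteq> J \<Longrightarrow> curve_C0 I X N u"
  unfolding curve_C0_def by (blast intro: tendsto_within_subset)

lemma curve_C1_subset: "curve_C1 J X N u u' \<Longrightarrow> I \<subseteq> J \<Longrightarrow> curve_C1 I X N u u'"
  unfolding curve_C1_def by (blast intro: tendsto_within_subset curve_C0_subset)

lemma curve_C0_diff:
  assumes "curve_C0 J Vspace (Hs_norm 1) u" "curve_C0 J Vspace (Hs_norm 1) v"
  shows "curve_C0 J Vspace (Hs_norm 1) (\<lambda>t x. u t x - v t x)"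
  unfolding curve_C0_def
proof (intro ballI conjI)
  fix t assume t: "t \<in> J"
  have uv: "u \<tau> \<in> Vspace" "v \<tau> \<in> Vspace" if "\<tau> \<in> J" for \<tau>
    using assms that by (auto simp: curve_C0_def)
  note h = uv[THEN Vspace_Hs_1]
  show "(\<lambda>x. u t x - v t x) \<in> Vspace" by (intro Vspace_diff uv t)
  have "((\<lambda>\<tau>. Hs_norm 1 (\<lambda>x. (u \<tau> x - u t x) - (v \<tau> x - v t x))) \<longlongrightarrow> 0) (at t within J)"
    using assms t by (intro tendsto_Hs_norm_diff[OF Hs_diff[OF h(1) h(1)[OF t]] Hs_diff[OF h(2) h(2)[OF t]]])
      (auto simp: curve_C0_def)
  then show "((\<lambda>\<tau>. Hs_norm 1 (\<lambda>x. u \<tau> x - v \<tau> x - (u t x - v t x))) \<longlongrightarrow> 0) (at t within J)"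
    by (simp add: algebra_simps)
qed

lemma curve_C1_diff:
  assumes "curve_C1 J Vspace (Hs_norm 1) u u'" "curve_C1 J Vspace (Hs_norm 1) v v'"
  shows "curve_C1 J Vspace (Hs_norm 1) (\<lambda>t x. u t x - v t x) (\<lambda>t x. u' t x - v' t x)"
  unfolding curve_C1_def
proof (intro ballI conjI)
  show "curve_C0 J Vspace (Hs_norm 1) (\<lambda>t x. u t x - v t x)" "curve_C0 J Vspace (Hs_norm 1) (\<lambda>t x. u' t x - v' t x)"
    using assms by (auto simp: curve_C1_def intro: curve_C0_diff)
  fix t assume t: "t \<in> J"
  have uv: "u \<tau> \<in> Vspace" "v \<tau> \<in> Vspace" "u' \<tau> \<in> Vspace" "v' \<tau> \<in> Vspace" if "\<tau> \<in> J" for \<tau>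
    using assms that by (auto simp: curve_C1_def curve_C0_def)
  note h = uv[THEN Vspace_Hs_1]
  have "((\<lambda>\<tau>. Hs_norm 1 (\<lambda>x. ((1 / (\<tau> - t)) *\<^sub>R (u \<tau> x - u t x) - u' t x) - ((1 / (\<tau> - t)) *\<^sub>R (v \<tau> x - v t x) - v' t x))) \<longlongrightarrow> 0) (at t within J)"
    using assms t
    by (intro tendsto_Hs_norm_diff[OF Hs_diff[OF Hs_scaleR[OF Hs_diff[OF h(1) h(1)[OF t]]] h(3)[OF t]]
          Hs_diff[OF Hs_scaleR[OF Hs_diff[OF h(2) h(2)[OF t]]] h(4)[OF t]]]) (auto simp: curve_C1_def)
  then show "((\<lambda>\<tau>. Hs_norm 1 (\<lambda>x. (1 / (\<tau> - t)) *\<^sub>R (u \<tau> x - v \<tau> x - (u t x - v t x)) - (u' t x - v' t x))) \<longlongrightarrow> 0) (at t within J)"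
    by (simp add: algebra_simps)
qed

text \<open>
  Near each time the norm is bounded by continuity, with the constant of the triangle inequality;
  finitely many neighbourhoods cover the time interval.
\<close>

lemma curve_C0_bounded:
  assumes c: "curve_C0 J X (Hs_norm r) u" and J: "compact J" and X: "X \<subseteq> Hs r"
  obtains M where "\<And>t. t \<in> J \<Longrightarrow> Hs_norm r (u t) \<le> M"
proof -
  have u: "u t \<in> Hs r" if "t \<in> J" for t using c X that by (auto simp: curve_C0_def)
  have "\<exists>d>0. \<forall>\<tau>\<in>J. dist \<tau> t < d \<longrightarrow> Hs_norm r (u \<tau>) \<le> 2 * (1 + Hs_norm r (u t))" if t: "t \<in> J" for t
  proof -
    have "((\<lambda>\<tau>. Hs_norm r (\<lambda>x. u \<tau> x - u t x)) \<longlongrightarrow> 0) (at t within J)"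
      using c t by (simp add: curve_C0_def)
    then have "\<forall>\<^sub>F \<tau> in at t within J. Hs_norm r (\<lambda>x. u \<tau> x - u t x) < 1"
      by (rule order_tendstoD) simp
    then obtain d where d: "d > 0" "\<And>\<tau>. \<tau> \<in> J \<Longrightarrow> \<tau> \<noteq> t \<Longrightarrow> dist \<tau> t < d \<Longrightarrow> Hs_norm r (\<lambda>x. u \<tau> x - u t x) < 1"
      unfolding eventually_at by blast
    have "Hs_norm r (u \<tau>) \<le> 2 * (1 + Hs_norm r (u t))" if \<tau>: "\<tau> \<in> J" "dist \<tau> t < d" for \<tau>
    proof (cases "\<tau> = t")
      case True
      have "Hs_norm r (u t) \<le> 2 * (1 + Hs_norm r (u t))" using Hs_norm_nonneg[of r "u t"] by (simp add: add_increasing)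
      then show ?thesis using True by simp
    next
      case False
      have "Hs_norm r (\<lambda>x. (u \<tau> x - u t x) + u t x) \<le> 2 * (Hs_norm r (\<lambda>x. u \<tau> x - u t x) + Hs_norm r (u t))"
        by (intro Hs_add(2) Hs_diff u \<tau> t)
      then show ?thesis using d(2)[OF \<tau>(1) False \<tau>(2)] by simp
    qed
    then show ?thesis using d(1) by blast
  qed
  then obtain d where d: "\<And>t. t \<in> J \<Longrightarrow> d t > 0"
    "\<And>t \<tau>. t \<in> J \<Longrightarrow> \<tau> \<in> J \<Longrightarrow> dist \<tau> t < d t \<Longrightarrow> Hs_norm r (u \<tau>) \<le> 2 * (1 + Hs_norm r (u t))"
    by metis
  obtain D where D: "D \<subseteq> J" "finite D" "J \<subseteq> (\<Union>t\<in>D. ball t (d t))"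
  proof (rule compactE_image[OF J, of J "\<lambda>t. ball t (d t)"])
    show "J \<subseteq> (\<Union>t\<in>J. ball t (d t))" using d(1) by auto
  qed (use that in auto)
  show thesis
  proof (rule that)
    fix \<tau> assume \<tau>: "\<tau> \<in> J"
    then obtain t where t: "t \<in> D" "dist \<tau> t < d t" using D(3) by (auto simp: dist_commute)
    then have "Hs_norm r (u \<tau>) \<le> 2 * (1 + Hs_norm r (u t))" using d(2) D(1) \<tau> by blast
    also have "\<dots> \<le> (\<Sum>t\<in>D. 2 * (1 + Hs_norm r (u t)))"
      by (rule member_le_sum[OF t(1) _ D(2)]) (simp add: add_nonneg_nonneg)
    finally show "Hs_norm r (u \<tau>) \<le> (\<Sum>t\<in>D. 2 * (1 + Hs_norm r (u t)))" .
  qed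
qed

section \<open>The modulated energy\<close>

definition energy_inner :: "real \<Rightarrow> vfield \<Rightarrow> vfield \<Rightarrow> real" where
  "energy_inner \<alpha> f g = L2_inner f g + \<alpha>\<^sup>2 * grad_inner f g"

lemma grad_inner_nonneg: "0 \<le> grad_inner f f"
  by (simp add: grad_inner_def sum_nonneg)

lemma grad_L2_norm_sq: "(grad_L2_norm f)\<^sup>2 = grad_inner f f"
proof -
  have "0 \<le> (\<Sum>i\<in>UNIV. (L2_norm (weak_partial i f))\<^sup>2)" by (rule sum_nonneg) simp
  then show ?thesis by (simp add: grad_L2_norm_def grad_inner_def L2_norm_sq)
qed

lemma grad_inner_diff_left:
  assumes "f \<in> Hs 1" "g \<in> Hs 1" "h \<in> Hs 1"
  shows "grad_inner (\<lambda>x. f x - g x) h = grad_inner f h - grad_inner g h"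
  using grad_inner_add_left[OF assms(1) Hs_scaleR[OF assms(2), of "-1"] assms(3)] grad_inner_scaleR_left[OF assms(2,3), of "-1"] by simp

lemma grad_inner_add_self:
  assumes "f \<in> Hs 1" "g \<in> Hs 1"
  shows "grad_inner (\<lambda>x. f x + g x) (\<lambda>x. f x + g x) = grad_inner f f + 2 * grad_inner f g + grad_inner g g"
proof -
  let ?s = "\<lambda>x. f x + g x"
  have "grad_inner ?s ?s = grad_inner ?s f + grad_inner ?s g"
    using grad_inner_add_left[OF assms Hs_add(1)[OF assms]]
    by (simp only: grad_inner_commute[of f ?s] grad_inner_commute[of g ?s])
  also have "\<dots> = (grad_inner f f + grad_inner g f) + (grad_inner f g + grad_inner g g)"
    by (simp only: grad_inner_add_left[OF assms assms(1)] grad_inner_add_left[OF assms assms(2)])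
  finally show ?thesis by (simp add: grad_inner_commute[of g f])
qed

lemma grad_inner_ge:
  assumes "f \<in> Hs 1" "g \<in> Hs 1" shows "- 2 * grad_inner f g \<le> grad_inner f f + grad_inner g g"
  using grad_inner_nonneg[of "\<lambda>x. f x + g x"] by (simp add: grad_inner_add_self[OF assms])

lemma grad_inner_add_self_le:
  assumes "f \<in> Hs 1" "g \<in> Hs 1"
  shows "grad_inner (\<lambda>x. f x + g x) (\<lambda>x. f x + g x) \<le> 2 * grad_inner f f + 2 * grad_inner g g"
proof -
  have "0 \<le> grad_inner (\<lambda>x. f x - g x) (\<lambda>x. f x - g x)" by (rule grad_inner_nonneg)
  also have "\<dots> = grad_inner f (\<lambda>x. f x - g x) - grad_inner g (\<lambda>x. f x - g x)"
    by (rule grad_inner_diff_left[OF assms Hs_diff[OF assms]])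
  also have "\<dots> = grad_inner f f - 2 * grad_inner f g + grad_inner g g"
    using grad_inner_diff_left[OF assms assms(1)] grad_inner_diff_left[OF assms assms(2)]
    by (simp add: grad_inner_commute[of f "\<lambda>x. f x - g x"] grad_inner_commute[of g "\<lambda>x. f x - g x"] grad_inner_commute[of g f])
  finally show ?thesis by (simp add: grad_inner_add_self[OF assms])
qed

lemma energy_inner_commute: "energy_inner \<alpha> f g = energy_inner \<alpha> g f"
  by (simp add: energy_inner_def L2_inner_commute grad_inner_commute)

lemma energy_inner_diff_left:
  assumes "f \<in> Hs 1" "g \<in> Hs 1" "h \<in> Hs 1"
  shows "energy_inner \<alpha> (\<lambda>x. f x - g x) h = energy_inner \<alpha> f h - energy_inner \<alpha> g h"
  using assms by (simp add: energy_inner_def grad_inner_diff_left L2_inner_diff_left Hs_L2[where s=1] algebra_simps)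

lemma energy_inner_add_left:
  assumes "f \<in> Hs 1" "g \<in> Hs 1" "h \<in> Hs 1"
  shows "energy_inner \<alpha> (\<lambda>x. f x + g x) h = energy_inner \<alpha> f h + energy_inner \<alpha> g h"
  using assms by (simp add: energy_inner_def grad_inner_add_left L2_inner_add_left Hs_L2[where s=1] algebra_simps)

lemma energy_inner_scaleR_left:
  assumes "f \<in> Hs 1" "h \<in> Hs 1"
  shows "energy_inner \<alpha> (\<lambda>x. c *\<^sub>R f x) h = c * energy_inner \<alpha> f h"
  using assms by (simp add: energy_inner_def grad_inner_scaleR_left L2_inner_scaleR_left algebra_simps)

lemma energy_inner_bounded:
  assumes "f \<in> Hs 1" "g \<in> Hs 1"
  shows "\<bar>energy_inner \<alpha> f g\<bar> \<le> (1 + 3 * \<alpha>\<^sup>2) * (Hs_norm 1 f * Hs_norm 1 g)"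
proof -
  have "\<bar>L2_inner f g\<bar> \<le> L2_norm f * L2_norm g" by (intro L2_Cauchy_Schwarz Hs_L2[where s=1] assms)
  also have "\<dots> \<le> Hs_norm 1 f * Hs_norm 1 g" by (intro mult_mono L2_norm_le_Hs_norm_1 assms) auto
  finally have 1: "\<bar>L2_inner f g\<bar> \<le> Hs_norm 1 f * Hs_norm 1 g" .
  have 2: "\<bar>\<alpha>\<^sup>2 * grad_inner f g\<bar> \<le> \<alpha>\<^sup>2 * (3 * Hs_norm 1 f * Hs_norm 1 g)"
    using mult_left_mono[OF grad_inner_bounded[OF assms], of "\<alpha>\<^sup>2"] by (simp add: abs_mult)
  have "\<bar>energy_inner \<alpha> f g\<bar> \<le> \<bar>L2_inner f g\<bar> + \<bar>\<alpha>\<^sup>2 * grad_inner f g\<bar>"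
    unfolding energy_inner_def by (rule abs_triangle_ineq)
  also have "\<dots> \<le> Hs_norm 1 f * Hs_norm 1 g + \<alpha>\<^sup>2 * (3 * Hs_norm 1 f * Hs_norm 1 g)" using 1 2 by (rule add_mono)
  finally show ?thesis by (simp add: algebra_simps)
qed

text \<open>
  The difference quotient of a quadratic form is the bilinear form of the difference quotient of the
  curve and the sum of the two values.
\<close>

lemma energy_has_derivative:
  assumes c: "curve_C1 J Vspace (Hs_norm 1) w w'" and t: "t \<in> J"
  shows "((\<lambda>\<tau>. energy_inner \<alpha> (w \<tau>) (w \<tau>)) has_real_derivative 2 * energy_inner \<alpha> (w' t) (w t)) (at t within J)"
proof -
  let ?Q = "energy_inner \<alpha>" and ?N = "Hs_norm 1" and ?C = "1 + 3 * \<alpha>\<^sup>2"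
  have w: "w \<tau> \<in> Hs 1" "w' \<tau> \<in> Hs 1" if "\<tau> \<in> J" for \<tau>
    using c that by (auto simp: curve_C1_def curve_C0_def Vspace_Hs_1)
  define q where "q \<tau> = (\<lambda>x. (1 / (\<tau> - t)) *\<^sub>R (w \<tau> x - w t x))" for \<tau>
  define d where "d \<tau> = (\<lambda>x. w \<tau> x - w t x)" for \<tau>
  define r where "r \<tau> = (\<lambda>x. q \<tau> x - w' t x)" for \<tau>
  have dl: "((\<lambda>\<tau>. ?N (d \<tau>)) \<longlongrightarrow> 0) (at t within J)" and rl: "((\<lambda>\<tau>. ?N (r \<tau>)) \<longlongrightarrow> 0) (at t within J)"
    using c t by (auto simp: curve_C1_def curve_C0_def d_def r_def q_def)
  define b where "b \<tau> = ?C * (?N (r \<tau>) * (2 * (?N (d \<tau>) + 2 * ?N (w t)))) + ?C * (?N (w' t) * ?N (d \<tau>))" for \<tau>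
  \<comment> \<open>the error splits into the error of the difference quotient, tested with the sum of the values,
    and the derivative tested with the increment\<close>
  have key: "norm ((?Q (w \<tau>) (w \<tau>) - ?Q (w t) (w t)) / (\<tau> - t) - 2 * ?Q (w' t) (w t)) \<le> b \<tau>" if \<tau>: "\<tau> \<in> J" "\<tau> \<noteq> t" for \<tau>
  proof -
    note W = w[OF \<tau>(1)] w[OF t]
    define s where "s = (\<lambda>x. w \<tau> x + w t x)"
    have D: "d \<tau> \<in> Hs 1" "q \<tau> \<in> Hs 1" "r \<tau> \<in> Hs 1" "s \<in> Hs 1"
      unfolding d_def q_def r_def s_def by (intro Hs_diff Hs_scaleR Hs_add W)+
    have "?Q (w \<tau>) (w \<tau>) - ?Q (w t) (w t) = ?Q (d \<tau>) s"
    proof -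
      have "?Q (d \<tau>) s = ?Q s (w \<tau>) - ?Q s (w t)"
        unfolding d_def using energy_inner_diff_left[OF W(1,3) D(4)]
        by (simp only: energy_inner_commute[of \<alpha> s])
      moreover have "?Q s g = ?Q (w \<tau>) g + ?Q (w t) g" if "g \<in> Hs 1" for g
        unfolding s_def by (rule energy_inner_add_left[OF W(1,3) that])
      ultimately show ?thesis using W by (simp add: energy_inner_commute[of \<alpha> "w t" "w \<tau>"])
    qed
    moreover have "?Q (d \<tau>) s / (\<tau> - t) = ?Q (q \<tau>) s"
      unfolding q_def using energy_inner_scaleR_left[OF D(1,4), of \<alpha> "1 / (\<tau> - t)"] by (simp add: d_def)
    moreover have "?Q (q \<tau>) s = ?Q (r \<tau>) s + ?Q (w' t) s"
      unfolding r_def using D W by (simp add: energy_inner_diff_left)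
    moreover have "?Q (w' t) s = ?Q (w' t) (d \<tau>) + 2 * ?Q (w' t) (w t)"
      using W D unfolding s_def d_def by (simp add: energy_inner_commute[of \<alpha> "w' t"] energy_inner_add_left energy_inner_diff_left)
    ultimately have eq: "(?Q (w \<tau>) (w \<tau>) - ?Q (w t) (w t)) / (\<tau> - t) - 2 * ?Q (w' t) (w t) = ?Q (r \<tau>) s + ?Q (w' t) (d \<tau>)"
      by simp
    have "?N s \<le> 2 * (?N (d \<tau>) + 2 * ?N (w t))"
    proof -
      have "?N (\<lambda>x. d \<tau> x + 2 *\<^sub>R w t x) \<le> 2 * (?N (d \<tau>) + ?N (\<lambda>x. 2 *\<^sub>R w t x))"
        by (intro Hs_add(2) D Hs_scaleR W)
      also have "(\<lambda>x. d \<tau> x + 2 *\<^sub>R w t x) = s" by (rule ext) (simp add: d_def s_def scaleR_2)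
      finally show ?thesis by (simp add: Hs_norm_scaleR)
    qed
    then have "?N (r \<tau>) * ?N s \<le> ?N (r \<tau>) * (2 * (?N (d \<tau>) + 2 * ?N (w t)))" by (rule mult_left_mono) simp
    then have 1: "?C * (?N (r \<tau>) * ?N s) \<le> ?C * (?N (r \<tau>) * (2 * (?N (d \<tau>) + 2 * ?N (w t))))"
      by (rule mult_left_mono) (simp add: add_nonneg_nonneg)
    have "\<bar>?Q (r \<tau>) s + ?Q (w' t) (d \<tau>)\<bar> \<le> \<bar>?Q (r \<tau>) s\<bar> + \<bar>?Q (w' t) (d \<tau>)\<bar>" by (rule abs_triangle_ineq)
    also have "\<dots> \<le> b \<tau>"
      unfolding b_def using 1 energy_inner_bounded[OF D(3,4), of \<alpha>] energy_inner_bounded[OF W(4) D(1), of \<alpha>]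
      by (intro add_mono) (auto intro: order_trans)
    finally show ?thesis by (simp add: eq)
  qed
  have "(b \<longlongrightarrow> ?C * (0 * (2 * (0 + 2 * ?N (w t)))) + ?C * (?N (w' t) * 0)) (at t within J)"
    unfolding b_def by (intro tendsto_add tendsto_mult tendsto_const dl rl)
  then have b0: "(b \<longlongrightarrow> 0) (at t within J)" by simp
  have "\<forall>\<^sub>F \<tau> in at t within J. norm ((?Q (w \<tau>) (w \<tau>) - ?Q (w t) (w t)) / (\<tau> - t) - 2 * ?Q (w' t) (w t)) \<le> b \<tau>"
    using key by (auto simp: eventually_at_filter)
  from Lim_null_comparison[OF this b0] show ?thesis
    unfolding has_field_derivative_iff by (simp add: LIM_zero_iff)
qed

text \<open>
  The function \<open>E t exp (- a t) - b t\<close> is nonincreasing, by the mean value theorem.  The bound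
  is slightly worse than \<open>b (exp (a t) - 1) / a\<close> but also covers \<open>a = 0\<close>.
\<close>

lemma Gronwall_linear:
  fixes E E' :: "real \<Rightarrow> real"
  assumes der: "\<And>t. t \<in> {0..T} \<Longrightarrow> (E has_real_derivative E' t) (at t within {0..T})"
    and le: "\<And>t. t \<in> {0..T} \<Longrightarrow> E' t \<le> a * E t + b" and "E 0 = 0" "0 \<le> a" "0 \<le> b" and t: "t \<in> {0..T}"
  shows "E t \<le> b * t * exp (a * t)"
proof -
  define g where "g s = E s * exp (- a * s) - b * s" for s
  define g' where "g' s = E' s * exp (- a * s) + E s * (exp (- a * s) * - a) - b" for s
  have "(g has_derivative (\<lambda>h. g' s * h)) (at s within {0..t})" if "s \<in> {0..t}" for s
  proof -
    have "(E has_real_derivative E' s) (at s within {0..t})"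
      by (rule DERIV_subset[OF der]) (use that t in auto)
    then have "(g has_real_derivative g' s) (at s within {0..t})"
      unfolding g_def[abs_def] g'_def by (auto intro!: derivative_eq_intros)
    then show ?thesis by (rule has_field_derivative_imp_has_derivative)
  qed
  then obtain s where s: "s \<in> {0..t}" "g t - g 0 = g' s * (t - 0)"
    using mvt_very_simple[of 0 t g "\<lambda>s h. g' s * h"] t by auto
  have "g' s \<le> 0"
  proof -
    have "(E' s - a * E s) * exp (- a * s) \<le> b * exp (- a * s)"
      using le[of s] s t by (intro mult_right_mono) auto
    also have "\<dots> \<le> b * 1" using s assms by (intro mult_left_mono) auto
    finally show ?thesis by (simp add: g'_def algebra_simps)
  qed
  then have "g' s * t \<le> 0" using t by (intro mult_nonpos_nonneg) auto
  then have "g t \<le> 0" using s(2) assms(3) by (simp add: g_def)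
  then have "E t * exp (- a * t) \<le> b * t" by (simp add: g_def)
  then have "E t * exp (- a * t) * exp (a * t) \<le> b * t * exp (a * t)" by (rule mult_right_mono) simp
  then show ?thesis by (simp add: mult.assoc flip: exp_add)
qed

section \<open>The inviscid limit and the blow-up criterion\<close>

text \<open>
  Each term of the equation is integrable against elements of \<open>V\<close>, the advection term by the embedding
  into \<open>L\<^sup>4\<close>, and the pressure gradient is orthogonal to them.
\<close>

lemma euler_weak_form:
  fixes v v' :: vfield and p :: "real^3 \<Rightarrow> real"
  assumes v: "v \<in> Vspace" and v': "v' \<in> Vspace" and p: "\<And>i. \<exists>g. has_weak_partial i p g"
    and eq: "AE x in torus. v' x + advect v v x + (\<chi> i. weak_partial i p x) = 0" and \<phi>: "\<phi> \<in> Vspace"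
  shows "L2_inner v' \<phi> + L2_inner (advect v v) \<phi> = 0"
proof -
  let ?g = "\<lambda>x. (\<chi> i. weak_partial i p x) :: real^3"
  have wp: "has_weak_partial i p (weak_partial i p)" for i
    using p[of i] has_weak_partial_weak_partial by blast
  have g: "?g \<in> L2" by (rule vector_field_L2) (rule has_weak_partialD(2)[OF wp])
  note i1 = L2_inner_integrable[OF Vspace_L2[OF v'] Vspace_L2[OF \<phi>]]
  note i2 = advect_integrable[OF Vspace_Hs_1[OF v] Vspace_Hs_1[OF v] Vspace_Hs_1[OF \<phi>]]
  note i3 = L2_inner_integrable[OF g Vspace_L2[OF \<phi>]]
  have "L2_inner v' \<phi> + L2_inner (advect v v) \<phi> + L2_inner ?g \<phi>
      = (LINT x|torus. v' x \<bullet> \<phi> x + advect v v x \<bullet> \<phi> x + ?g x \<bullet> \<phi> x)"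
    unfolding L2_inner_def using i1 i2 i3 by simp
  also have "\<dots> = (LINT x|torus. 0)"
  proof (rule integral_cong_AE)
    show "(\<lambda>x. v' x \<bullet> \<phi> x + advect v v x \<bullet> \<phi> x + ?g x \<bullet> \<phi> x) \<in> borel_measurable torus"
      by (intro borel_measurable_integrable Bochner_Integration.integrable_add i1 i2 i3)
    show "AE x in torus. v' x \<bullet> \<phi> x + advect v v x \<bullet> \<phi> x + ?g x \<bullet> \<phi> x = 0"
      using eq by eventually_elim (simp flip: inner_add_left)
  qed simp
  finally show ?thesis using gradient_orthogonal_Vspace[OF wp \<phi>] by simp
qed

text \<open>
  Here \<open>a\<close> and \<open>v\<close> are the two velocities at a fixed time and \<open>a'\<close> and \<open>v'\<close> their time derivatives.  Both
  equations are tested with \<open>w\<close>.  By trilinearity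
  \<open>((a \<cdot> \<nabla>) a, w) - ((v \<cdot> \<nabla>) v, w) = ((a \<cdot> \<nabla>) w, w) + ((w \<cdot> \<nabla>) v, w)\<close>, and the first term on
  the right vanishes.  The term \<open>\<alpha>\<^sup>2 A v'\<close>, which the Euler equations lack, is the only source and
  carries the factor \<open>\<alpha>\<^sup>2\<close>.
\<close>

lemma modulated_energy_inequality:
  assumes a: "a \<in> Vspace" and a': "a' \<in> Vspace" and v: "v \<in> Vspace" "v \<in> Hs 3" and v': "v' \<in> Vspace"
    and voigt: "\<And>\<phi>. \<phi> \<in> Vspace \<Longrightarrow> L2_inner a' \<phi> + \<alpha>\<^sup>2 * A_op a' \<phi> + B_op a a \<phi> = 0"
    and euler: "\<And>\<phi>. \<phi> \<in> Vspace \<Longrightarrow> L2_inner v' \<phi> + L2_inner (advect v v) \<phi> = 0"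
  defines "w \<equiv> \<lambda>x. a x - v x" and "w' \<equiv> \<lambda>x. a' x - v' x"
  shows "2 * energy_inner \<alpha> w' w \<le> (18 * sqrt embedding_const * Hs_norm 3 v + 1) * energy_inner \<alpha> w w + \<alpha>\<^sup>2 * (3 * (Hs_norm 1 v')\<^sup>2)"
proof -
  have w: "w \<in> Vspace" and w'V: "w' \<in> Vspace" unfolding w_def w'_def by (intro Vspace_diff a v a' v')+
  note h = Vspace_Hs_1[OF a] Vspace_Hs_1[OF a'] Vspace_Hs_1[OF v(1)] Vspace_Hs_1[OF v'] Vspace_Hs_1[OF w]
  have B: "L2_inner (advect a a) w - L2_inner (advect v v) w = L2_inner (advect w v) w"
  proof -
    have "L2_inner (advect a w) w = L2_inner (advect a a) w - L2_inner (advect a v) w"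
      using linear_on_VD(3)[OF linear_advect_2[OF a w] a v(1)] by (simp add: w_def)
    moreover have "L2_inner (advect w v) w = L2_inner (advect a v) w - L2_inner (advect v v) w"
      using linear_on_VD(3)[OF linear_advect_1[OF v(1) w] a v(1)] by (simp add: w_def)
    moreover have "L2_inner (advect a w) w = 0" by (rule advect_cancel[OF a w])
    ultimately show ?thesis by simp
  qed
  have "energy_inner \<alpha> w' w = energy_inner \<alpha> a' w - energy_inner \<alpha> v' w"
    unfolding w'_def by (rule energy_inner_diff_left[OF h(2,4,5)])
  also have "energy_inner \<alpha> a' w = - L2_inner (advect a a) w"
    using voigt[OF w] by (simp add: A_op_eq[OF a' w] B_op_eq[OF a a w] energy_inner_def)
  also have "energy_inner \<alpha> v' w = - L2_inner (advect v v) w + \<alpha>\<^sup>2 * grad_inner v' w"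
    using euler[OF w] by (simp add: energy_inner_def)
  finally have "2 * energy_inner \<alpha> w' w = - 2 * L2_inner (advect w v) w + \<alpha>\<^sup>2 * (- 2 * grad_inner v' w)"
    using B by simp
  also have "\<dots> \<le> 2 * (9 * sqrt embedding_const * Hs_norm 3 v * (L2_norm w)\<^sup>2) + \<alpha>\<^sup>2 * (grad_inner v' v' + grad_inner w w)"
    using advect_gradient_bound[OF v(2) h(5)] mult_left_mono[OF grad_inner_ge[OF h(4,5)], of "\<alpha>\<^sup>2"] by simp
  also have "\<dots> \<le> (18 * sqrt embedding_const * Hs_norm 3 v + 1) * energy_inner \<alpha> w w + \<alpha>\<^sup>2 * (3 * (Hs_norm 1 v')\<^sup>2)"
  proof -
    let ?K = "18 * sqrt embedding_const * Hs_norm 3 v"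
    have K: "0 \<le> ?K" by (simp add: embedding_const_nonneg)
    have e: "energy_inner \<alpha> w w = (L2_norm w)\<^sup>2 + \<alpha>\<^sup>2 * grad_inner w w" by (simp add: energy_inner_def L2_norm_sq)
    have g0: "0 \<le> \<alpha>\<^sup>2 * grad_inner w w" by (simp add: grad_inner_nonneg)
    have "?K * (L2_norm w)\<^sup>2 \<le> ?K * energy_inner \<alpha> w w" using K g0 by (intro mult_left_mono) (auto simp: e)
    moreover have "\<alpha>\<^sup>2 * grad_inner w w \<le> energy_inner \<alpha> w w" by (simp add: e)
    moreover have "\<alpha>\<^sup>2 * grad_inner v' v' \<le> \<alpha>\<^sup>2 * (3 * (Hs_norm 1 v')\<^sup>2)"
      using grad_inner_bounded[OF h(4,4)] by (intro mult_left_mono) (auto simp: power2_eq_square)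
    ultimately show ?thesis by (simp add: distrib_left distrib_right)
  qed
  finally show ?thesis .
qed

text \<open>
  The constants in the differential inequality come from the \<open>H\<^sup>s\<close> norm of \<open>v\<close> and the \<open>H\<^sup>1\<close> norm of its
  time derivative, both bounded on the compact time interval.  The resulting bound \<open>C \<alpha>\<^sup>2\<close> for the energy
  can be divided by \<open>\<alpha>\<^sup>2\<close>.
\<close>

theorem voigt_gradient_bound:
  assumes "s \<ge> 3" and "euler_solution s T uin v"
    and u: "\<And>\<alpha>. \<alpha> > 0 \<Longrightarrow> euler_voigt_solution \<alpha> uin (u \<alpha>)"
  obtains C where "\<And>\<alpha> t. \<alpha> > 0 \<Longrightarrow> t \<in> {0..T} \<Longrightarrow> (grad_L2_norm (u \<alpha> t))\<^sup>2 \<le> C"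
proof -
  obtain v' where c0: "curve_C0 {0..T} (Hs s \<inter> Vspace) (Hs_norm s) v"
    and c1: "curve_C1 {0..T} (Hs (s - 1) \<inter> Vspace) (Hs_norm (s - 1)) v v'"
    and eq: "\<And>t. t \<in> {0..T} \<Longrightarrow> \<exists>p :: real^3 \<Rightarrow> real. (\<forall>i. \<exists>g. has_weak_partial i p g) \<and>
           (AE x in torus. v' t x + advect (v t) (v t) x + (\<chi> i. weak_partial i p x) = 0)"
    and v0: "AE x in torus. v 0 x = uin x"
    using assms(2) unfolding euler_solution_def by blast
  have c1V: "curve_C1 {0..T} Vspace (Hs_norm 1) v v'" using c1 assms(1) by (intro curve_C1_imp_V[of _ "s - 1"]) auto
  have vV: "v t \<in> Vspace" "v' t \<in> Vspace" "v t \<in> Hs s" if "t \<in> {0..T}" for t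
    using c1V c0 that by (auto simp: curve_C1_def curve_C0_def)
  obtain M where M: "\<And>t. t \<in> {0..T} \<Longrightarrow> Hs_norm s (v t) \<le> M"
    by (rule curve_C0_bounded[OF c0]) auto
  have "curve_C0 {0..T} Vspace (Hs_norm 1) v'" using c1V by (simp add: curve_C1_def)
  then obtain K where K: "\<And>t. t \<in> {0..T} \<Longrightarrow> Hs_norm 1 (v' t) \<le> K"
    by (rule curve_C0_bounded) (auto simp: Vspace_Hs_1)
  define A B where "A = 18 * sqrt embedding_const * \<bar>M\<bar> + 1" and "B = 3 * K\<^sup>2"
  have A: "0 \<le> A" and B: "0 \<le> B" by (auto simp: A_def B_def embedding_const_nonneg add_nonneg_nonneg)
  have "(grad_L2_norm (u \<alpha> t))\<^sup>2 \<le> 2 * (B * T * exp (A * T)) + 6 * M\<^sup>2" if \<alpha>: "\<alpha> > 0" and t: "t \<in> {0..T}" for \<alpha> t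
  proof -
    obtain u' where cu: "curve_C1 UNIV Vspace (Hs_norm 1) (u \<alpha>) u'"
      and voigt: "\<And>t \<phi>. \<phi> \<in> Vspace \<Longrightarrow> L2_inner (u' t) \<phi> + \<alpha>\<^sup>2 * A_op (u' t) \<phi> + B_op (u \<alpha> t) (u \<alpha> t) \<phi> = 0"
      and u0: "AE x in torus. u \<alpha> 0 x = uin x"
      using u[OF \<alpha>] unfolding euler_voigt_solution_def by blast
    have uV: "u \<alpha> t \<in> Vspace" "u' t \<in> Vspace" for t
      using cu by (auto simp: curve_C1_def curve_C0_def)
    define w w' where "w t = (\<lambda>x. u \<alpha> t x - v t x)" and "w' t = (\<lambda>x. u' t x - v' t x)" for t
    have cw: "curve_C1 {0..T} Vspace (Hs_norm 1) w w'"
      unfolding w_def[abs_def] w'_def[abs_def] by (intro curve_C1_diff curve_C1_subset[OF cu] c1V) auto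
    have wV: "w t \<in> Vspace" if "t \<in> {0..T}" for t using cw that by (auto simp: curve_C1_def curve_C0_def)
    let ?E = "\<lambda>t. energy_inner \<alpha> (w t) (w t)"
    have "?E t \<le> (\<alpha>\<^sup>2 * B) * t * exp (A * t)"
    proof (rule Gronwall_linear[where E="?E" and E'="\<lambda>t. 2 * energy_inner \<alpha> (w' t) (w t)", OF energy_has_derivative[OF cw] _ _ A _ t])
      fix t assume t: "t \<in> {0..T}"
      obtain p :: "real^3 \<Rightarrow> real" where p: "\<And>i. \<exists>g. has_weak_partial i p g"
        "AE x in torus. v' t x + advect (v t) (v t) x + (\<chi> i. weak_partial i p x) = 0"
        using eq[OF t] by blast
      have v3: "v t \<in> Hs 3" "Hs_norm 3 (v t) \<le> M"
        using Hs_mono[OF assms(1) vV(3)[OF t]] M[OF t] by auto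
      have "2 * energy_inner \<alpha> (w' t) (w t)
          \<le> (18 * sqrt embedding_const * Hs_norm 3 (v t) + 1) * ?E t + \<alpha>\<^sup>2 * (3 * (Hs_norm 1 (v' t))\<^sup>2)"
        unfolding w_def w'_def
        by (rule modulated_energy_inequality[OF uV vV(1)[OF t] v3(1) vV(2)[OF t] voigt euler_weak_form[OF vV(1,2)[OF t] p]])
      also have "\<dots> \<le> A * ?E t + \<alpha>\<^sup>2 * B"
      proof (rule add_mono)
        have "0 \<le> ?E t" by (simp add: energy_inner_def grad_inner_nonneg)
        moreover have "18 * sqrt embedding_const * Hs_norm 3 (v t) + 1 \<le> A"
          unfolding A_def using v3(2) by (intro add_right_mono mult_left_mono) (auto simp: embedding_const_nonneg)
        ultimately show "(18 * sqrt embedding_const * Hs_norm 3 (v t) + 1) * ?E t \<le> A * ?E t"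
          by (rule mult_right_mono[rotated])
        show "\<alpha>\<^sup>2 * (3 * (Hs_norm 1 (v' t))\<^sup>2) \<le> \<alpha>\<^sup>2 * B"
          unfolding B_def using K[OF t] by (intro mult_left_mono power_mono) auto
      qed
      finally show "2 * energy_inner \<alpha> (w' t) (w t) \<le> A * ?E t + \<alpha>\<^sup>2 * B" .
    next
      have 0: "0 \<in> {0..T}" using t by auto
      have "AE x in torus. w 0 x = 0" using u0 v0 by eventually_elim (simp add: w_def)
      from Hs_norm_0_AE[OF Vspace_L2[OF wV[OF 0]] this] show "?E 0 = 0"
        using energy_inner_bounded[OF Vspace_Hs_1[OF wV[OF 0]] Vspace_Hs_1[OF wV[OF 0]], of \<alpha>] by simp
    qed (use B in auto)
    also have "\<dots> \<le> (\<alpha>\<^sup>2 * B) * T * exp (A * T)"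
      using t A B by (intro mult_mono) (auto intro: mult_left_mono)
    finally have E: "?E t \<le> \<alpha>\<^sup>2 * (B * T * exp (A * T))" by (simp only: mult.assoc)
    have "\<alpha>\<^sup>2 * grad_inner (w t) (w t) \<le> ?E t" by (simp add: energy_inner_def)
    with E have "\<alpha>\<^sup>2 * grad_inner (w t) (w t) \<le> \<alpha>\<^sup>2 * (B * T * exp (A * T))" by linarith
    then have gw: "grad_inner (w t) (w t) \<le> B * T * exp (A * T)" using \<alpha> by (simp add: mult_le_cancel_left)
    note hv = Vspace_Hs_1[OF vV(1)[OF t]] and hw = Vspace_Hs_1[OF wV[OF t]]
    have "grad_inner (v t) (v t) \<le> 3 * Hs_norm 1 (v t) * Hs_norm 1 (v t)"
      using grad_inner_bounded[OF hv hv] by linarith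
    also have "\<dots> \<le> 3 * M * M"
    proof -
      have "Hs_norm 1 (v t) \<le> M" using Hs_mono(2)[of 1 s "v t"] assms(1) vV(3)[OF t] M[OF t] by auto
      then show ?thesis using order_trans[OF Hs_norm_nonneg \<open>Hs_norm 1 (v t) \<le> M\<close>] by (intro mult_mono) auto
    qed
    finally have gv: "grad_inner (v t) (v t) \<le> 3 * M\<^sup>2" by (simp add: power2_eq_square)
    have "grad_inner (u \<alpha> t) (u \<alpha> t) \<le> 2 * grad_inner (w t) (w t) + 2 * grad_inner (v t) (v t)"
      using grad_inner_add_self_le[OF hw hv] by (simp add: w_def)
    then show ?thesis using gw gv by (simp add: grad_L2_norm_sq)
  qed
  then show ?thesis by (rule that)
qed

theorem theorem5p2:
  fixes s T :: real and uin :: vfield and u :: "real \<Rightarrow> real \<Rightarrow> vfield"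
  assumes "s \<ge> 3"
    and "uin \<in> Hs s \<inter> Vspace"
    and "\<And>\<alpha>. \<alpha> > 0 \<Longrightarrow> euler_voigt_solution \<alpha> uin (u \<alpha>)"
    and "T > 0"
    and "(SUP t\<in>{0..<T}. Limsup (at_right 0) (\<lambda>\<alpha>. ereal (\<alpha>\<^sup>2 * (grad_L2_norm (u \<alpha> t))\<^sup>2))) > 0"
  shows "\<not> (\<exists>v. euler_solution s T uin v)"
proof
  assume "\<exists>v. euler_solution s T uin v"
  then obtain v where v: "euler_solution s T uin v" by blast
  obtain C where C: "\<And>\<alpha> t. \<alpha> > 0 \<Longrightarrow> t \<in> {0..T} \<Longrightarrow> (grad_L2_norm (u \<alpha> t))\<^sup>2 \<le> C"
    using voigt_gradient_bound[OF assms(1) v assms(3)] by blast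
  have "Limsup (at_right 0) (\<lambda>\<alpha>. ereal (\<alpha>\<^sup>2 * (grad_L2_norm (u \<alpha> t))\<^sup>2)) \<le> 0" if t: "t \<in> {0..<T}" for t
  proof -
    have t': "t \<in> {0..T}" using t by auto
    have "\<forall>\<^sub>F \<alpha> in at_right 0. norm (\<alpha>\<^sup>2 * (grad_L2_norm (u \<alpha> t))\<^sup>2) \<le> \<alpha>\<^sup>2 * C"
      using eventually_at_right_less[of "0::real"] by eventually_elim (simp add: mult_left_mono C[OF _ t'])
    moreover have "((\<lambda>\<alpha>::real. \<alpha>\<^sup>2 * C) \<longlongrightarrow> 0\<^sup>2 * C) (at_right 0)" by (intro tendsto_intros)
    then have "((\<lambda>\<alpha>::real. \<alpha>\<^sup>2 * C) \<longlongrightarrow> 0) (at_right 0)" by simp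
    ultimately have "((\<lambda>\<alpha>. \<alpha>\<^sup>2 * (grad_L2_norm (u \<alpha> t))\<^sup>2) \<longlongrightarrow> 0) (at_right 0)" by (rule Lim_null_comparison)
    then have "((\<lambda>\<alpha>. ereal (\<alpha>\<^sup>2 * (grad_L2_norm (u \<alpha> t))\<^sup>2)) \<longlongrightarrow> ereal 0) (at_right 0)" by simp
    from lim_imp_Limsup[OF _ this] show ?thesis by simp
  qed
  then have "(SUP t\<in>{0..<T}. Limsup (at_right 0) (\<lambda>\<alpha>. ereal (\<alpha>\<^sup>2 * (grad_L2_norm (u \<alpha> t))\<^sup>2))) \<le> 0"
    by (rule SUP_least)
  then show False using assms(5) by simp
qed

end
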